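(* For fixed $\sigma=(\sigma_1,\sigma_2)\in\Sigma$, \[ \dim_{\mathbb R}\mathcal M_\sigma= \begin{cases} 25,&\sigma_1>\sigma_2>0,\\ 24,&\sigma_1=\sigma_2>0,\\ 24,&\sigma_1>0=\sigma_2,\\ 21,&\sigma_1=\sigma_2=0. \end{cases} \] Moreover, $\dim_{\mathbb R}\mathcal M=27$; its diagonal stratum ($\sigma_1=\sigma_2>0$), coordinate-axis stratum ($\sigma_1>0=\sigma_2$), and polynomial stratum ($\sigma=(0,0)$) have dimensions $25$, $25$, and $21$, respectively.
   Context: Sphere maps. $\mathbb B^n$ is the open unit ball of $\mathbb C^n$. A rational sphere map on $\mathbb B^2$ is a rational map $F=P/g$, holomorphic on $\mathbb B^2$, with $P=(p_1,\dots,p_N)^t$ a polynomial map, $g$ a scalar polynomial and $\|P\|^2=|g|^2$ on $\partial\mathbb B^2$. It is reduced if $g,p_1,\dots,p_N$ have no common nonconstant factor; then its degree is $\max\{\deg P,\deg g\}$. With $g(0)=1$ it is pointed if $P(0)=0$. Two maps are spherically equivalent if they differ by composition with automorphisms of the source and target balls (after passing to minimal-target representatives, i.e. regarding a map as a map into the smallest ball $\mathbb B^k$ into which it can be carried by a target automorphism). Parameters. $\Sigma=\{(\sigma_1,\sigma_2):0\le\sigma_2\le\sigma_1<1,\ \sqrt{1-\sigma_1^2}+\sqrt{1-\sigma_2^2}>1\}$ and $g_\sigma=1+\sigma_1z_1^2+\sigma_2z_2^2$. A pointed reduced representation with denominator $g_\sigma$, $\sigma\in\Sigma$, is said to be in ordered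 $\Lambda$-normal form. $\mathcal M_\sigma$ is the space of spherical-equivalence classes of reduced maps of exact degree three with ordered $\Lambda$-normal-form denominator $g_\sigma$, and $\mathcal M=\bigsqcup_{\sigma\in\Sigma}\mathcal M_\sigma$. Concrete model. Let $\mathbf V$ be the column of length 9 with entries $z_1,z_2,\ z_1^2,\sqrt2z_1z_2,z_2^2,\ z_1^3,\sqrt3z_1^2z_2,\sqrt3z_1z_2^2,z_2^3$. For a Hermitian $9\times 9$ matrix $H\ge0$ (positive semidefinite) let $H_c$ be its trailing $4\times4$ principal block and $\mathcal E_H=\{v^*\mathbf V: v\in\operatorname{Range}H\}$. Let $\mathcal S_{g_\sigma}^{\mathrm{red},3}$ be the set of Hermitian $H\ge0$ with $\mathbf V^*H\mathbf V=|g_\sigma|^2$ on $\partial\mathbb B^2$, $H_c\ne0$, and such that no nonconstant factor of $g_\sigma$ divides every member of $\mathcal E_H$; let $\mathcal S_{g_\sigma}^{\mathrm{fr}}$ be the set of positive definite $H$ with $\mathbf V^*H\mathbf V=|g_\sigma|^2$ on $\partial\mathbb B^2$ (a subset of $\mathcal S_{g_\sigma}^{\mathrm{red},3}$). Let $G_\sigma=\{U\in U(2):U^tD_\sigma U=D_\sigma\}$, $D_\sigma=\operatorname{diag}(\sigma_1,\sigma_2)$, define $\rho$ by $\mathbf V(Uz)=\rho(U)\mathbf V(z)$, and let $U\in G_\sigma$ act by $H\mapsto\rho(U)^*H\rho(U)$. Then $\mathcal M_\sigma=\mathcal S_{g_\sigma}^{\mathrm{red},3}/G_\sigma$, and $\mathcal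 M=\mathfrak S/\!\sim$, where $\mathfrak S=\{(\sigma,H):\sigma\in\Sigma,\ H\in\mathcal S_{g_\sigma}^{\mathrm{red},3}\}\subset\mathbb R^2\times\operatorname{Herm}_9$ and $(\sigma,H)\sim(\tau,K)$ iff $\sigma=\tau$ and $K=\rho(U)^*H\rho(U)$ for some $U\in G_\sigma$ (subspace and quotient topologies). Here $H$ corresponds to the class of the map $H^{1/2}\mathbf V/g_\sigma$. Dimension. $\dim_{\mathbb R}\mathcal M_\sigma$ means the dimension of the principal stratum (orbits of principal isotropy type) of the full-rank quotient $\mathcal S_{g_\sigma}^{\mathrm{fr}}/G_\sigma$; part of the meaning is that this stratum is open and dense in $\mathcal M_\sigma$. The strata of $\mathcal M$ are the parts lying over $\{\sigma_1>\sigma_2>0\}$, $\{\sigma_1=\sigma_2>0\}$, $\{\sigma_1>0=\sigma_2\}$, $\{(0,0)\}$ in $\Sigma$ (on each of which $G_\sigma$ is constant); the dimension of each is likewise that of its full-rank principal quotient stratum, with $\sigma$ varying, and $\dim_{\mathbb R}\mathcal M$ is the generic dimension, i.e. that of the stratum over $\{\sigma_1>\sigma_2>0\}$. *)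

theory Defs
  imports "HOL-Analysis.Analysis" "HOL-Computational_Algebra.Computational_Algebra"
begin

section \<open>Quotient topologies and manifold dimension\<close>

definition quotient_topology :: "'a topology \<Rightarrow> ('a \<Rightarrow> 'b) \<Rightarrow> 'b topology" where
  "quotient_topology X f =
     topology (\<lambda>U. U \<subseteq> f ` topspace X \<and> openin X {x \<in> topspace X. f x \<in> U})"

lemma openin_quotient_topology:
  "openin (quotient_topology X f) U \<longleftrightarrow>
     U \<subseteq> f ` topspace X \<and> openin X {x \<in> topspace X. f x \<in> U}"
proof -
  have "istopology (\<lambda>U. U \<subseteq> f ` topspace X \<and> openin X {x \<in> topspace X. f x \<in> U})"
    unfolding istopology_def
  proof (intro conjI allI impI; (elim conjE)?)
    fix S T
    assume "openin X {x \<in> topspace X. f x \<in> S}" "openin X {x \<in> topspace X. f x \<in> T}"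
    then have "openin X ({x \<in> topspace X. f x \<in> S} \<inter> {x \<in> topspace X. f x \<in> T})"
      by (rule openin_Int)
    moreover have "{x \<in> topspace X. f x \<in> S} \<inter> {x \<in> topspace X. f x \<in> T} =
        {x \<in> topspace X. f x \<in> S \<inter> T}" by auto
    ultimately show "openin X {x \<in> topspace X. f x \<in> S \<inter> T}" by simp
  next
    fix \<K>
    assume K: "\<forall>K\<in>\<K>. K \<subseteq> f ` topspace X \<and> openin X {x \<in> topspace X. f x \<in> K}"
    then show "\<Union>\<K> \<subseteq> f ` topspace X" by blast
    have "openin X (\<Union>K\<in>\<K>. {x \<in> topspace X. f x \<in> K})" using K by blast
    moreover have "(\<Union>K\<in>\<K>. {x \<in> topspace X. f x \<in> K}) = {x \<in> topspace X. f x \<in> \<Union>\<K>}"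
      by auto
    ultimately show "openin X {x \<in> topspace X. f x \<in> \<Union>\<K>}" by simp
  qed auto
  then show ?thesis
    unfolding quotient_topology_def by (simp add: topology_inverse')
qed

lemma topspace_quotient_topology: "topspace (quotient_topology X f) = f ` topspace X"
proof
  have "openin (quotient_topology X f) (f ` topspace X)"
    using openin_topspace[of X] by (auto simp: openin_quotient_topology conj_commute cong: conj_cong)
  then show "f ` topspace X \<subseteq> topspace (quotient_topology X f)"
    by (rule openin_subset)
qed (use openin_topspace[of "quotient_topology X f"] in \<open>simp only: openin_quotient_topology\<close>)

lemma quotient_map_quotient_topology: "quotient_map X (quotient_topology X f) f"
  unfolding quotient_map_def
  by (auto simp: topspace_quotient_topology openin_quotient_topology)

text \<open>The empty space is excluded, so the dimension is unique (invariance of domain).\<close>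

definition manifold_of_dim :: "'a topology \<Rightarrow> nat \<Rightarrow> bool" where
  "manifold_of_dim X d \<longleftrightarrow>
     topspace X \<noteq> {} \<and> Hausdorff_space X \<and> second_countable X \<and>
     (\<forall>x \<in> topspace X. \<exists>U W. openin X U \<and> x \<in> U \<and> openin (Euclidean_space d) W \<and>
        subtopology X U homeomorphic_space subtopology (Euclidean_space d) W)"

definition dim_via_open_dense :: "'a topology \<Rightarrow> 'a set \<Rightarrow> nat \<Rightarrow> bool" where
  "dim_via_open_dense X P d \<longleftrightarrow>
     openin X P \<and> X closure_of P = topspace X \<and> manifold_of_dim (subtopology X P) d"


section \<open>Complex matrices\<close>

definition cdot :: "complex ^ 'n \<Rightarrow> complex ^ 'n \<Rightarrow> complex" where
  "cdot v w = (\<Sum>i\<in>UNIV. cnj (v $ i) * w $ i)"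

definition adjoint_mat :: "complex ^ 'n ^ 'm \<Rightarrow> complex ^ 'm ^ 'n" where
  "adjoint_mat A = (\<chi> i j. cnj (A $ j $ i))"

definition hermitian :: "complex ^ 'n ^ 'n \<Rightarrow> bool" where
  "hermitian A \<longleftrightarrow> adjoint_mat A = A"

definition pos_semidef :: "complex ^ 'n ^ 'n \<Rightarrow> bool" where
  "pos_semidef A \<longleftrightarrow> hermitian A \<and> (\<forall>v. 0 \<le> Re (cdot v (A *v v)))"

definition pos_def :: "complex ^ 'n ^ 'n \<Rightarrow> bool" where
  "pos_def A \<longleftrightarrow> hermitian A \<and> (\<forall>v. v \<noteq> 0 \<longrightarrow> 0 < Re (cdot v (A *v v)))"

definition unitary :: "complex ^ 'n ^ 'n \<Rightarrow> bool" where
  "unitary U \<longleftrightarrow> adjoint_mat U ** U = mat 1"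


section \<open>Polynomials in two variables\<close>

text \<open>
  The ring \<open>complex poly poly\<close> is used as \<open>\<complex>[z\<^sub>1][z\<^sub>2]\<close>: the outer variable is \<open>z\<^sub>2\<close>,
  the coefficients are polynomials in \<open>z\<^sub>1\<close>.
\<close>

abbreviation const2 :: "complex \<Rightarrow> complex poly poly" where
  "const2 c \<equiv> [:[:c:]:]"

abbreviation Z1 :: "complex poly poly" where
  "Z1 \<equiv> [:[:0, 1:]:]"

abbreviation Z2 :: "complex poly poly" where
  "Z2 \<equiv> [:0, 1:]"

definition eval2 :: "complex poly poly \<Rightarrow> complex ^ 2 \<Rightarrow> complex" where
  "eval2 p z = poly (poly p [:z $ 2:]) (z $ 1)"

definition nonconstant2 :: "complex poly poly \<Rightarrow> bool" where
  "nonconstant2 p \<longleftrightarrow> (\<forall>c. p \<noteq> const2 c)"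


section \<open>Parameters, Gram matrices and the symmetry groups\<close>

definition Sigma_set :: "(real \<times> real) set" where
  "Sigma_set = {(\<sigma>1, \<sigma>2). 0 \<le> \<sigma>2 \<and> \<sigma>2 \<le> \<sigma>1 \<and> \<sigma>1 < 1 \<and>
     sqrt (1 - \<sigma>1\<^sup>2) + sqrt (1 - \<sigma>2\<^sup>2) > 1}"

definition g_poly :: "real \<times> real \<Rightarrow> complex poly poly" where
  "g_poly \<sigma> = 1 + const2 (of_real (fst \<sigma>)) * Z1 ^ 2 + const2 (of_real (snd \<sigma>)) * Z2 ^ 2"

definition V_poly :: "complex poly poly ^ 9" where
  "V_poly = vector
     [Z1, Z2,
      Z1 ^ 2, const2 (of_real (sqrt 2)) * Z1 * Z2, Z2 ^ 2,
      Z1 ^ 3, const2 (of_real (sqrt 3)) * Z1 ^ 2 * Z2,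
        const2 (of_real (sqrt 3)) * Z1 * Z2 ^ 2, Z2 ^ 3]"

definition V :: "complex ^ 2 \<Rightarrow> complex ^ 9" where
  "V z = (\<chi> i. eval2 (V_poly $ i) z)"

lemma V_nth:
  "V z $ 1 = z $ 1" "V z $ 2 = z $ 2"
  "V z $ 3 = (z $ 1)\<^sup>2" "V z $ 4 = of_real (sqrt 2) * z $ 1 * z $ 2" "V z $ 5 = (z $ 2)\<^sup>2"
  "V z $ 6 = (z $ 1) ^ 3" "V z $ 7 = of_real (sqrt 3) * (z $ 1)\<^sup>2 * z $ 2"
  "V z $ 8 = of_real (sqrt 3) * z $ 1 * (z $ 2)\<^sup>2" "V z $ 9 = (z $ 2) ^ 3"
  by (simp_all add: V_def V_poly_def vector_def eval2_def)

lemma eval2_g_poly: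
  "eval2 (g_poly \<sigma>) z = 1 + of_real (fst \<sigma>) * (z $ 1)\<^sup>2 + of_real (snd \<sigma>) * (z $ 2)\<^sup>2"
  by (simp add: g_poly_def eval2_def)

definition represents_on_sphere :: "real \<times> real \<Rightarrow> complex ^ 9 ^ 9 \<Rightarrow> bool" where
  "represents_on_sphere \<sigma> H \<longleftrightarrow>
     (\<forall>z \<in> sphere 0 1. cdot (V z) (H *v V z) = of_real ((cmod (eval2 (g_poly \<sigma>) z))\<^sup>2))"

definition E_space :: "complex ^ 9 ^ 9 \<Rightarrow> complex poly poly set" where
  "E_space H = {\<Sum>i\<in>UNIV. const2 (cnj (v $ i)) * V_poly $ i | v. v \<in> range ((*v) H)}"

text \<open>The third conjunct says that the trailing \<open>4 \<times> 4\<close> principal block is nonzero; in the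
  numeral type \<open>9\<close> the index of the last entry is \<open>9 = 0\<close>.\<close>

definition S_red :: "real \<times> real \<Rightarrow> (complex ^ 9 ^ 9) set" where
  "S_red \<sigma> = {H. pos_semidef H \<and> represents_on_sphere \<sigma> H \<and>
     (\<exists>i \<in> {6, 7, 8, 9}. \<exists>j \<in> {6, 7, 8, 9}. H $ i $ j \<noteq> 0) \<and>
     \<not> (\<exists>d. nonconstant2 d \<and> d dvd g_poly \<sigma> \<and> (\<forall>p \<in> E_space H. d dvd p))}"

definition S_fr :: "real \<times> real \<Rightarrow> (complex ^ 9 ^ 9) set" where
  "S_fr \<sigma> = {H. pos_def H \<and> represents_on_sphere \<sigma> H}"

definition D_mat :: "real \<times> real \<Rightarrow> complex ^ 2 ^ 2" where
  "D_mat \<sigma> = vector [vector [of_real (fst \<sigma>), 0], vector [0, of_real (snd \<sigma>)]]"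

definition G :: "real \<times> real \<Rightarrow> (complex ^ 2 ^ 2) set" where
  "G \<sigma> = {U. unitary U \<and> transpose U ** D_mat \<sigma> ** U = D_mat \<sigma>}"

definition rho :: "complex ^ 2 ^ 2 \<Rightarrow> complex ^ 9 ^ 9" where
  "rho U = (THE R. \<forall>z. V (U *v z) = R *v V z)"

definition act :: "complex ^ 2 ^ 2 \<Rightarrow> complex ^ 9 ^ 9 \<Rightarrow> complex ^ 9 ^ 9" where
  "act U H = adjoint_mat (rho U) ** H ** rho U"


section \<open>Moduli spaces\<close>

definition orbit :: "real \<times> real \<Rightarrow> complex ^ 9 ^ 9 \<Rightarrow> (complex ^ 9 ^ 9) set" where
  "orbit \<sigma> H = {act U H | U. U \<in> G \<sigma>}"

definition M_sigma :: "real \<times> real \<Rightarrow> (complex ^ 9 ^ 9) set topology" where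
  "M_sigma \<sigma> = quotient_topology (top_of_set (S_red \<sigma>)) (orbit \<sigma>)"

type_synonym param_gram = "(real \<times> real) \<times> (complex ^ 9 ^ 9)"

definition total_space :: "param_gram set" where
  "total_space = {(\<sigma>, H). \<sigma> \<in> Sigma_set \<and> H \<in> S_red \<sigma>}"

definition sim :: "(param_gram \<times> param_gram) set" where
  "sim = {((\<sigma>, H), (\<tau>, K)). (\<sigma>, H) \<in> total_space \<and> (\<tau>, K) \<in> total_space \<and>
     \<sigma> = \<tau> \<and> (\<exists>U \<in> G \<sigma>. K = act U H)}"

definition sim_class :: "param_gram \<Rightarrow> param_gram set" where
  "sim_class x = sim `` {x}"

definition M_total :: "param_gram set topology" where
  "M_total = quotient_topology (top_of_set total_space) sim_class"


section \<open>Principal strata and dimensions\<close>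

definition isotropy :: "param_gram \<Rightarrow> (complex ^ 2 ^ 2) set" where
  "isotropy = (\<lambda>(\<sigma>, H). {U \<in> G \<sigma>. act U H = H})"

text \<open>
  The full-rank points over \<open>A\<close> of principal, i.e. minimal, isotropy type: their isotropy group
  is contained, up to conjugation in the symmetry group, in that of every other full-rank point
  over \<open>A\<close>. This is meaningful when \<open>G\<close> is constant on \<open>A\<close>, so that \<open>A\<close> is only ever
  a single point or one of the four strata of parameters.
\<close>

definition principal_points :: "(real \<times> real) set \<Rightarrow> param_gram set" where
  "principal_points A = {(\<sigma>, H). \<sigma> \<in> A \<and> H \<in> S_fr \<sigma> \<and>
     (\<forall>\<tau> \<in> A. \<forall>K \<in> S_fr \<tau>. \<exists>W \<in> G \<sigma>.
        isotropy (\<sigma>, H) \<subseteq> {W ** U ** adjoint_mat W | U. U \<in> isotropy (\<tau>, K)})}"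

definition M_sigma_has_dim :: "real \<times> real \<Rightarrow> nat \<Rightarrow> bool" where
  "M_sigma_has_dim \<sigma> d \<longleftrightarrow>
     dim_via_open_dense (M_sigma \<sigma>) (orbit \<sigma> ` {H. (\<sigma>, H) \<in> principal_points {\<sigma>}}) d"

definition stratum :: "(real \<times> real) set \<Rightarrow> param_gram set topology" where
  "stratum A = subtopology M_total (sim_class ` {(\<sigma>, H) \<in> total_space. \<sigma> \<in> A})"

definition stratum_has_dim :: "(real \<times> real) set \<Rightarrow> nat \<Rightarrow> bool" where
  "stratum_has_dim A d \<longleftrightarrow>
     dim_via_open_dense (stratum A) (sim_class ` principal_points A) d"

definition generic_params :: "(real \<times> real) set" where
  "generic_params = {(\<sigma>1, \<sigma>2) \<in> Sigma_set. \<sigma>1 > \<sigma>2 \<and> \<sigma>2 > 0}"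

definition diagonal_params :: "(real \<times> real) set" where
  "diagonal_params = {(\<sigma>1, \<sigma>2) \<in> Sigma_set. \<sigma>1 = \<sigma>2 \<and> \<sigma>2 > 0}"

definition axis_params :: "(real \<times> real) set" where
  "axis_params = {(\<sigma>1, \<sigma>2) \<in> Sigma_set. \<sigma>1 > 0 \<and> \<sigma>2 = 0}"

definition polynomial_params :: "(real \<times> real) set" where
  "polynomial_params = {(0, 0)}"

text \<open>The dimension of the whole moduli space is by convention its generic dimension.\<close>

definition M_total_has_dim :: "nat \<Rightarrow> bool" where
  "M_total_has_dim d \<longleftrightarrow> stratum_has_dim generic_params d"

end

theory Submission
  imports Defs
begin

text \<open>
  Why the dimensions are what they are. Two Hermitian matrices represent the same function on the
  sphere iff their difference $K$ satisfies $\mathbf V^*K\mathbf V=0$ there, and then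
  $\mathbf V^*K\mathbf V=(\|z\|^2-1)\,q$ for a Hermitian form $q$ in the five monomials of degree one and
  two. The Hermitian $5\times5$ matrices have real dimension 25, so the full-rank Gram matrices over
  $\sigma$ are an open subset of a 25-dimensional affine space (\<open>dim_kernel_forms\<close>,
  \<open>S_fr_iff_open\<close>). A positive definite solution exists because an explicit choice of $q$
  leads to exactly the inequality that defines $\Sigma$ (\<open>S_fr_nonempty\<close>); convex combination with
  such a solution makes the full-rank matrices dense in all of \<open>S_red \<sigma>\<close>.
  
  The compact group $G_\sigma$ acts linearly and isometrically for the Frobenius norm, since the weights
  $\sqrt2,\sqrt3$ make $\rho$ unitary. From the blocks of $H$ in degrees $(1,1)$ and $(1,2)$ one builds two
  covectors of $\mathbb C^2$ that transform naturally under $U(2)$; where their determinant does not vanish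
  the isotropy group of $H$ is trivial. This is a polynomial condition that holds somewhere on each affine
  space, hence on a dense set (\<open>S_fr_covector_det_dense\<close>). Thus the principal isotropy group is
  trivial, and the principal stratum is the set of free orbits.
  
  A free isometric linear action of a compact matrix group has slices: near $x_0$ the affine space
  through $x_0$ orthogonal to the orbit meets each nearby orbit exactly once. So the quotient is a manifold
  whose dimension drops by that of the Lie algebra (\<open>manifold_quotient\<close>). The slice is met at
  least once because each nearby point can be moved by a group element that maximises the inner product
  with $x_0$, and at most once by linearisation along a sequence of group elements tending to the
  identity.
  
  The Lie algebra of $G_\sigma$ has dimension 0, 1, 1, 4 on the four strata of parameters, which themselves
  have dimension 2, 1, 1, 0. Hence $25-0$, $25-1$, $25-1$, $25-4$ for fixed $\sigma$, and $27$, $25$, $25$, $21$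
  when $\sigma$ varies. The one topological point is that a stratum carries the subspace topology of $\mathcal M$
  while the slice theorem speaks of a quotient topology. On the full-rank part the two agree, because there
  the projection to $\mathcal M$ is a closed map: the groups $G_\sigma$ all lie in the compact group $U(2)$ and depend on
  $\sigma$ through a closed condition (\<open>closed_map_sim_class\<close>).
\<close>

no_notation fps_nth (infixl \<open>$\<close> 75)

section \<open>Quotients by free isometric actions of compact matrix groups\<close>

lemma Euclidean_space_eq_top_of_set: "Euclidean_space n = top_of_set {x. \<forall>i\<ge>n. x i = 0}"
  by (simp add: Euclidean_space_def euclidean_product_topology)

lemma subspace_homeomorphic_Euclidean_space:
  fixes N :: "'a::euclidean_space set"
  assumes "subspace N"
  shows "top_of_set N homeomorphic_space Euclidean_space (dim N)"
proof -
  obtain B where B: "B \<subseteq> N" "pairwise orthogonal B" "\<And>x. x \<in> B \<Longrightarrow> norm x = 1"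
      "independent B" "card B = dim N" "span B = N"
    using orthonormal_basis_subspace[OF assms] by metis
  define n where "n = dim N"
  have "finite B" using B(4) independent_imp_finite by blast
  then obtain b where b: "bij_betw b {..<n} B"
    using B(5) ex_bij_betw_nat_finite unfolding n_def atLeast0LessThan[symmetric] by metis
  have ortho: "b i \<bullet> b j = (if i = j then 1 else 0)" if "i < n" "j < n" for i j
  proof (cases "i = j")
    case True
    then show ?thesis using B(3)[of "b i"] b that by (auto simp: bij_betw_def norm_eq_1)
  next
    case False
    then have "b i \<noteq> b j" using b that by (auto simp: bij_betw_def inj_on_def)
    then show ?thesis using B(2) b that False
      by (auto simp: pairwise_def orthogonal_def bij_betw_def)
  qed
  have bN: "b i \<in> N" if "i < n" for i using that b B(1) by (auto simp: bij_betw_def)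
  define F where "F = (\<lambda>x i. if i < n then x \<bullet> b i else 0)"
  define G where "G = (\<lambda>y. \<Sum>i<n. y i *\<^sub>R b i)"
  have GF: "G (F x) = x" if "x \<in> N" for x
  proof -
    define y where "y = x - G (F x)"
    have GN: "G (F x) \<in> N" unfolding G_def
      by (intro subspace_sum[OF assms] subspace_scale[OF assms] bN) auto
    then have yN: "y \<in> span B" using that B(6) assms by (simp add: y_def subspace_diff)
    have "orthogonal y v" if v: "v \<in> B" for v
    proof -
      obtain j where j: "j < n" "v = b j" using b v unfolding bij_betw_def by blast
      have "G (F x) \<bullet> b j = (\<Sum>i<n. if i = j then x \<bullet> b i else 0)"
        unfolding G_def inner_sum_left F_def
        by (rule sum.cong) (use j ortho in auto)
      also have "\<dots> = x \<bullet> b j" using j by simp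
      finally show ?thesis by (simp add: y_def orthogonal_def inner_diff_left j)
    qed
    then have "orthogonal y y" using orthogonal_to_span yN by blast
    then show ?thesis by (simp add: y_def orthogonal_def)
  qed
  have FG: "F (G y) = y" if "\<forall>i\<ge>n. y i = 0" for y
  proof
    fix j show "F (G y) j = y j"
    proof (cases "j < n")
      case True
      have "G y \<bullet> b j = (\<Sum>i<n. if i = j then y i else 0)"
        unfolding G_def inner_sum_left by (rule sum.cong) (use True ortho in auto)
      then show ?thesis using True by (simp add: F_def)
    qed (use that in \<open>auto simp: F_def\<close>)
  qed
  have "homeomorphic_maps (top_of_set N) (top_of_set {x. \<forall>i\<ge>n. x i = 0}) F G"
    unfolding homeomorphic_maps_def
  proof (intro conjI ballI)
    have "continuous_on N F"
    proof (rule continuous_on_coordinatewise_then_product)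
      show "continuous_on N (\<lambda>x. F x i)" for i
        by (cases "i < n") (auto simp: F_def intro!: continuous_intros)
    qed
    then show "continuous_map (top_of_set N) (top_of_set {x. \<forall>i\<ge>n. x i = 0}) F"
      by (auto simp: F_def)
    have "continuous_on UNIV G"
      unfolding G_def by (intro continuous_intros continuous_on_product_coordinates)
    moreover have "G y \<in> N" for y unfolding G_def
      by (intro subspace_sum[OF assms] subspace_scale[OF assms] bN) auto
    ultimately show "continuous_map (top_of_set {x. \<forall>i\<ge>n. x i = 0}) (top_of_set N) G"
      by (auto intro: continuous_on_subset)
  qed (use GF FG in auto)
  then show ?thesis
    unfolding homeomorphic_space_def Euclidean_space_eq_top_of_set n_def[symmetric] by blast
qed

lemma second_countable_top_of_set:
  fixes S :: "'a::euclidean_space set"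
  shows "second_countable (top_of_set S)"
proof -
  obtain \<B> where \<B>: "countable \<B>" "\<And>C. C \<in> \<B> \<Longrightarrow> openin (top_of_set S) C"
      "\<And>T. openin (top_of_set S) T \<Longrightarrow> \<exists>\<U>. \<U> \<subseteq> \<B> \<and> T = \<Union>\<U>"
    using subset_second_countable[of S] by metis
  have "\<exists>B\<in>\<B>. x \<in> B \<and> B \<subseteq> T" if T: "openin (top_of_set S) T" "x \<in> T" for x T
    using \<B>(3)[OF T(1)] T(2) by blast
  then show ?thesis
    unfolding second_countable_def using \<B>(1,2) by blast
qed

text \<open>
  A derivative as a limit of difference quotients along a sequence whose directions converge. It turns
  the tangent vectors of a closed matrix group into honest limits of secants.
\<close>

lemma has_derivative_sequential_quotient:
  fixes f :: "'a::real_normed_vector \<Rightarrow> 'b::real_normed_vector"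
  assumes f: "(f has_derivative f') (at x)"
    and g: "g \<longlonglongrightarrow> x" "\<And>n. g n \<noteq> x"
    and \<tau>: "(\<lambda>n. (g n - x) /\<^sub>R norm (g n - x)) \<longlonglongrightarrow> \<tau>"
  shows "(\<lambda>n. (f (g n) - f x) /\<^sub>R norm (g n - x)) \<longlonglongrightarrow> f' \<tau>"
proof -
  have bl: "bounded_linear f'" using f by (rule has_derivative_bounded_linear)
  have "((\<lambda>y. (f y - f x - f' (y - x)) /\<^sub>R norm (y - x)) \<longlongrightarrow> 0) (at x)"
    using f unfolding has_derivative_at_within
    by (simp add: diff_diff_eq divide_inverse_commute)
  moreover have "filterlim g (at x) sequentially"
    using g by (simp add: filterlim_at)
  ultimately have "(\<lambda>n. (f (g n) - f x - f' (g n - x)) /\<^sub>R norm (g n - x)) \<longlonglongrightarrow> 0"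
    by (rule filterlim_compose)
  moreover have "(\<lambda>n. f' ((g n - x) /\<^sub>R norm (g n - x))) \<longlonglongrightarrow> f' \<tau>"
    using bounded_linear.tendsto[OF bl \<tau>] .
  ultimately have "(\<lambda>n. (f (g n) - f x - f' (g n - x)) /\<^sub>R norm (g n - x)
      + f' ((g n - x) /\<^sub>R norm (g n - x))) \<longlonglongrightarrow> 0 + f' \<tau>"
    by (rule tendsto_add)
  moreover have "(f (g n) - f x - f' (g n - x)) /\<^sub>R norm (g n - x)
      + f' ((g n - x) /\<^sub>R norm (g n - x)) = (f (g n) - f x) /\<^sub>R norm (g n - x)" for n
    using bl by (simp add: linear_simps scaleR_diff_right algebra_simps)
  ultimately show ?thesis by simp
qed

lemma vector_derivative_in_subspace:
  fixes h :: "real \<Rightarrow> 'a::euclidean_space"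
  assumes "(h has_vector_derivative v) (at 0)" "subspace M" "\<And>t. h t \<in> M"
  shows "v \<in> M"
proof -
  have "(\<lambda>n. (h (1 / real (Suc n)) - h 0) /\<^sub>R norm (1 / real (Suc n) - 0)) \<longlonglongrightarrow> 1 *\<^sub>R v"
    using assms(1) unfolding has_vector_derivative_def
    by (rule has_derivative_sequential_quotient) (use lim_1_over_n LIMSEQ_Suc lim_inverse_n' in \<open>auto simp del: of_nat_Suc\<close>)
  moreover have "(h (1 / real (Suc n)) - h 0) /\<^sub>R norm (1 / real (Suc n) - 0) \<in> M" for n
    using assms(2,3) by (simp add: subspace_diff subspace_scale)
  moreover have "closed M" using assms(2) by (rule closed_subspace)
  ultimately show ?thesis using closed_sequentially by (metis (no_types, lifting) scaleR_one)
qed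

text \<open>
  The relation between \<open>h (u + t)\<close> and \<open>h u\<close> carries the vanishing velocity
  from time 0 to all times.
\<close>

lemma zero_velocity_imp_constant:
  fixes h :: "real \<Rightarrow> 'a::real_normed_vector"
  assumes h: "(h has_derivative (\<lambda>_. 0)) (at 0)"
    and P: "\<And>t. bounded_linear (P t)" "\<And>t u. h (u + t) = P t (h u)"
  shows "h t = h 0"
proof -
  have "(h has_derivative (\<lambda>_. 0)) (at t)" for t
  proof -
    have "((\<lambda>u. h (u - t)) has_derivative (\<lambda>_. 0)) (at t)"
      by (rule has_derivative_compose[where g = h and g' = "\<lambda>_. 0" and f = "\<lambda>u. u - t" and f' = "\<lambda>u. u"])
         (use h in \<open>auto intro!: derivative_eq_intros\<close>)
    then have "((\<lambda>u. P t (h (u - t))) has_derivative (\<lambda>_. P t 0)) (at t)"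
      by (rule bounded_linear.has_derivative[OF P(1)])
    then show ?thesis by (simp add: linear_0[OF bounded_linear.linear[OF P(1)]] flip: P(2))
  qed
  then obtain c where "\<And>t. h t = c"
    using has_derivative_zero_constant[of UNIV h] by (auto simp: has_derivative_at_withinI)
  then show ?thesis by simp
qed

text \<open>
  The hypotheses of the slice theorem. The action is a right action, as $H\mapsto\rho(U)^*H\rho(U)$
  is. The function \<open>d\<close> is the infinitesimal action at the identity. The set
  \<open>\<kappa>\<close> plays the role of the Lie algebra, and the last two assumptions say so
  without a Lie group structure: its elements integrate to one-parameter groups, and it contains every
  limit direction of sequences in the group that converge to the identity.
\<close>

locale isometric_matrix_action =
  fixes \<Gamma> :: "(complex ^ 2 ^ 2) set"
    and a :: "complex ^ 2 ^ 2 \<Rightarrow> 'e::euclidean_space \<Rightarrow> 'e"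
    and d :: "'e \<Rightarrow> complex ^ 2 ^ 2 \<Rightarrow> 'e"
    and \<kappa> :: "(complex ^ 2 ^ 2) set"
  assumes compact_group: "compact \<Gamma>"
    and group_one: "mat 1 \<in> \<Gamma>"
    and group_mult: "\<And>U W. U \<in> \<Gamma> \<Longrightarrow> W \<in> \<Gamma> \<Longrightarrow> U ** W \<in> \<Gamma>"
    and act_mult: "\<And>U W x. U \<in> \<Gamma> \<Longrightarrow> W \<in> \<Gamma> \<Longrightarrow> a (U ** W) x = a W (a U x)"
    and act_one: "\<And>x. a (mat 1) x = x"
    and act_linear: "\<And>U. linear (a U)"
    and act_isometry: "\<And>U x. U \<in> \<Gamma> \<Longrightarrow> norm (a U x) = norm x"
    and act_continuous: "continuous_on UNIV (\<lambda>(U, x). a U x)"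
    and act_derivative: "\<And>x. ((\<lambda>U. a U x) has_derivative d x) (at (mat 1))"
    and lie_subspace: "subspace \<kappa>"
    and lie_one_parameter_group: "\<And>\<xi>. \<xi> \<in> \<kappa> \<Longrightarrow> \<exists>\<gamma>. \<gamma> 0 = mat 1 \<and>
        (\<forall>s t. \<gamma> (s + t) = \<gamma> s ** \<gamma> t) \<and> range \<gamma> \<subseteq> \<Gamma> \<and> (\<gamma> has_vector_derivative \<xi>) (at 0)"
    and lie_tangent: "\<And>g \<tau>. (\<And>n. g n \<in> \<Gamma>) \<Longrightarrow> (\<And>n. g n \<noteq> mat 1) \<Longrightarrow> g \<longlonglongrightarrow> mat 1 \<Longrightarrow>
        (\<lambda>n. (g n - mat 1) /\<^sub>R norm (g n - mat 1)) \<longlonglongrightarrow> \<tau> \<Longrightarrow> \<tau> \<in> \<kappa>"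
begin

definition free :: "'e \<Rightarrow> bool" where
  "free x \<longleftrightarrow> (\<forall>U\<in>\<Gamma>. a U x = x \<longrightarrow> U = mat 1)"

lemma act_inner: "U \<in> \<Gamma> \<Longrightarrow> a U x \<bullet> a U y = x \<bullet> y"
  using act_isometry[of U "x + y"] act_isometry[of U x] act_isometry[of U y]
  by (simp add: norm_eq_sqrt_inner linear_add[OF act_linear] inner_add inner_commute)

lemma continuous_act: "continuous_on S (a U)"
  using linear_continuous_on[OF act_linear[of U, unfolded linear_conv_bounded_linear]] .

lemma tendsto_act:
  assumes "(u \<longlongrightarrow> U) F" "(x \<longlongrightarrow> y) F"
  shows "((\<lambda>n. a (u n) (x n)) \<longlongrightarrow> a U y) F"
proof -
  have "isCont (\<lambda>(U, x). a U x) (U, y)"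
    using act_continuous continuous_on_eq_continuous_at open_UNIV by blast
  then have "((\<lambda>n. (\<lambda>(U, x). a U x) (u n, x n)) \<longlongrightarrow> (\<lambda>(U, x). a U x) (U, y)) F"
    by (rule isCont_tendsto_compose) (intro tendsto_Pair assms)
  then show ?thesis by simp
qed

lemma derivative_along_curve:
  assumes "\<gamma> 0 = mat 1" "(\<gamma> has_vector_derivative \<xi>) (at 0)"
  shows "((\<lambda>t. a (\<gamma> t) x) has_vector_derivative d x \<xi>) (at 0)"
proof -
  have "((\<lambda>U. a U x) has_derivative d x) (at (\<gamma> 0))" using act_derivative assms(1) by simp
  from has_derivative_compose[OF assms(2)[unfolded has_vector_derivative_def] this]
  have "((\<lambda>t. a (\<gamma> t) x) has_derivative (\<lambda>t. d x (t *\<^sub>R \<xi>))) (at 0)" .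
  then show ?thesis
    unfolding has_vector_derivative_def
    using linear_scale[OF has_derivative_linear[OF act_derivative[of x]]] by simp
qed

text \<open>
  If \<open>d x \<xi> = 0\<close>, then \<open>x\<close> has velocity zero along the one-parameter
  group generated by \<open>\<xi>\<close>, first at time 0 and by the group law at all times, so this
  group fixes \<open>x\<close>.
\<close>

lemma free_imp_infinitesimally_free:
  assumes "free x" "\<xi> \<in> \<kappa>" "d x \<xi> = 0"
  shows "\<xi> = 0"
proof -
  obtain \<gamma> where \<gamma>: "\<gamma> 0 = mat 1" "\<And>s t. \<gamma> (s + t) = \<gamma> s ** \<gamma> t" "range \<gamma> \<subseteq> \<Gamma>"
      "(\<gamma> has_vector_derivative \<xi>) (at 0)"
    using lie_one_parameter_group[OF assms(2)] by blast
  define h where "h t = a (\<gamma> t) x" for t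
  have h0: "(h has_vector_derivative 0) (at 0)"
    unfolding h_def using derivative_along_curve[OF \<gamma>(1,4)] assms(3) by metis
  have "h (u + t) = a (\<gamma> t) (h u)" for t u
    using \<gamma>(2,3) by (simp add: h_def act_mult image_subset_iff)
  then have c: "h t = h 0" for t
    by (rule zero_velocity_imp_constant[OF h0[unfolded has_vector_derivative_def, simplified]
        act_linear[unfolded linear_conv_bounded_linear]])
  have "h 0 = x" by (simp add: h_def \<gamma>(1) act_one)
  then have "a (\<gamma> t) x = x" for t using c[of t] by (simp add: h_def)
  then have "\<gamma> = (\<lambda>t. mat 1)" using assms(1) \<gamma>(3) unfolding free_def by blast
  then have "(\<gamma> has_vector_derivative 0) (at 0)" by simp
  then show ?thesis using \<gamma>(4) vector_derivative_unique_at by blast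
qed

text \<open>
  The slice through \<open>x0\<close> meets nearby orbits at most once; the case \<open>a U s =
  s\<close> also shows that freeness is an open condition. By compactness a counterexample yields
  group elements tending to an element that fixes \<open>x0\<close>, hence to the identity. Let
  \<open>\<tau>\<close> be a limit of their normalised directions and \<open>\<eta> = d x0
  \<tau>\<close>. Comparing the displacement of \<open>x0\<close> with that of \<open>s\<close> in the
  direction \<open>\<eta>\<close> gives \<open>\<eta> \<bullet> \<eta> = 0\<close>. Infinitesimal
  freeness then forces \<open>\<tau> = 0\<close>, although \<open>\<tau>\<close> has norm one.
\<close>

lemma slice_injective:
  assumes "free x0"
  obtains \<epsilon> where "\<epsilon> > 0"
    and "\<And>U s. U \<in> \<Gamma> \<Longrightarrow> dist s x0 < \<epsilon> \<Longrightarrow> dist (a U s) x0 < \<epsilon> \<Longrightarrow>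
           (\<And>\<xi>. \<xi> \<in> \<kappa> \<Longrightarrow> (a U s - s) \<bullet> d x0 \<xi> = 0) \<Longrightarrow> U = mat 1"
proof (rule ccontr)
  assume neg: "\<not> thesis"
  note conclude = that
  have "\<exists>U s. U \<in> \<Gamma> \<and> dist s x0 < e \<and> dist (a U s) x0 < e \<and>
      (\<forall>\<xi>\<in>\<kappa>. (a U s - s) \<bullet> d x0 \<xi> = 0) \<and> U \<noteq> mat 1" if e: "e > 0" for e
  proof (rule ccontr)
    assume no: "\<not> ?thesis"
    have thesis by (rule conclude[OF e]) (use no in blast)
    with neg show False by simp
  qed
  then have "\<exists>U s. U \<in> \<Gamma> \<and> dist s x0 < inverse (real (Suc n)) \<and> dist (a U s) x0 < inverse (real (Suc n)) \<and>
      (\<forall>\<xi>\<in>\<kappa>. (a U s - s) \<bullet> d x0 \<xi> = 0) \<and> U \<noteq> mat 1" for n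
    by simp
  then obtain U s where Us: "\<And>n. U n \<in> \<Gamma>" "\<And>n. dist (s n) x0 < inverse (real (Suc n))"
     "\<And>n. dist (a (U n) (s n)) x0 < inverse (real (Suc n))"
     "\<And>n \<xi>. \<xi> \<in> \<kappa> \<Longrightarrow> (a (U n) (s n) - s n) \<bullet> d x0 \<xi> = 0" "\<And>n. U n \<noteq> mat 1"
    by metis
  have dist_bound: "f \<longlonglongrightarrow> x0" if "\<And>n. dist (f n) x0 < inverse (real (Suc n))" for f :: "nat \<Rightarrow> 'e"
    unfolding tendsto_dist_iff[of f]
    by (rule tendsto_sandwich[OF _ _ tendsto_const LIMSEQ_inverse_real_of_nat])
       (use that in \<open>auto intro!: always_eventually less_imp_le\<close>)
  have s: "s \<longlonglongrightarrow> x0" and as: "(\<lambda>n. a (U n) (s n)) \<longlonglongrightarrow> x0"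
    using Us(2,3) by (auto intro!: dist_bound)
  obtain V r where V: "V \<in> \<Gamma>" "strict_mono r" "(U \<circ> r) \<longlonglongrightarrow> V"
    using compact_group Us(1) unfolding compact_def by metis
  have sr: "(s \<circ> r) \<longlonglongrightarrow> x0" "((\<lambda>n. a (U n) (s n)) \<circ> r) \<longlonglongrightarrow> x0"
    using s as V(2) LIMSEQ_subseq_LIMSEQ by blast+
  have "(\<lambda>n. a ((U \<circ> r) n) ((s \<circ> r) n)) \<longlonglongrightarrow> a V x0" by (rule tendsto_act[OF V(3) sr(1)])
  then have "a V x0 = x0" using sr(2) LIMSEQ_unique by (simp add: o_def)
  then have V1: "V = mat 1" using assms V(1) unfolding free_def by blast
  define q where "q n = norm ((U \<circ> r) n - mat 1)" for n
  define \<tau>' where "\<tau>' n = ((U \<circ> r) n - mat 1) /\<^sub>R q n" for n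
  have q: "q n > 0" for n using Us(5) by (simp add: q_def)
  have "\<tau>' n \<in> sphere 0 1" for n using q[of n] by (simp add: \<tau>'_def q_def)
  then obtain \<tau> r' where \<tau>: "\<tau> \<in> sphere 0 1" "strict_mono r'" "(\<tau>' \<circ> r') \<longlonglongrightarrow> \<tau>"
    using compact_sphere[of 0 1] unfolding compact_def by metis
  define g where "g = U \<circ> r \<circ> r'"
  define u where "u = s \<circ> r \<circ> r'"
  have g: "g \<longlonglongrightarrow> mat 1" "\<And>n. g n \<in> \<Gamma>" "\<And>n. g n \<noteq> mat 1" "u \<longlonglongrightarrow> x0"
    unfolding g_def u_def using Us V(3) sr(1) \<tau>(2) V1 LIMSEQ_subseq_LIMSEQ by auto
  have g\<tau>: "(\<lambda>n. (g n - mat 1) /\<^sub>R norm (g n - mat 1)) \<longlonglongrightarrow> \<tau>"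
    using \<tau>(3) by (simp add: o_def g_def \<tau>'_def q_def)
  then have "\<tau> \<in> \<kappa>" using lie_tangent g by blast
  define \<eta> where "\<eta> = d x0 \<tau>"
  have quot: "(\<lambda>n. (a (g n) x - x) /\<^sub>R norm (g n - mat 1)) \<longlonglongrightarrow> d x \<tau>" for x
    using has_derivative_sequential_quotient[OF act_derivative g(1,3) g\<tau>, of x] by (simp add: act_one)
  have "(\<lambda>n. ((a (g n) x0 - x0) /\<^sub>R norm (g n - mat 1)) \<bullet> \<eta>) \<longlonglongrightarrow> \<eta> \<bullet> \<eta>"
    by (intro tendsto_inner quot[of x0, folded \<eta>_def] tendsto_const)
  moreover have "(\<lambda>n. ((a (g n) x0 - x0) /\<^sub>R norm (g n - mat 1)) \<bullet> \<eta>) \<longlonglongrightarrow> 0"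
  proof -
    \<comment> \<open>Since \<open>a (g n) (u n) - u n\<close> is orthogonal to \<open>\<eta>\<close>, only the displacement of \<open>u n - x0\<close> remains, and it is of smaller order because \<open>u n\<close> tends to \<open>x0\<close>.\<close>
    have eq: "((a (g n) x0 - x0) /\<^sub>R norm (g n - mat 1)) \<bullet> \<eta> =
        a (g n) (u n - x0) \<bullet> ((a (g n) \<eta> - \<eta>) /\<^sub>R norm (g n - mat 1))" for n
    proof -
      have "(a (g n) (u n) - u n) \<bullet> \<eta> = 0"
        unfolding g_def u_def \<eta>_def using Us(4) \<open>\<tau> \<in> \<kappa>\<close> by simp
      then have "(a (g n) x0 - x0) \<bullet> \<eta> = (u n - x0) \<bullet> \<eta> - a (g n) (u n - x0) \<bullet> \<eta>"
        by (simp add: linear_diff[OF act_linear] inner_diff_left)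
      also have "(u n - x0) \<bullet> \<eta> = a (g n) (u n - x0) \<bullet> a (g n) \<eta>"
        using act_inner g(2) by metis
      finally show ?thesis by (simp add: inner_diff_right)
    qed
    have "(\<lambda>n. a (g n) (u n - x0)) \<longlonglongrightarrow> a (mat 1) (x0 - x0)"
      by (intro tendsto_act g tendsto_diff tendsto_const)
    then have "(\<lambda>n. a (g n) (u n - x0) \<bullet> ((a (g n) \<eta> - \<eta>) /\<^sub>R norm (g n - mat 1)))
        \<longlonglongrightarrow> a (mat 1) (x0 - x0) \<bullet> d \<eta> \<tau>"
      by (intro tendsto_inner quot)
    then show ?thesis by (simp only: eq act_one diff_self inner_zero_left)
  qed
  ultimately have "\<eta> \<bullet> \<eta> = 0" by (rule LIMSEQ_unique)
  then have "\<tau> = 0"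
    using free_imp_infinitesimally_free[OF assms \<open>\<tau> \<in> \<kappa>\<close>] by (simp add: \<eta>_def)
  then show False using \<tau>(1) by simp
qed

lemma open_free: "open {x. free x}"
  unfolding open_dist
proof clarify
  fix x0 assume "free x0"
  from slice_injective[OF this] obtain \<epsilon> where \<epsilon>: "\<epsilon> > 0"
    "\<And>U s. U \<in> \<Gamma> \<Longrightarrow> dist s x0 < \<epsilon> \<Longrightarrow> dist (a U s) x0 < \<epsilon> \<Longrightarrow>
           (\<And>\<xi>. \<xi> \<in> \<kappa> \<Longrightarrow> (a U s - s) \<bullet> d x0 \<xi> = 0) \<Longrightarrow> U = mat 1" by blast
  then have "free y" if "dist y x0 < \<epsilon>" for y
    unfolding free_def using that by auto
  then show "\<exists>e>0. \<forall>y. dist y x0 < e \<longrightarrow> y \<in> {x. free x}" using \<epsilon>(1) by blast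
qed

text \<open>
  The group element that maximises \<open>a U y \<bullet> x0\<close> brings \<open>y\<close> closest
  to \<open>x0\<close>. Criticality of the maximum, combined with the skew symmetry of the
  infinitesimal action, puts \<open>a U y - x0\<close> orthogonally to the orbit of \<open>x0\<close>.
\<close>

lemma slice_reached:
  obtains U where "U \<in> \<Gamma>" "dist (a U y) x0 \<le> dist y x0"
    "\<And>\<xi>. \<xi> \<in> \<kappa> \<Longrightarrow> (a U y - x0) \<bullet> d x0 \<xi> = 0"
proof -
  have "continuous_on \<Gamma> (\<lambda>U. a U y \<bullet> x0)"
    unfolding continuous_on_def by (intro ballI tendsto_inner tendsto_act tendsto_const tendsto_ident_at)
  then obtain U where U: "U \<in> \<Gamma>" "\<And>W. W \<in> \<Gamma> \<Longrightarrow> a W y \<bullet> x0 \<le> a U y \<bullet> x0"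
    using continuous_attains_sup[OF compact_group] group_one by (metis empty_iff)
  define z where "z = a U y"
  show thesis
  proof (rule that[OF U(1)])
    have "norm (a U y - x0) ^ 2 \<le> norm (y - x0) ^ 2"
      using U(2)[OF group_one] act_inner[OF U(1), of y y]
      by (simp add: power2_norm_eq_inner inner_diff inner_commute act_one algebra_simps)
    then show "dist (a U y) x0 \<le> dist y x0" by (simp add: dist_norm)
  next
    fix \<xi> assume "\<xi> \<in> \<kappa>"
    from lie_one_parameter_group[OF this] obtain \<gamma> where
      \<gamma>: "\<gamma> 0 = mat 1" "range \<gamma> \<subseteq> \<Gamma>" "(\<gamma> has_vector_derivative \<xi>) (at 0)" by blast
    \<comment> \<open>The infinitesimal action is skew because the inner product is constant along the one-parameter group.\<close>
    have inv: "w \<bullet> d x0 \<xi> + d w \<xi> \<bullet> x0 = 0" for w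
    proof -
      have "((\<lambda>t. a (\<gamma> t) w \<bullet> a (\<gamma> t) x0) has_vector_derivative
          (a (\<gamma> 0) w \<bullet> d x0 \<xi> + d w \<xi> \<bullet> a (\<gamma> 0) x0)) (at 0)"
        by (rule bounded_bilinear.has_vector_derivative[OF bounded_bilinear_inner])
           (intro derivative_along_curve \<gamma>)+
      moreover have "(\<lambda>t. a (\<gamma> t) w \<bullet> a (\<gamma> t) x0) = (\<lambda>t. w \<bullet> x0)"
        using \<gamma>(2) by (auto simp: act_inner image_subset_iff)
      ultimately have "((\<lambda>t. w \<bullet> x0) has_vector_derivative (w \<bullet> d x0 \<xi> + d w \<xi> \<bullet> x0)) (at 0)"
        by (simp add: \<gamma>(1) act_one)
      then show ?thesis using vector_derivative_unique_at[OF _ has_vector_derivative_const] by metis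
    qed
    have "((\<lambda>t. a (\<gamma> t) z \<bullet> x0) has_vector_derivative (d z \<xi> \<bullet> x0)) (at 0)"
      using bounded_linear.has_vector_derivative[OF bounded_linear_inner_left derivative_along_curve[OF \<gamma>(1,3)]] .
    then have "((\<lambda>t. a (\<gamma> t) z \<bullet> x0) has_real_derivative (d z \<xi> \<bullet> x0)) (at 0)"
      by (simp add: has_real_derivative_iff_has_vector_derivative)
    moreover have "a (\<gamma> t) z \<bullet> x0 \<le> a (\<gamma> 0) z \<bullet> x0" for t
      using U(2)[of "U ** \<gamma> t"] U(1) \<gamma> act_mult[of U "\<gamma> t"] group_mult
      by (auto simp: z_def act_one image_subset_iff)
    ultimately have "d z \<xi> \<bullet> x0 = 0"
      using DERIV_local_max[where f = "\<lambda>t. a (\<gamma> t) z \<bullet> x0" and x = 0 and d = 1] by auto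
    then have "z \<bullet> d x0 \<xi> = 0" using inv[of z] by simp
    moreover have "x0 \<bullet> d x0 \<xi> = 0" using inv[of x0] by (simp add: inner_commute)
    ultimately show "(a U y - x0) \<bullet> d x0 \<xi> = 0" by (simp add: inner_diff_left z_def)
  qed
qed


text \<open>
  The closed slice is compact and injects continuously into the Hausdorff quotient, so it is embedded.
  The image of the open slice is open since by \<open>slice_reached\<close> it equals the image of a
  ball. The slice is a ball in the orthogonal complement of the tangent space to the orbit, and this
  tangent space has the dimension of the Lie algebra.
\<close>

proposition manifold_quotient:
  assumes M: "subspace M" "\<And>U x. U \<in> \<Gamma> \<Longrightarrow> x \<in> M \<Longrightarrow> a U x \<in> M"
    and X: "openin (top_of_set M) X" "X \<noteq> {}" "\<And>U x. U \<in> \<Gamma> \<Longrightarrow> x \<in> X \<Longrightarrow> a U x \<in> X"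
    and free: "\<And>x. x \<in> X \<Longrightarrow> free x"
    and fibre: "\<And>x y. x \<in> X \<Longrightarrow> y \<in> X \<Longrightarrow> f x = f y \<longleftrightarrow> (\<exists>U\<in>\<Gamma>. y = a U x)"
  shows "manifold_of_dim (quotient_topology (top_of_set X) f) (dim M - dim \<kappa>)"
proof -
  let ?X = "top_of_set X"
  define Y where "Y = quotient_topology ?X f"
  have quo: "quotient_map ?X Y f" unfolding Y_def by (rule quotient_map_quotient_topology)
  then have cont: "continuous_map ?X Y f" by (rule quotient_imp_continuous_map)
  have topY: "topspace Y = f ` X" by (simp add: Y_def topspace_quotient_topology)
  have openY: "openin Y S \<longleftrightarrow> S \<subseteq> f ` X \<and> openin ?X {x \<in> X. f x \<in> S}" for S
    by (simp add: Y_def openin_quotient_topology)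
  have sat: "f x \<in> f ` W \<longleftrightarrow> (\<exists>U\<in>\<Gamma>. a U x \<in> W)" if "x \<in> X" "W \<subseteq> X" for x W
  proof
    assume "f x \<in> f ` W"
    then show "\<exists>U\<in>\<Gamma>. a U x \<in> W" using fibre that by (metis imageE subset_iff)
  next
    assume "\<exists>U\<in>\<Gamma>. a U x \<in> W"
    then obtain U where U: "U \<in> \<Gamma>" "a U x \<in> W" by blast
    then have "f x = f (a U x)" using fibre[of x "a U x"] that by blast
    then show "f x \<in> f ` W" using U(2) by simp
  qed
  have opn: "open_map ?X Y f"
    unfolding open_map_def
  proof (intro allI impI)
    fix W assume W: "openin ?X W"
    then have WX: "W \<subseteq> X" using openin_imp_subset by blast
    have "{x \<in> X. f x \<in> f ` W} = (\<Union>U\<in>\<Gamma>. X \<inter> a U -` W)"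
      unfolding set_eq_iff mem_Collect_eq UN_iff Int_iff vimage_eq using sat[OF _ WX] by blast
    moreover have "openin ?X (X \<inter> a U -` W)" if "U \<in> \<Gamma>" for U
      by (rule continuous_openin_preimage[OF continuous_act _ W]) (use X(3) that in auto)
    then have "openin ?X (\<Union>U\<in>\<Gamma>. X \<inter> a U -` W)" by (intro openin_Union) blast
    ultimately have "openin ?X {x \<in> X. f x \<in> f ` W}" by (simp only:)
    then show "openin Y (f ` W)" using WX by (auto simp: openY)
  qed
  have clo: "closed_map ?X Y f"
    unfolding closed_map_def
  proof (intro allI impI)
    fix C assume C: "closedin ?X C"
    then have CX: "C \<subseteq> X" using closedin_imp_subset by blast
    have eq: "{x \<in> X. f x \<in> f ` C} = {y. \<exists>U. U \<in> \<Gamma> \<and> (U, y) \<in> (\<Gamma> \<times> X) \<inter> (\<lambda>(U, x). a U x) -` C}"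
      unfolding set_eq_iff mem_Collect_eq Int_iff vimage_eq mem_Sigma_iff prod.case
      using sat[OF _ CX] by blast
    have "closedin (top_of_set (\<Gamma> \<times> X)) ((\<Gamma> \<times> X) \<inter> (\<lambda>(U, x). a U x) -` C)"
      by (rule continuous_closedin_preimage_gen[OF continuous_on_subset[OF act_continuous] _ C])
         (use X(3) in auto)
    then have "closedin ?X {x \<in> X. f x \<in> f ` C}"
      unfolding eq by (rule closedin_compact_projection[OF compact_group])
    then show "closedin Y (f ` C)"
      using quo CX unfolding quotient_map_closedin by (simp add: topY image_mono)
  qed
  have "normal_space ?X"
    by (simp add: metrizable_imp_normal_space metrizable_space_subtopology metrizable_space_euclidean)
  then have haus: "Hausdorff_space Y"
    using normal_Hausdorff_space_closed_continuous_map_image[OF _ _ clo cont]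
    by (simp add: topY Hausdorff_space_subtopology)
  have "second_countable ?X"
    by (rule second_countable_top_of_set)
  then have sc: "second_countable Y"
    using second_countable_open_map_image[OF cont opn] by (simp add: topY)
  have loc: "\<exists>U W. openin Y U \<and> y \<in> U \<and> openin (Euclidean_space (dim M - dim \<kappa>)) W \<and>
        subtopology Y U homeomorphic_space subtopology (Euclidean_space (dim M - dim \<kappa>)) W"
    if y: "y \<in> topspace Y" for y
  proof -
    obtain x0 where x0: "x0 \<in> X" "y = f x0" using y topY by blast
    obtain \<epsilon>1 where \<epsilon>1: "\<epsilon>1 > 0"
       "\<And>U s. U \<in> \<Gamma> \<Longrightarrow> dist s x0 < \<epsilon>1 \<Longrightarrow> dist (a U s) x0 < \<epsilon>1 \<Longrightarrow>
           (\<And>\<xi>. \<xi> \<in> \<kappa> \<Longrightarrow> (a U s - s) \<bullet> d x0 \<xi> = 0) \<Longrightarrow> U = mat 1"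
      using slice_injective[OF free[OF x0(1)]] by blast
    obtain \<epsilon>2 where \<epsilon>2: "\<epsilon>2 > 0" "ball x0 \<epsilon>2 \<inter> M \<subseteq> X"
      using X(1) x0(1) openin_contains_ball by metis
    define r where "r = min \<epsilon>1 \<epsilon>2 / 2"
    have r: "r > 0" "r < \<epsilon>1" "r < \<epsilon>2" using \<epsilon>1(1) \<epsilon>2(1) by (auto simp: r_def)
    have XM: "X \<subseteq> M" using X(1) openin_imp_subset by blast
    define T where "T = d x0 ` \<kappa>"
    define N where "N = {v \<in> M. \<forall>w\<in>T. orthogonal w v}"
    have lin: "linear (d x0)" using act_derivative has_derivative_linear by blast
    have T: "subspace T" unfolding T_def by (rule linear_subspace_image[OF lin lie_subspace])
    have TM: "T \<subseteq> M"
    proof -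
      have "d x0 \<xi> \<in> M" if \<xi>: "\<xi> \<in> \<kappa>" for \<xi>
      proof -
        obtain \<gamma> where \<gamma>: "\<gamma> 0 = mat 1" "range \<gamma> \<subseteq> \<Gamma>" "(\<gamma> has_vector_derivative \<xi>) (at 0)"
          using lie_one_parameter_group[OF \<xi>] by blast
        show ?thesis
          by (rule vector_derivative_in_subspace[OF derivative_along_curve[OF \<gamma>(1,3)] M(1)])
             (use \<gamma>(2) x0(1) XM M(2) in auto)
      qed
      then show ?thesis by (auto simp: T_def)
    qed
    have "inj_on (d x0) \<kappa>"
    proof (rule inj_onI)
      fix \<xi> \<xi>' assume *: "\<xi> \<in> \<kappa>" "\<xi>' \<in> \<kappa>" "d x0 \<xi> = d x0 \<xi>'"
      then have "d x0 (\<xi> - \<xi>') = 0" by (simp add: linear_diff[OF lin])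
      then have "\<xi> - \<xi>' = 0"
        using free_imp_infinitesimally_free[OF free[OF x0(1)]] * lie_subspace subspace_diff by blast
      then show "\<xi> = \<xi>'" by simp
    qed
    moreover have "span \<kappa> = \<kappa>" using lie_subspace by simp
    ultimately have "dim T = dim \<kappa>" unfolding T_def using dim_image_eq[OF lin, of \<kappa>] by metis
    moreover have "dim N + dim T = dim M"
      unfolding N_def by (rule dim_subspace_orthogonal_to_vectors[OF T M(1) TM])
    ultimately have dimN: "dim N = dim M - dim \<kappa>" by simp
    have N: "subspace N"
      unfolding N_def using M(1)
      by (auto simp: subspace_def orthogonal_def inner_add_right)
    have Nperp: "v \<bullet> d x0 \<xi> = 0" if "v \<in> N" "\<xi> \<in> \<kappa>" for v \<xi>
      using that by (auto simp: N_def T_def orthogonal_def inner_commute)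
    define S where "S = (+) x0 ` (N \<inter> ball 0 r)"
    define S' where "S' = (+) x0 ` (N \<inter> cball 0 r)"
    have SS': "S \<subseteq> S'" by (auto simp: S_def S'_def)
    have S'X: "S' \<subseteq> X"
    proof
      fix s assume "s \<in> S'"
      then obtain v where v: "v \<in> N" "norm v \<le> r" "s = x0 + v" by (auto simp: S'_def)
      then have "s \<in> M" using x0(1) XM M(1) by (auto simp: N_def subspace_add)
      moreover have "s \<in> ball x0 \<epsilon>2" using v r by (simp add: dist_norm)
      ultimately show "s \<in> X" using \<epsilon>2(2) by blast
    qed
    have "compact S'"
      unfolding S'_def by (intro compact_translation closed_Int_compact closed_subspace N compact_cball)
    have inj: "inj_on f S'"
    proof (rule inj_onI)
      fix s s' assume s: "s \<in> S'" "s' \<in> S'" "f s = f s'"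
      then obtain U where U: "U \<in> \<Gamma>" "s' = a U s" using fibre S'X by blast
      obtain v where v: "v \<in> N" "norm v \<le> r" "s = x0 + v" using s(1) by (auto simp: S'_def)
      obtain v' where v': "v' \<in> N" "norm v' \<le> r" "s' = x0 + v'" using s(2) by (auto simp: S'_def)
      have "U = mat 1"
      proof (rule \<epsilon>1(2)[OF U(1), of s])
        show "dist s x0 < \<epsilon>1" using v r by (simp add: dist_norm)
        show "dist (a U s) x0 < \<epsilon>1" using v' r U(2) by (simp add: dist_norm)
        fix \<xi> assume "\<xi> \<in> \<kappa>"
        then show "(a U s - s) \<bullet> d x0 \<xi> = 0"
          using Nperp[of v \<xi>] Nperp[of v' \<xi>] v v' U(2) by (simp add: inner_diff_left flip: U(2))
      qed
      then show "s = s'" using U(2) act_one by simp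
    qed
    have emb: "embedding_map (top_of_set S') Y f"
    proof (rule continuous_imp_embedding_map)
      show "continuous_map (top_of_set S') Y f"
        using continuous_map_from_subtopology_mono[OF cont S'X] .
    qed (use \<open>compact S'\<close> haus inj in \<open>auto simp: compact_space_subtopology compactin_euclidean_iff\<close>)
    have "homeomorphic_map (subtopology (top_of_set S') S) (subtopology (subtopology Y (f ` S')) (f ` S)) f"
      by (rule homeomorphic_map_subtopologies_alt)
         (use emb SS' inj in \<open>auto simp: embedding_map_def topY inj_on_def\<close>)
    then have "homeomorphic_map (top_of_set S) (subtopology Y (f ` S)) f"
      using SS' by (simp add: subtopology_subtopology Int_absorb1 image_mono)
    then have h1: "subtopology Y (f ` S) homeomorphic_space top_of_set S"
      using homeomorphic_map_imp_homeomorphic_space homeomorphic_space_sym by blast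
    have fS: "f ` S = f ` (X \<inter> ball x0 r)"
    proof
      show "f ` S \<subseteq> f ` (X \<inter> ball x0 r)"
        using SS' S'X by (auto simp: S_def dist_norm intro!: imageI)
      show "f ` (X \<inter> ball x0 r) \<subseteq> f ` S"
      proof clarsimp
        fix z assume z: "z \<in> X" "dist x0 z < r"
        obtain U where U: "U \<in> \<Gamma>" "dist (a U z) x0 \<le> dist z x0"
            "\<And>\<xi>. \<xi> \<in> \<kappa> \<Longrightarrow> (a U z - x0) \<bullet> d x0 \<xi> = 0"
          using slice_reached[of z x0] by blast
        have "a U z \<in> X" using X(3) U(1) z(1) by blast
        then have "a U z - x0 \<in> N"
          using U(3) subspace_diff[OF M(1), of "a U z" x0] subsetD[OF XM] x0(1)
          by (simp add: N_def T_def orthogonal_def inner_commute)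
        moreover have "norm (a U z - x0) < r" using U(2) z(2) by (simp add: dist_norm norm_minus_commute)
        ultimately have "a U z \<in> S"
          unfolding S_def by (intro image_eqI[of _ _ "a U z - x0"]) auto
        moreover have "f z = f (a U z)" using fibre[OF z(1) \<open>a U z \<in> X\<close>] U(1) by blast
        ultimately show "f z \<in> f ` S" by blast
      qed
    qed
    have opS: "openin Y (f ` S)"
      unfolding fS using opn unfolding open_map_def by (simp add: openin_open_Int)
    have "x0 \<in> S" using r N by (auto simp: S_def subspace_0 intro!: image_eqI[of _ _ 0])
    have "homeomorphic_maps (top_of_set S) (top_of_set (N \<inter> ball 0 r)) (\<lambda>y. y - x0) ((+) x0)"
      unfolding homeomorphic_maps_def S_def by (auto intro!: continuous_intros)
    then have h2: "top_of_set S homeomorphic_space top_of_set (N \<inter> ball 0 r)"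
      unfolding homeomorphic_space_def by blast
    obtain \<phi> where \<phi>: "homeomorphic_map (top_of_set N) (Euclidean_space (dim N)) \<phi>"
      using subspace_homeomorphic_Euclidean_space[OF N] homeomorphic_space by blast
    define W where "W = \<phi> ` (N \<inter> ball 0 r)"
    have W: "openin (Euclidean_space (dim N)) W"
      unfolding W_def using homeomorphic_imp_open_map[OF \<phi>] unfolding open_map_def
      by (simp add: openin_open_Int)
    have "homeomorphic_map (subtopology (top_of_set N) (N \<inter> ball 0 r))
        (subtopology (Euclidean_space (dim N)) W) \<phi>"
      unfolding W_def
      by (rule homeomorphic_map_subtopologies_alt[OF \<phi>])
         (use \<phi> in \<open>auto simp: homeomorphic_eq_everything_map inj_on_def\<close>)
    then have h3: "top_of_set (N \<inter> ball 0 r) homeomorphic_space subtopology (Euclidean_space (dim N)) W"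
      by (auto simp: subtopology_subtopology Int_absorb1 intro: homeomorphic_map_imp_homeomorphic_space)
    show ?thesis
      using opS \<open>x0 \<in> S\<close> x0(2) W homeomorphic_space_trans[OF h1 homeomorphic_space_trans[OF h2 h3]]
      unfolding dimN by blast
  qed
  show ?thesis
    unfolding manifold_of_dim_def Y_def[symmetric]
    using haus sc loc X(2) topY by blast
qed

end

section \<open>Hermitian forms in the monomials\<close>

lemma power_sum_coeff_zero:
  fixes c :: "'k \<Rightarrow> complex" and n :: "'k \<Rightarrow> nat"
  assumes "finite S" "infinite A" and zero: "\<And>x. x \<in> A \<Longrightarrow> (\<Sum>k\<in>S. c k * x ^ n k) = 0"
  shows "(\<Sum>k\<in>{k\<in>S. n k = m}. c k) = 0"
proof -
  define p where "p = (\<Sum>k\<in>S. monom (c k) (n k))"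
  have "poly p x = 0" if "x \<in> A" for x
    using zero[OF that] by (simp add: p_def poly_sum poly_monom)
  then have "A \<subseteq> {x. poly p x = 0}" by blast
  then have "p = 0" using \<open>infinite A\<close> poly_roots_finite finite_subset by blast
  then have "0 = coeff p m" by simp
  also have "\<dots> = (\<Sum>k\<in>S. if n k = m then c k else 0)"
    by (simp add: p_def coeff_sum)
  also have "\<dots> = (\<Sum>k\<in>{k\<in>S. n k = m}. c k)"
    using \<open>finite S\<close> by (simp add: sum.inter_filter)
  finally show ?thesis by simp
qed

lemma infinite_unit_circle: "infinite {u :: complex. cmod u = 1}"
proof
  assume fin: "finite {u :: complex. cmod u = 1}"
  have "(\<lambda>x. Complex x (sqrt (1 - x\<^sup>2))) ` {0..1} \<subseteq> {u. cmod u = 1}"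
    by (auto simp: complex_norm power2_eq_square mult_le_one)
  moreover have "inj_on (\<lambda>x. Complex x (sqrt (1 - x\<^sup>2))) {0..1}" by (auto simp: inj_on_def)
  ultimately have "finite {0..1::real}" using fin finite_imageD finite_subset by blast
  then show False by (simp add: infinite_Icc)
qed

text \<open>
  On the unit circle $\bar u=u^{-1}$, so that only the differences of exponents can be separated.
\<close>

lemma circle_sum_coeff_zero:
  fixes c :: "'k \<Rightarrow> complex" and a b :: "'k \<Rightarrow> nat"
  assumes fin: "finite S"
    and zero: "\<And>u. cmod u = 1 \<Longrightarrow> (\<Sum>k\<in>S. c k * (u ^ a k * cnj u ^ b k)) = 0"
  shows "(\<Sum>k\<in>{k\<in>S. int (a k) - int (b k) = e}. c k) = 0"
proof -
  \<comment> \<open>Multiplication by $u^m$ clears all negative powers of $u$.\<close>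
  define m where "m = (\<Sum>k\<in>S. b k)"
  have m: "b k \<le> m" if "k \<in> S" for k unfolding m_def using fin that by (simp add: member_le_sum)
  have "(\<Sum>k\<in>S. c k * u ^ (a k + (m - b k))) = 0" if u: "u \<in> {u. cmod u = 1}" for u
  proof -
    have uc: "u * cnj u = 1" using u by (simp add: complex_norm_square[symmetric])
    have "u ^ (a k + (m - b k)) = u ^ m * (u ^ a k * cnj u ^ b k)" if "k \<in> S" for k
    proof -
      have "u ^ m = u ^ (m - b k) * u ^ b k" using m[OF that] by (simp flip: power_add)
      then have "u ^ m * (u ^ a k * cnj u ^ b k) = u ^ (m - b k) * u ^ a k * (u * cnj u) ^ b k"
        by (simp add: power_mult_distrib)
      then have "u ^ m * (u ^ a k * cnj u ^ b k) = u ^ (m - b k) * u ^ a k"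
        by (simp only: uc power_one mult_1_right)
      then show ?thesis by (simp only: power_add mult.commute)
    qed
    then have "(\<Sum>k\<in>S. c k * u ^ (a k + (m - b k))) = u ^ m * (\<Sum>k\<in>S. c k * (u ^ a k * cnj u ^ b k))"
      by (simp add: sum_distrib_left mult.left_commute)
    then show ?thesis using zero u by simp
  qed
  from power_sum_coeff_zero[OF fin infinite_unit_circle this]
  have *: "(\<Sum>k\<in>{k\<in>S. a k + (m - b k) = nat (e + int m)}. c k) = 0" .
  show ?thesis
  proof (cases "e + int m \<ge> 0")
    case True
    have "{k\<in>S. int (a k) - int (b k) = e} = {k\<in>S. a k + (m - b k) = nat (e + int m)}"
      using True m by force
    then show ?thesis using * by simp
  next
    case False
    then have "{k\<in>S. int (a k) - int (b k) = e} = {}" using m by force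
    then show ?thesis by (metis sum.empty)
  qed
qed

text \<open>
  On the whole plane both exponents can be separated: the circle determines their difference and the
  radius their sum.
\<close>

lemma bidegree_sum_coeff_zero:
  fixes c :: "'k \<Rightarrow> complex" and a b :: "'k \<Rightarrow> nat"
  assumes fin: "finite S" and zero: "\<And>x. (\<Sum>k\<in>S. c k * (x ^ a k * cnj x ^ b k)) = 0"
  shows "(\<Sum>k\<in>{k\<in>S. a k = p \<and> b k = q}. c k) = 0"
proof -
  define e where "e = int p - int q"
  define S' where "S' = {k\<in>S. int (a k) - int (b k) = e}"
  have "(\<Sum>k\<in>S'. c k * x ^ (a k + b k)) = 0" if x: "x \<in> range complex_of_real" for x
  proof -
    obtain r where r: "x = complex_of_real r" using x by blast
    have "(\<Sum>k\<in>S. (c k * x ^ (a k + b k)) * (u ^ a k * cnj u ^ b k)) = 0" if "cmod u = 1" for u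
    proof -
      have "(c k * x ^ (a k + b k)) * (u ^ a k * cnj u ^ b k) = c k * ((x * u) ^ a k * cnj (x * u) ^ b k)" for k
        by (simp add: r power_mult_distrib power_add)
      then show ?thesis using zero[of "x * u"] by (simp only:)
    qed
    from circle_sum_coeff_zero[OF fin this, of e] show ?thesis by (simp add: S'_def)
  qed
  moreover have "infinite (range complex_of_real)"
    using finite_imageD[of complex_of_real UNIV] by (auto simp: inj_on_def infinite_UNIV_char_0)
  moreover have "finite S'" using fin by (simp add: S'_def)
  ultimately have "(\<Sum>k\<in>{k\<in>S'. a k + b k = p + q}. c k) = 0"
    by (intro power_sum_coeff_zero[where A = "range complex_of_real"])
  moreover have "{k\<in>S'. a k + b k = p + q} = {k\<in>S. a k = p \<and> b k = q}"
    by (auto simp: S'_def e_def)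
  ultimately show ?thesis by simp
qed

lemma exhaust_9:
  fixes x :: 9
  shows "x = 1 \<or> x = 2 \<or> x = 3 \<or> x = 4 \<or> x = 5 \<or> x = 6 \<or> x = 7 \<or> x = 8 \<or> x = 9"
proof (induct x)
  case (of_int z)
  then have "z = 0 \<or> z = 1 \<or> z = 2 \<or> z = 3 \<or> z = 4 \<or> z = 5 \<or> z = 6 \<or> z = 7 \<or> z = 8" by fastforce
  then show ?case by auto
qed

lemma forall_9: "(\<forall>i::9. P i) \<longleftrightarrow> P 1 \<and> P 2 \<and> P 3 \<and> P 4 \<and> P 5 \<and> P 6 \<and> P 7 \<and> P 8 \<and> P 9"
  by (metis exhaust_9)

lemma UNIV_9: "UNIV = {1, 2, 3, 4, 5, 6, 7, 8, 9 :: 9}"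
  using exhaust_9 by auto

lemma sum_9: "sum f (UNIV :: 9 set) = f 1 + f 2 + f 3 + f 4 + f 5 + f 6 + f 7 + f 8 + f 9"
  unfolding UNIV_9 by (simp add: ac_simps)

text \<open>
  The next three functions describe the entries of $\mathbf V$ as \<open>V_coeff i\<close> times a
  monomial of degree \<open>total_deg i\<close> with exponent \<open>z2_deg i\<close> of $z_2$.
\<close>

definition total_deg :: "9 \<Rightarrow> nat" where
  "total_deg i = (vector [1, 1, 2, 2, 2, 3, 3, 3, 3] :: nat ^ 9) $ i"

definition z2_deg :: "9 \<Rightarrow> nat" where
  "z2_deg i = (vector [0, 1, 0, 1, 2, 0, 1, 2, 3] :: nat ^ 9) $ i"

definition V_coeff :: "9 \<Rightarrow> complex" where
  "V_coeff i = (vector [1, 1, 1, of_real (sqrt 2), 1, 1, of_real (sqrt 3), of_real (sqrt 3), 1] :: complex ^ 9) $ i"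

lemma total_deg_nth [simp]:
  "total_deg 1 = 1" "total_deg 2 = 1" "total_deg 3 = 2" "total_deg 4 = 2" "total_deg 5 = 2"
  "total_deg 6 = 3" "total_deg 7 = 3" "total_deg 8 = 3" "total_deg 9 = 3"
  by (simp_all add: total_deg_def vector_def)

lemma z2_deg_nth [simp]:
  "z2_deg 1 = 0" "z2_deg 2 = 1" "z2_deg 3 = 0" "z2_deg 4 = 1" "z2_deg 5 = 2"
  "z2_deg 6 = 0" "z2_deg 7 = 1" "z2_deg 8 = 2" "z2_deg 9 = 3"
  by (simp_all add: z2_deg_def vector_def)

lemma V_coeff_nth [simp]:
  "V_coeff 1 = 1" "V_coeff 2 = 1" "V_coeff 3 = 1" "V_coeff 4 = of_real (sqrt 2)" "V_coeff 5 = 1"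
  "V_coeff 6 = 1" "V_coeff 7 = of_real (sqrt 3)" "V_coeff 8 = of_real (sqrt 3)" "V_coeff 9 = 1"
  by (simp_all add: V_coeff_def vector_def)

text \<open>
  Every point with $z_1\neq0$ has the form $(l,lt)$. Along these points \<open>l\<close> records the
  degree and \<open>t\<close> separates the monomials of one degree.
\<close>

lemma V_line: "V (vector [l, l * t]) $ i = V_coeff i * l ^ total_deg i * t ^ z2_deg i"
proof -
  have "\<forall>i. V (vector [l, l * t]) $ i = V_coeff i * l ^ total_deg i * t ^ z2_deg i"
    unfolding forall_9 using V_nth[of "vector [l, l * t]"]
    by (simp add: power_mult_distrib power2_eq_square power3_eq_cube)
  then show ?thesis by blast
qed

lemma V_coeff_nonzero: "V_coeff i \<noteq> 0"
  using exhaust_9[of i] by auto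

lemma V_index_eqI: "total_deg i = total_deg j \<Longrightarrow> z2_deg i = z2_deg j \<Longrightarrow> i = j"
proof -
  have "\<forall>i j. total_deg i = total_deg j \<longrightarrow> z2_deg i = z2_deg j \<longrightarrow> i = j"
    unfolding forall_9 by simp
  then show "total_deg i = total_deg j \<Longrightarrow> z2_deg i = z2_deg j \<Longrightarrow> i = j" by blast
qed

lemma total_deg_le: "total_deg i \<le> 3"
  using exhaust_9[of i] by auto

lemma cdot_matrix: "cdot v (M *v w) = (\<Sum>(i, j)\<in>UNIV. M $ i $ j * (cnj (v $ i) * w $ j))"
proof -
  have "cdot v (M *v w) = (\<Sum>i\<in>UNIV. \<Sum>j\<in>UNIV. M $ i $ j * (cnj (v $ i) * w $ j))"
    unfolding cdot_def matrix_vector_mult_def by (simp add: sum_distrib_left mult_ac)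
  then show ?thesis by (simp only: sum.cartesian_product UNIV_Times_UNIV)
qed

text \<open>
  The coefficients of the form along the points $(l,lt)$ with respect to the monomials in $l$ and
  $\bar l$.
\<close>

definition line_coeff :: "complex ^ 9 ^ 9 \<Rightarrow> complex \<Rightarrow> 9 \<times> 9 \<Rightarrow> complex" where
  "line_coeff M t k = M $ fst k $ snd k * V_coeff (fst k) * V_coeff (snd k) *
     (t ^ z2_deg (snd k) * cnj t ^ z2_deg (fst k))"

definition bidegree_block :: "nat \<Rightarrow> nat \<Rightarrow> (9 \<times> 9) set" where
  "bidegree_block p q = {k. total_deg (snd k) = p \<and> total_deg (fst k) = q}"

lemma form_on_line:
  "cdot (V (vector [l, l * t])) (M *v V (vector [l, l * t])) =
     (\<Sum>k\<in>UNIV. line_coeff M t k * (l ^ total_deg (snd k) * cnj l ^ total_deg (fst k)))"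
proof -
  have "cnj (V_coeff i) = V_coeff i" for i using exhaust_9[of i] by auto
  then show ?thesis
    unfolding cdot_matrix V_line line_coeff_def complex_cnj_mult complex_cnj_power case_prod_unfold
    by (intro sum.cong refl) (simp only: mult_ac)
qed

lemma block_zero_imp_entry_zero:
  assumes "\<And>t. (\<Sum>k\<in>bidegree_block p q. line_coeff M t k) = 0"
    and "total_deg j = p" "total_deg i = q"
  shows "M $ i $ j = (0 :: complex)"
proof -
  have "(\<Sum>k\<in>{k \<in> bidegree_block p q.
        z2_deg (snd k) = z2_deg j \<and> z2_deg (fst k) = z2_deg i}.
      M $ fst k $ snd k * V_coeff (fst k) * V_coeff (snd k)) = 0"
    by (rule bidegree_sum_coeff_zero[OF _ assms(1)[unfolded line_coeff_def]]) (rule finite)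
  moreover have "{k \<in> bidegree_block p q.
        z2_deg (snd k) = z2_deg j \<and> z2_deg (fst k) = z2_deg i} = {(i, j)}"
    unfolding bidegree_block_def set_eq_iff mem_Collect_eq singleton_iff prod_eq_iff
    using assms(2,3) V_index_eqI by (metis fst_conv snd_conv)
  ultimately have "(\<Sum>k\<in>{(i, j)}. M $ fst k $ snd k * V_coeff (fst k) * V_coeff (snd k)) = 0"
    by (simp only:)
  then show ?thesis using V_coeff_nonzero[of i] V_coeff_nonzero[of j] by simp
qed

text \<open>
  A sesquilinear form in the monomials is determined by its values on the diagonal: separate first the
  bidegrees in \<open>l\<close> and then those in \<open>t\<close>.
\<close>

lemma form_eq_zero_imp_zero:
  assumes form: "\<And>z. cdot (V z) (M *v V z) = 0"
  shows "M = 0"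
proof -
  note on_line = form[of "vector [l, l * t]" for l t, unfolded form_on_line]
  have "M $ i $ j = 0" for i j
  proof (rule block_zero_imp_entry_zero[where p = "total_deg j" and q = "total_deg i"])
    fix t
    have "(\<Sum>k\<in>{k \<in> UNIV. total_deg (snd k) = total_deg j \<and> total_deg (fst k) = total_deg i}.
       line_coeff M t k) = 0"
      by (rule bidegree_sum_coeff_zero[OF _ on_line]) (rule finite)
    then show "(\<Sum>k\<in>bidegree_block (total_deg j) (total_deg i). line_coeff M t k) = 0"
      by (simp add: bidegree_block_def)
  qed auto
  then show ?thesis by (simp add: vec_eq_iff)
qed

lemma norm_sq_2: "(norm (z :: complex ^ 2))\<^sup>2 = (cmod (z $ 1))\<^sup>2 + (cmod (z $ 2))\<^sup>2"
  by (simp add: norm_vec_def L2_set_def sum_2)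

text \<open>
  On the sphere the degrees of the two factors are only known up to a common shift. If all entries
  with both degrees below three vanish, then in each remaining entry one of the two degrees is three
  and the difference determines the other, so no information is lost.
\<close>

lemma sphere_form_eq_zero_imp_zero:
  assumes form: "\<And>z. z \<in> sphere 0 1 \<Longrightarrow> cdot (V z) (M *v V z) = 0"
    and low: "\<And>i j. total_deg i \<noteq> 3 \<Longrightarrow> total_deg j \<noteq> 3 \<Longrightarrow> M $ i $ j = 0"
  shows "M = 0"
proof -
  have "M $ i $ j = 0" if deg3: "total_deg i = 3 \<or> total_deg j = 3" for i j
  proof (rule block_zero_imp_entry_zero[where p = "total_deg j" and q = "total_deg i"])
    fix t
    \<comment> \<open>The factor that normalises $(1,t)$ to the sphere.\<close>
    define N where "N = complex_of_real (1 / sqrt (1 + (cmod t)\<^sup>2))"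
    have pos: "1 + (cmod t)\<^sup>2 > 0" by (simp add: add_pos_nonneg)
    have N0: "N \<noteq> 0" and cN: "cnj N = N" using pos by (simp_all add: N_def)
    define e where "e = int (total_deg j) - int (total_deg i)"
    define F where "F k = line_coeff M t k * N ^ (total_deg (snd k) + total_deg (fst k))" for k
    let ?B = "bidegree_block (total_deg j) (total_deg i)"
    let ?D = "{k\<in>UNIV. int (total_deg (snd k)) - int (total_deg (fst k)) = e}"
    have "sum F ?D = 0"
    proof (rule circle_sum_coeff_zero)
      fix u :: complex assume u: "cmod u = 1"
      let ?z = "vector [u * N, (u * N) * t] :: complex ^ 2"
      have "(norm ?z)\<^sup>2 = (cmod N)\<^sup>2 * (1 + (cmod t)\<^sup>2)"
        by (simp add: norm_sq_2 u norm_mult power_mult_distrib distrib_left)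
      also have "\<dots> = 1" using pos by (simp add: N_def norm_divide power_divide)
      finally have "norm ?z = 1" using power2_eq_imp_eq[of "norm ?z" 1] by simp
      then have zero: "cdot (V ?z) (M *v V ?z) = 0" using form by simp
      have "F k * (u ^ total_deg (snd k) * cnj u ^ total_deg (fst k)) =
          line_coeff M t k * ((u * N) ^ total_deg (snd k) * cnj (u * N) ^ total_deg (fst k))" for k
        by (simp add: F_def cN power_mult_distrib power_add)
      then show "(\<Sum>k\<in>UNIV. F k * (u ^ total_deg (snd k) * cnj u ^ total_deg (fst k))) = 0"
        using zero unfolding form_on_line by (simp only:)
    qed simp
    moreover have "sum F ?D = sum F ?B"
    proof (rule sum.mono_neutral_right)
      show "?B \<subseteq> ?D" by (auto simp: bidegree_block_def e_def)
      have "F k = 0" if k: "k \<in> ?D" "k \<notin> ?B" for k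
      proof -
        have "total_deg (snd k) \<noteq> 3 \<and> total_deg (fst k) \<noteq> 3"
          using k deg3 total_deg_le[of "snd k"] total_deg_le[of "fst k"]
            total_deg_le[of i] total_deg_le[of j] by (auto simp: bidegree_block_def e_def)
        then show ?thesis using low[of "fst k" "snd k"] by (simp add: F_def line_coeff_def)
      qed
      then show "\<forall>k\<in>?D - ?B. F k = 0" by blast
    qed simp
    moreover have "sum F ?B = (\<Sum>k\<in>?B. line_coeff M t k) * N ^ (total_deg j + total_deg i)"
      unfolding sum_distrib_right by (rule sum.cong) (auto simp: F_def bidegree_block_def)
    ultimately show "(\<Sum>k\<in>?B. line_coeff M t k) = 0" using N0 by simp
  qed auto
  then have "M $ i $ j = 0" for i j using low by blast
  then show ?thesis by (simp add: vec_eq_iff)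
qed

text \<open>
  The values of $\mathbf V$ span $\mathbb C^9$. This is what makes the definite description in
  \<open>rho\<close> meaningful.
\<close>

lemma V_spans:
  fixes A B :: "complex ^ 9 ^ 'n"
  assumes "\<And>z. A *v V z = B *v V z"
  shows "A = B"
proof -
  have "A $ p $ i = B $ p $ i" for p i
  proof -
    define r where "r j = A $ p $ j - B $ p $ j" for j
    have r: "(\<Sum>j\<in>UNIV. r j * V z $ j) = 0" for z
      using arg_cong[OF assms[of z], of "\<lambda>v. v $ p"]
      by (simp add: matrix_vector_mult_def r_def left_diff_distrib sum_subtractf)
    define M :: "complex ^ 9 ^ 9" where "M = (\<chi> i j. cnj (r i) * r j)"
    have "cdot (V z) (M *v V z) = 0" for z
    proof -
      have "M *v V z = 0" using r[of z]
        by (simp add: vec_eq_iff matrix_vector_mult_def M_def mult.assoc flip: sum_distrib_left)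
      then show ?thesis by (simp add: cdot_def)
    qed
    then have "M = 0" by (rule form_eq_zero_imp_zero)
    then have "M $ i $ i = 0" by simp
    then show ?thesis by (simp add: M_def r_def)
  qed
  then show ?thesis by (simp add: vec_eq_iff)
qed

section \<open>The representation on Gram matrices\<close>

lemma has_derivative_vec:
  fixes f :: "'a::euclidean_space \<Rightarrow> 'b::euclidean_space ^ 'n"
  assumes "\<And>i. ((\<lambda>x. f x $ i) has_derivative (\<lambda>h. f' h $ i)) (at a within S)"
  shows "(f has_derivative f') (at a within S)"
  unfolding has_derivative_componentwise_within[of f]
proof
  fix b :: "'b ^ 'n" assume "b \<in> Basis"
  then obtain i u where b: "b = axis i u" by (auto simp: Basis_vec_def)
  have "((\<lambda>x. f x $ i \<bullet> u) has_derivative (\<lambda>h. f' h $ i \<bullet> u)) (at a within S)"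
    using bounded_linear.has_derivative[OF bounded_linear_inner_left assms] .
  then show "((\<lambda>x. f x \<bullet> b) has_derivative (\<lambda>x. f' x \<bullet> b)) (at a within S)"
    by (simp add: b inner_axis)
qed

lemma differentiable_vec:
  fixes f :: "'a::euclidean_space \<Rightarrow> 'b::euclidean_space ^ 'n"
  assumes "\<And>i. (\<lambda>x. f x $ i) differentiable (at a within S)"
  shows "f differentiable (at a within S)"
proof -
  obtain f' where "\<And>i. ((\<lambda>x. f x $ i) has_derivative f' i) (at a within S)"
    using assms unfolding differentiable_def by metis
  then have "(f has_derivative (\<lambda>h. \<chi> i. f' i h)) (at a within S)"
    by (intro has_derivative_vec) simp
  then show ?thesis unfolding differentiable_def by blast
qed

lemma vec_nth_differentiable:
  fixes f :: "'a::real_normed_vector \<Rightarrow> 'b::real_normed_vector ^ 'n"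
  shows "f differentiable F \<Longrightarrow> (\<lambda>x. f x $ i) differentiable F"
  unfolding differentiable_def
  using bounded_linear.has_derivative[OF bounded_linear_vec_nth] by blast

lemma vector_9 [simp]:
  "(vector [a1, a2, a3, a4, a5, a6, a7, a8, a9] :: 'a::zero ^ 9) $ 1 = a1"
  "(vector [a1, a2, a3, a4, a5, a6, a7, a8, a9] :: 'a::zero ^ 9) $ 2 = a2"
  "(vector [a1, a2, a3, a4, a5, a6, a7, a8, a9] :: 'a::zero ^ 9) $ 3 = a3"
  "(vector [a1, a2, a3, a4, a5, a6, a7, a8, a9] :: 'a::zero ^ 9) $ 4 = a4"
  "(vector [a1, a2, a3, a4, a5, a6, a7, a8, a9] :: 'a::zero ^ 9) $ 5 = a5"
  "(vector [a1, a2, a3, a4, a5, a6, a7, a8, a9] :: 'a::zero ^ 9) $ 6 = a6"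
  "(vector [a1, a2, a3, a4, a5, a6, a7, a8, a9] :: 'a::zero ^ 9) $ 7 = a7"
  "(vector [a1, a2, a3, a4, a5, a6, a7, a8, a9] :: 'a::zero ^ 9) $ 8 = a8"
  "(vector [a1, a2, a3, a4, a5, a6, a7, a8, a9] :: 'a::zero ^ 9) $ 9 = a9"
  by (simp_all add: vector_def)

lemma cdot_adjoint_mat: "cdot v (adjoint_mat A *v w) = cdot (A *v v) w"
  unfolding cdot_def adjoint_mat_def matrix_vector_mult_def
  by (simp add: sum_distrib_left sum_distrib_right mult_ac) (rule sum.swap)

lemma adjoint_mat_mult: "adjoint_mat (A ** B) = adjoint_mat B ** adjoint_mat A"
  by (simp add: adjoint_mat_def matrix_matrix_mult_def vec_eq_iff mult.commute)

lemma adjoint_mat_adjoint_mat [simp]: "adjoint_mat (adjoint_mat A) = A"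
  by (simp add: adjoint_mat_def vec_eq_iff)

lemma adjoint_mat_one [simp]: "adjoint_mat (mat 1) = mat 1"
  by (simp add: adjoint_mat_def mat_def vec_eq_iff)

lemma cdot_self: "cdot v v = of_real ((norm v)\<^sup>2)"
  by (simp add: cdot_def norm_vec_def L2_set_def sum_nonneg mult.commute[of "cnj _"] flip: complex_norm_square)

lemma unitary_cdot: "unitary U \<Longrightarrow> cdot (U *v v) (U *v w) = cdot v w"
  unfolding unitary_def by (metis cdot_adjoint_mat matrix_vector_mul_assoc matrix_vector_mul_lid)

lemma unitary_norm: "unitary U \<Longrightarrow> norm (U *v v) = norm v"
  using unitary_cdot[of U v v] by (simp only: cdot_self of_real_eq_iff power2_eq_iff_nonneg norm_ge_zero)

lemma unitary_right: "unitary U \<Longrightarrow> U ** adjoint_mat U = mat 1"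
  unfolding unitary_def using matrix_left_right_inverse by blast

text \<open>
  The symmetric powers of \<open>U\<close> of orders one, two and three, in the normalised monomial
  bases.
\<close>

definition rho_matrix :: "complex ^ 2 ^ 2 \<Rightarrow> complex ^ 9 ^ 9" where
  "rho_matrix U = (let a = U $ 1 $ 1; b = U $ 1 $ 2; c = U $ 2 $ 1; e = U $ 2 $ 2;
      s = of_real (sqrt 2); r = of_real (sqrt 3) in
    vector [
      vector [a, b, 0, 0, 0, 0, 0, 0, 0],
      vector [c, e, 0, 0, 0, 0, 0, 0, 0],
      vector [0, 0, a * a, s * a * b, b * b, 0, 0, 0, 0],
      vector [0, 0, s * a * c, a * e + b * c, s * b * e, 0, 0, 0, 0],
      vector [0, 0, c * c, s * c * e, e * e, 0, 0, 0, 0],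
      vector [0, 0, 0, 0, 0, a * a * a, r * a * a * b, r * a * b * b, b * b * b],
      vector [0, 0, 0, 0, 0, r * a * a * c, a * a * e + 2 * a * b * c, 2 * a * b * e + b * b * c, r * b * b * e],
      vector [0, 0, 0, 0, 0, r * a * c * c, 2 * a * c * e + b * c * c, a * e * e + 2 * b * c * e, r * b * e * e],
      vector [0, 0, 0, 0, 0, c * c * c, r * c * c * e, r * c * e * e, e * e * e]])"

lemma sqrt_2_3_squares:
  "complex_of_real (sqrt 2) * complex_of_real (sqrt 2) = 2"
  "complex_of_real (sqrt 3) * complex_of_real (sqrt 3) = 3"
  by (simp_all flip: of_real_mult)

lemma V_equivariant: "V (U *v z) = rho_matrix U *v V z"
proof -
  obtain s r where sr: "complex_of_real (sqrt 2) = s" "complex_of_real (sqrt 3) = r" by blast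
  have s: "s * s = 2" and r: "r * r = 3" using sqrt_2_3_squares sr by auto
  have s': "s * (s * x) = 2 * x" and r': "r * (r * x) = 3 * x" for x
    by (simp_all add: s r flip: mult.assoc)
  have "\<forall>i. V (U *v z) $ i = (rho_matrix U *v V z) $ i"
    unfolding forall_9 matrix_vector_mult_def[of "rho_matrix U"] vec_lambda_beta sum_9
    unfolding V_nth rho_matrix_def Let_def vector_9 sr
    unfolding matrix_vector_mult_def vec_lambda_beta sum_2
    by (simp add: power2_eq_square power3_eq_cube algebra_simps s r s' r')
  then show ?thesis by (simp add: vec_eq_iff)
qed

lemma rho_eq: "rho U = rho_matrix U"
  unfolding rho_def
proof (rule the_equality)
  show "\<forall>z. V (U *v z) = rho_matrix U *v V z" by (simp add: V_equivariant)
  fix R assume "\<forall>z. V (U *v z) = R *v V z"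
  then show "R = rho_matrix U" by (intro V_spans) (simp add: V_equivariant[symmetric])
qed

lemma V_rho: "V (U *v z) = rho U *v V z"
  by (simp add: rho_eq V_equivariant)

lemma rho_mult: "rho (U ** W) = rho U ** rho W"
  by (rule V_spans) (metis V_rho matrix_vector_mul_assoc)

lemma rho_one: "rho (mat 1) = mat 1"
  by (rule V_spans) (metis V_rho matrix_vector_mul_lid)

text \<open>
  The reason for the weights $\sqrt2$ and $\sqrt3$: each block of $\mathbf V$ has a norm that depends
  only on $\|z\|$.
\<close>

lemma cdot_V_V:
  fixes z :: "complex ^ 2"
  shows "cdot (V z) (V z) = cdot z z + cdot z z ^ 2 + cdot z z ^ 3"
proof -
  obtain s r where sr: "complex_of_real (sqrt 2) = s" "complex_of_real (sqrt 3) = r" by blast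
  have s: "s * s = 2" and r: "r * r = 3" using sqrt_2_3_squares sr by auto
  have s': "s * (s * x) = 2 * x" and r': "r * (r * x) = 3 * x" for x
    by (simp_all add: s r flip: mult.assoc)
  have cs: "cnj s = s" "cnj r = r" by (simp_all flip: sr)
  obtain a b c e where "z $ 1 = a" "z $ 2 = b" "cnj a = c" "cnj b = e" by blast
  note atoms = this
  show ?thesis
    unfolding cdot_def sum_9 sum_2 V_nth sr complex_cnj_mult complex_cnj_power cs atoms
    by (simp add: power2_eq_square power3_eq_cube algebra_simps s r s' r')
qed

lemma unitary_rho: "unitary U \<Longrightarrow> unitary (rho U)"
proof -
  assume U: "unitary U"
  have "adjoint_mat (rho U) ** rho U - mat 1 = 0"
  proof (rule form_eq_zero_imp_zero)
    fix z
    have "cdot (V z) ((adjoint_mat (rho U) ** rho U) *v V z) = cdot (V (U *v z)) (V (U *v z))"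
      by (simp add: V_rho cdot_adjoint_mat flip: matrix_vector_mul_assoc)
    also have "\<dots> = cdot (V z) (V z)" by (simp add: cdot_V_V unitary_cdot[OF U])
    finally show "cdot (V z) ((adjoint_mat (rho U) ** rho U - mat 1) *v V z) = 0"
      by (simp add: matrix_vector_mult_diff_rdistrib cdot_def right_diff_distrib sum_subtractf)
  qed
  then show "unitary (rho U)" by (simp add: unitary_def)
qed

lemma rho_differentiable: "rho differentiable (at U)"
proof -
  have e: "(\<lambda>U. U $ i $ j) differentiable (at U)" for i j :: 2 and U :: "complex ^ 2 ^ 2"
    by (intro vec_nth_differentiable differentiable_ident)
  have "(\<lambda>U. rho_matrix U $ i $ j) differentiable (at U)" for i j
  proof -
    have "\<forall>i j. (\<lambda>U. rho_matrix U $ i $ j) differentiable (at U)"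
      unfolding forall_9 rho_matrix_def Let_def vector_9
      by (intro conjI differentiable_add differentiable_mult differentiable_const e)
    then show ?thesis by blast
  qed
  then have "rho_matrix differentiable (at U)" by (intro differentiable_vec)
  moreover have "rho = rho_matrix" using rho_eq by blast
  ultimately show ?thesis by simp
qed

lemma continuous_on_rho: "continuous_on S rho"
  using rho_differentiable by (intro continuous_at_imp_continuous_on ballI differentiable_imp_continuous_within) auto

lemma cdot_act: "cdot (V z) (act U H *v V z) = cdot (V (U *v z)) (H *v V (U *v z))"
  by (simp add: act_def V_rho cdot_adjoint_mat flip: matrix_vector_mul_assoc)

lemma act_mult: "act (U ** W) H = act W (act U H)"
  by (simp add: act_def rho_mult adjoint_mat_mult matrix_mul_assoc)

lemma act_one: "act (mat 1) H = H"
  by (simp add: act_def rho_one)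

lemma bounded_bilinear_matrix_mult:
  "bounded_bilinear ((**) :: complex ^ 'n ^ 'm \<Rightarrow> complex ^ 'k ^ 'n \<Rightarrow> complex ^ 'k ^ 'm)"
  by (rule bilinear_conv_bounded_bilinear[THEN iffD1])
     (auto simp: bilinear_def linear_iff matrix_matrix_mult_def vec_eq_iff scaleR_sum_right
        distrib_left distrib_right sum.distrib)

lemma bounded_linear_adjoint_mat: "bounded_linear (adjoint_mat :: complex ^ 'n ^ 'm \<Rightarrow> _)"
  by (rule linear_conv_bounded_linear[THEN iffD1])
     (auto simp: linear_iff adjoint_mat_def vec_eq_iff)

lemma bounded_linear_transpose: "bounded_linear (transpose :: complex ^ 'n ^ 'm \<Rightarrow> _)"
  by (rule linear_conv_bounded_linear[THEN iffD1])
     (auto simp: linear_iff transpose_def vec_eq_iff)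

lemmas matrix_mult_continuous_on = bounded_bilinear.continuous_on[OF bounded_bilinear_matrix_mult]
lemmas adjoint_mat_continuous_on = bounded_linear.continuous_on[OF bounded_linear_adjoint_mat]

lemma linear_act: "linear (act U)"
  unfolding act_def
  by (intro bounded_linear.linear
      bounded_linear_compose[OF bounded_bilinear.bounded_linear_left[OF bounded_bilinear_matrix_mult]
        bounded_bilinear.bounded_linear_right[OF bounded_bilinear_matrix_mult]])

lemma continuous_on_act: "continuous_on UNIV (\<lambda>(U, H). act U H)"
  unfolding act_def case_prod_unfold
  by (intro matrix_mult_continuous_on adjoint_mat_continuous_on continuous_on_compose2[OF continuous_on_rho[of UNIV]]
      continuous_on_fst continuous_on_snd continuous_on_id) auto

definition act_deriv :: "complex ^ 9 ^ 9 \<Rightarrow> complex ^ 2 ^ 2 \<Rightarrow> complex ^ 9 ^ 9" where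
  "act_deriv H \<xi> = frechet_derivative (\<lambda>U. act U H) (at (mat 1)) \<xi>"

lemma act_differentiable: "(\<lambda>U. act U H) differentiable (at U)"
proof -
  obtain D where D: "(rho has_derivative D) (at U)"
    using rho_differentiable differentiable_def by blast
  note 1 = bounded_linear.has_derivative[OF bounded_linear_adjoint_mat D]
  note 2 = bounded_bilinear.FDERIV[OF bounded_bilinear_matrix_mult 1 has_derivative_const[of H]]
  note 3 = bounded_bilinear.FDERIV[OF bounded_bilinear_matrix_mult 2 D]
  show ?thesis unfolding act_def differentiable_def using 3 by blast
qed

lemma act_has_derivative: "((\<lambda>U. act U H) has_derivative act_deriv H) (at (mat 1))"
  using act_differentiable[of H "mat 1"]
  unfolding act_deriv_def[abs_def] by (simp add: frechet_derivative_works)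

lemma norm_matrix_columns: "(norm (A :: complex ^ 'n ^ 'm))\<^sup>2 = (\<Sum>j\<in>UNIV. \<Sum>i\<in>UNIV. (cmod (A $ i $ j))\<^sup>2)"
  by (simp add: norm_vec_def L2_set_def sum_nonneg) (rule sum.swap)

lemma norm_adjoint_mat: "norm (adjoint_mat A) = norm A"
proof -
  have "(norm (adjoint_mat A))\<^sup>2 = (norm A)\<^sup>2"
    unfolding norm_matrix_columns[of A] by (simp add: norm_vec_def L2_set_def sum_nonneg adjoint_mat_def)
  then show ?thesis by simp
qed

lemma norm_unitary_mult:
  assumes "unitary R" shows "norm (R ** A) = norm A"
proof -
  have "(\<Sum>i\<in>UNIV. (cmod ((R ** A) $ i $ j))\<^sup>2) = (\<Sum>i\<in>UNIV. (cmod (A $ i $ j))\<^sup>2)" for j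
  proof -
    have "(norm (R *v column j A))\<^sup>2 = (norm (column j A))\<^sup>2" using unitary_norm[OF assms] by simp
    then show ?thesis
      by (simp add: norm_vec_def L2_set_def sum_nonneg column_def matrix_vector_mult_def matrix_matrix_mult_def)
  qed
  then have "(norm (R ** A))\<^sup>2 = (norm A)\<^sup>2" by (simp add: norm_matrix_columns)
  then show ?thesis by simp
qed

lemma norm_act: "unitary U \<Longrightarrow> norm (act U H) = norm H"
proof -
  assume U: "unitary U"
  then have R: "unitary (rho U)" by (rule unitary_rho)
  then have R': "unitary (adjoint_mat (rho U))" by (simp add: unitary_def unitary_right)
  have "norm (act U H) = norm (H ** rho U)"
    unfolding act_def matrix_mul_assoc[symmetric] by (rule norm_unitary_mult[OF R'])
  also have "\<dots> = norm (adjoint_mat (rho U) ** adjoint_mat H)"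
    by (simp add: norm_adjoint_mat flip: adjoint_mat_mult)
  also have "\<dots> = norm H" by (simp add: norm_unitary_mult[OF R'] norm_adjoint_mat)
  finally show ?thesis .
qed

section \<open>Forms that vanish on the sphere\<close>

text \<open>
  The tangent directions at a Gram matrix over a fixed parameter.
\<close>

definition kernel_forms :: "(complex ^ 9 ^ 9) set" where
  "kernel_forms = {K. hermitian K \<and> (\<forall>z\<in>sphere 0 1. cdot (V z) (K *v V z) = 0)}"

text \<open>
  Hermitian forms in the five monomials of degree one and two, extended by zero.
\<close>

definition low_forms :: "(complex ^ 9 ^ 9) set" where
  "low_forms = {Q. hermitian Q \<and> (\<forall>i j. total_deg i = 3 \<or> total_deg j = 3 \<longrightarrow> Q $ i $ j = 0)}"

lemma hermitian_nth: "hermitian A \<longleftrightarrow> (\<forall>i j. cnj (A $ j $ i) = A $ i $ j)"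
  by (simp add: hermitian_def adjoint_mat_def vec_eq_iff)

lemma subspace_hermitian: "subspace {A. hermitian A}"
  by (auto simp: subspace_def hermitian_nth)

lemma cdot_matrix_linear: "cdot v ((A + B) *v w) = cdot v (A *v w) + cdot v (B *v w)"
   "cdot v ((A - B) *v w) = cdot v (A *v w) - cdot v (B *v w)"
   "cdot v ((c *\<^sub>R A) *v w) = c *\<^sub>R cdot v (A *v w)"
  unfolding cdot_matrix
  by (simp_all add: case_prod_unfold distrib_right left_diff_distrib sum.distrib sum_subtractf scaleR_sum_right)

lemma cdot_zero_right [simp]: "cdot v 0 = 0"
  by (simp add: cdot_def)

lemma subspace_kernel_forms: "subspace kernel_forms"
  using subspace_hermitian by (auto simp: subspace_def kernel_forms_def cdot_matrix_linear)

text \<open>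
  A real $5\times5$ matrix $x$ encodes the Hermitian matrix $(x+x^t)+i(x-x^t)$.
\<close>

lemma dim_low_forms: "dim low_forms = 25"
proof -
  define I where "I = {i. total_deg i \<noteq> 3}"
  have I: "I = {1, 2, 3, 4, 5}"
  proof (rule set_eqI)
    show "i \<in> I \<longleftrightarrow> i \<in> {1, 2, 3, 4, 5}" for i
      using exhaust_9[of i] by (auto simp: I_def)
  qed
  define d where "d = (\<lambda>(i, j). axis i (axis j 1) :: real ^ 9 ^ 9) ` (I \<times> I)"
  define S where "S = {x :: real ^ 9 ^ 9. \<forall>b\<in>Basis. b \<notin> d \<longrightarrow> x \<bullet> b = 0}"
  have inj: "inj (\<lambda>(i, j). axis i (axis j 1) :: real ^ 9 ^ 9)"
    by (auto simp: inj_on_def axis_eq_axis)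
  have "d \<subseteq> Basis" by (auto simp: d_def Basis_vec_def)
  then have "dim S = card d" unfolding S_def by (rule dim_substandard)
  also have "\<dots> = card (I \<times> I)"
    unfolding d_def by (rule card_image) (rule inj_on_subset[OF inj], simp)
  also have "\<dots> = 25" by (simp add: I card_cartesian_product)
  finally have dimS: "dim S = 25" .
  have S_iff: "x \<in> S \<longleftrightarrow> (\<forall>i j. total_deg i = 3 \<or> total_deg j = 3 \<longrightarrow> x $ i $ j = 0)" for x
  proof -
    have "axis i (axis j 1) \<in> d \<longleftrightarrow> i \<in> I \<and> j \<in> I" for i j
      unfolding d_def by (auto simp: axis_eq_axis image_iff)
    then have "x \<in> S \<longleftrightarrow> (\<forall>i j. \<not> (i \<in> I \<and> j \<in> I) \<longrightarrow> x $ i $ j = 0)"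
      unfolding S_def Basis_vec_def by (auto simp: inner_axis)
    then show ?thesis by (auto simp: I_def)
  qed
  define f :: "real ^ 9 ^ 9 \<Rightarrow> complex ^ 9 ^ 9"
    where "f x = (\<chi> i j. Complex (x $ i $ j + x $ j $ i) (x $ i $ j - x $ j $ i))" for x
  have lin: "linear f"
    by (auto simp: linear_iff f_def vec_eq_iff complex_eq_iff algebra_simps)
  have "inj f"
  proof (rule injI)
    fix x y assume "f x = f y"
    then have "x $ i $ j - x $ j $ i = y $ i $ j - y $ j $ i \<and> x $ i $ j + x $ j $ i = y $ i $ j + y $ j $ i" for i j
      by (simp add: f_def vec_eq_iff)
    then have "x $ i $ j = y $ i $ j" for i j
      by (smt (verit) field_sum_of_halves)
    then show "x = y" by (simp add: vec_eq_iff)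
  qed
  have "low_forms = f ` S"
  proof
    show "low_forms \<subseteq> f ` S"
    proof
      fix Q assume Q: "Q \<in> low_forms"
      define x where "x = (\<chi> i j. (Re (Q $ i $ j) + Im (Q $ i $ j)) / 2)"
      have Qc: "Q $ j $ i = cnj (Q $ i $ j)" for i j
        using Q by (simp add: low_forms_def hermitian_nth)
      have "Q $ i $ j = f x $ i $ j" for i j
        using Qc[of j i] by (simp add: f_def x_def complex_eq_iff field_simps)
      then have "Q = f x" by (simp add: vec_eq_iff)
      moreover have "x \<in> S" using Q by (simp add: S_iff x_def low_forms_def)
      ultimately show "Q \<in> f ` S" by blast
    qed
    show "f ` S \<subseteq> low_forms"
      by (auto simp: low_forms_def hermitian_nth f_def complex_eq_iff S_iff)
  qed
  moreover have "dim (f ` S) = dim S"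
    by (rule dim_image_eq[OF lin inj_on_subset[OF \<open>inj f\<close>]]) simp
  ultimately show ?thesis using dimS by simp
qed

text \<open>
  The matrices of multiplication by $z_1$ and by $z_2$ from degrees one and two to degrees two and
  three, in the normalised monomials.
\<close>

definition shift1 :: "complex ^ 9 ^ 9" where
  "shift1 = vector [
     axis 3 1,
     axis 4 (of_real (1 / sqrt 2)),
     axis 6 1,
     axis 7 (of_real (sqrt 2 / sqrt 3)),
     axis 8 (of_real (1 / sqrt 3)), 0, 0, 0, 0]"

definition shift2 :: "complex ^ 9 ^ 9" where
  "shift2 = vector [
     axis 4 (of_real (1 / sqrt 2)),
     axis 5 1,
     axis 7 (of_real (1 / sqrt 3)),
     axis 8 (of_real (sqrt 2 / sqrt 3)),
     axis 9 1, 0, 0, 0, 0]"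

lemma axis_mult: "(\<Sum>j\<in>UNIV. axis k c $ j * x $ j) = c * (x $ k :: complex)"
  unfolding axis_def by (simp add: if_distrib[of "\<lambda>y. y * _"] cong: if_cong)

lemma shift_V:
  "shift1 *v V z = z $ 1 *s (\<chi> i. if total_deg i = 3 then 0 else V z $ i)"
  "shift2 *v V z = z $ 2 *s (\<chi> i. if total_deg i = 3 then 0 else V z $ i)"
proof -
  have s: "complex_of_real (1 / sqrt 2) * complex_of_real (sqrt 2) = 1"
     "complex_of_real (1 / sqrt 3) * complex_of_real (sqrt 3) = 1"
     "complex_of_real (sqrt 2 / sqrt 3) * complex_of_real (sqrt 3) = complex_of_real (sqrt 2)"
    by (simp_all only: of_real_mult[symmetric]) simp_all
  note s' = s s[unfolded mult.commute[of "complex_of_real (_ / _)"]]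
  show "shift1 *v V z = z $ 1 *s (\<chi> i. if total_deg i = 3 then 0 else V z $ i)"
    unfolding vec_eq_iff forall_9 shift1_def matrix_vector_mult_def vec_lambda_beta vector_9 axis_mult V_nth
      vector_smult_component
    by (simp add: s' mult.assoc power2_eq_square power3_eq_cube mult_ac del: of_real_divide)
  show "shift2 *v V z = z $ 2 *s (\<chi> i. if total_deg i = 3 then 0 else V z $ i)"
    unfolding vec_eq_iff forall_9 shift2_def matrix_vector_mult_def vec_lambda_beta vector_9 axis_mult V_nth
      vector_smult_component
    by (simp add: s' mult.assoc power2_eq_square power3_eq_cube mult_ac del: of_real_divide)
qed

lemma shift_degree:
  "shift1 $ i $ j \<noteq> 0 \<Longrightarrow> total_deg j = Suc (total_deg i)"
  "shift2 $ i $ j \<noteq> 0 \<Longrightarrow> total_deg j = Suc (total_deg i)"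
proof -
  have "\<forall>i j. shift1 $ i $ j \<noteq> 0 \<longrightarrow> total_deg j = Suc (total_deg i)"
    unfolding forall_9[where P = "\<lambda>i. \<forall>j. _ i j"] shift1_def vector_9 by (auto simp: axis_def)
  then show "shift1 $ i $ j \<noteq> 0 \<Longrightarrow> total_deg j = Suc (total_deg i)" by blast
  have "\<forall>i j. shift2 $ i $ j \<noteq> 0 \<longrightarrow> total_deg j = Suc (total_deg i)"
    unfolding forall_9[where P = "\<lambda>i. \<forall>j. _ i j"] shift2_def vector_9 by (auto simp: axis_def)
  then show "shift2 $ i $ j \<noteq> 0 \<Longrightarrow> total_deg j = Suc (total_deg i)" by blast
qed

text \<open>
  For \<open>Q\<close> in \<open>low_forms\<close>, the matrix of the form $(\|z\|^2-1)\,\mathbf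
  V^*Q\mathbf V$.
\<close>

definition sphere_multiple :: "complex ^ 9 ^ 9 \<Rightarrow> complex ^ 9 ^ 9" where
  "sphere_multiple Q = adjoint_mat shift1 ** Q ** shift1 + adjoint_mat shift2 ** Q ** shift2 - Q"

lemma linear_sphere_multiple: "linear sphere_multiple"
  unfolding sphere_multiple_def
  by (intro bounded_linear.linear bounded_linear_sub bounded_linear_add bounded_linear_ident
      bounded_linear_compose[OF bounded_bilinear.bounded_linear_left[OF bounded_bilinear_matrix_mult]
        bounded_bilinear.bounded_linear_right[OF bounded_bilinear_matrix_mult]])

lemma hermitian_congruence: "hermitian Q \<Longrightarrow> hermitian (adjoint_mat A ** Q ** A)"
  by (simp add: hermitian_def adjoint_mat_mult matrix_mul_assoc)

lemma cdot_congruence: "cdot v ((adjoint_mat A ** Q ** A) *v w) = cdot (A *v v) (Q *v (A *v w))"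
  by (simp add: cdot_adjoint_mat flip: matrix_vector_mul_assoc)

lemma cdot_smult: "cdot (c *s v) (Q *v (c *s v)) = cnj c * c * cdot v (Q *v v)"
  unfolding cdot_matrix by (simp add: case_prod_unfold sum_distrib_left mult_ac)

lemma sphere_multiple_form:
  assumes "Q \<in> low_forms"
  shows "cdot (V z) (sphere_multiple Q *v V z) = (cdot z z - 1) * cdot (V z) (Q *v V z)"
proof -
  define W where "W = (\<chi> i. if total_deg i = 3 then 0 else V z $ i)"
  have W: "cdot W (Q *v W) = cdot (V z) (Q *v V z)"
    unfolding cdot_matrix
    by (rule sum.cong) (use assms in \<open>auto simp: low_forms_def W_def\<close>)
  show ?thesis
    unfolding sphere_multiple_def cdot_matrix_linear cdot_congruence shift_V W_def[symmetric] cdot_smult W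
    by (simp add: cdot_def[of z z] sum_2 algebra_simps)
qed

lemma sphere_multiple_in_kernel:
  assumes Q: "Q \<in> low_forms" shows "sphere_multiple Q \<in> kernel_forms"
proof -
  have "hermitian Q" using Q by (simp add: low_forms_def)
  then have "hermitian (sphere_multiple Q)"
    unfolding sphere_multiple_def
    using hermitian_congruence subspace_hermitian
    by (metis (no_types, lifting) mem_Collect_eq subspace_add subspace_diff)
  then show ?thesis
    unfolding kernel_forms_def by (auto simp: sphere_multiple_form[OF Q] cdot_self)
qed

lemma shift_congruence_low:
  assumes E: "\<And>i j. E $ i $ j \<noteq> 0 \<Longrightarrow> total_deg j = Suc (total_deg i)"
    and Q: "\<And>p q. total_deg p < n \<Longrightarrow> Q $ p $ q = 0" and i: "total_deg i < Suc n"
  shows "(adjoint_mat E ** Q ** E) $ i $ j = 0"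
proof -
  have "cnj (E $ p $ i) * Q $ p $ q = 0" for p q
    using E[of p i] Q[of p q] i by (cases "E $ p $ i = 0") auto
  then have "(\<Sum>p\<in>UNIV. cnj (E $ p $ i) * Q $ p $ q) = 0" for q by (intro sum.neutral) blast
  then show ?thesis
    by (simp add: matrix_matrix_mult_def adjoint_mat_def)
qed

lemma sphere_multiple_top_rows:
  assumes "total_deg i = 1" shows "sphere_multiple Q $ i $ j = - Q $ i $ j"
proof -
  have d: "total_deg i < Suc 1" using assms by simp
  have "total_deg p \<ge> 1" for p using exhaust_9[of p] by auto
  then have low: "total_deg p < 1 \<Longrightarrow> Q $ p $ q = 0" for p q by (metis not_le)
  show ?thesis
    unfolding sphere_multiple_def
    using shift_congruence_low[OF shift_degree(1) low d] shift_congruence_low[OF shift_degree(2) low d]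
    by simp
qed

text \<open>
  The subtracted \<open>Q\<close> preserves degrees while the two other terms raise them. So
  \<open>Q\<close> can be recovered degree by degree.
\<close>

lemma sphere_multiple_eq_zero:
  assumes "sphere_multiple Q = 0" shows "Q = 0"
proof -
  have eq: "Q = adjoint_mat shift1 ** Q ** shift1 + adjoint_mat shift2 ** Q ** shift2"
    using assms by (simp add: sphere_multiple_def)
  have "\<forall>i j. total_deg i < n \<longrightarrow> Q $ i $ j = 0" for n
  proof (induction n)
    case (Suc n)
    show ?case
    proof (intro allI impI)
      fix i j assume i: "total_deg i < Suc n"
      have "(adjoint_mat shift1 ** Q ** shift1) $ i $ j = 0"
        by (rule shift_congruence_low[OF shift_degree(1) _ i]) (use Suc in auto)
      moreover have "(adjoint_mat shift2 ** Q ** shift2) $ i $ j = 0"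
        by (rule shift_congruence_low[OF shift_degree(2) _ i]) (use Suc in auto)
      ultimately show "Q $ i $ j = 0" by (subst eq) simp
    qed
  qed simp
  then show ?thesis by (simp add: vec_eq_iff) (metis lessI)
qed

text \<open>
  Multiples of $\|z\|^2-1$ give the lower bound. For the upper bound, an element of the kernel is
  determined by its entries of degree at most two, by \<open>sphere_form_eq_zero_imp_zero\<close>.
\<close>

lemma dim_kernel_forms: "dim kernel_forms = 25"
proof (rule antisym)
  have "inj sphere_multiple"
    using linear_injective_0[OF linear_sphere_multiple] sphere_multiple_eq_zero by blast
  then have "dim low_forms = dim (sphere_multiple ` low_forms)"
    using dim_image_eq[OF linear_sphere_multiple, of low_forms] by (metis inj_on_subset subset_UNIV)
  also have "\<dots> \<le> dim kernel_forms"
    using sphere_multiple_in_kernel by (intro dim_subset) blast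
  finally show "25 \<le> dim kernel_forms" by (simp add: dim_low_forms)
next
  define trunc :: "complex ^ 9 ^ 9 \<Rightarrow> complex ^ 9 ^ 9"
    where "trunc K = (\<chi> i j. if total_deg i = 3 \<or> total_deg j = 3 then 0 else K $ i $ j)" for K
  have lin: "linear trunc" by (auto simp: linear_iff trunc_def vec_eq_iff)
  have inj: "inj_on trunc kernel_forms"
  proof (rule inj_onI)
    fix K L assume KL: "K \<in> kernel_forms" "L \<in> kernel_forms" "trunc K = trunc L"
    have "K - L \<in> kernel_forms" using KL subspace_diff[OF subspace_kernel_forms] by blast
    then have "K - L = 0"
    proof (intro sphere_form_eq_zero_imp_zero)
      fix i j assume "total_deg i \<noteq> 3" "total_deg j \<noteq> 3"
      then show "(K - L) $ i $ j = 0"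
        using arg_cong[OF KL(3), of "\<lambda>A. A $ i $ j"] by (simp add: trunc_def)
    qed (auto simp: kernel_forms_def)
    then show "K = L" by simp
  qed
  have "dim kernel_forms = dim (trunc ` kernel_forms)"
    using dim_image_eq[OF lin, of kernel_forms] inj span_eq_iff[THEN iffD2, OF subspace_kernel_forms] by metis
  also have "\<dots> \<le> dim low_forms"
    by (intro dim_subset) (auto simp: kernel_forms_def low_forms_def hermitian_nth trunc_def)
  finally show "dim kernel_forms \<le> 25" by (simp add: dim_low_forms)
qed

section \<open>The symmetry groups and their Lie algebras\<close>

text \<open>
  The functions $\cosh(wt)$ and $\sinh(wt)/w$ with $w^2=\delta$, which degenerate to $1$ and $t$ if
  $\delta=0$.
\<close>

lemma exponential_coefficients:
  fixes \<delta> :: complex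
  obtains C S where "C 0 = 1" "S 0 = 0"
    "\<And>s t. C (s + t) = C s * C t + \<delta> * (S s * S t)"
    "\<And>s t. S (s + t) = S s * C t + C s * S t"
    "(C has_field_derivative 0) (at 0)" "(S has_field_derivative 1) (at 0)"
proof (cases "\<delta> = 0")
  case True
  show thesis
    by (rule that[of "\<lambda>_. 1" "\<lambda>t. t"]) (auto simp: True intro!: derivative_eq_intros)
next
  case False
  define w where "w = csqrt \<delta>"
  have w: "w \<noteq> 0" "w * w = \<delta>" using False by (auto simp: w_def simp flip: power2_eq_square)
  show thesis
  proof (rule that[of "\<lambda>t. cosh (w * t)" "\<lambda>t. sinh (w * t) / w"])
    show "cosh (w * (s + t)) = cosh (w * s) * cosh (w * t) + \<delta> * (sinh (w * s) / w * (sinh (w * t) / w))" for s t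
      using w by (simp add: distrib_left cosh_add flip: w(2))
    show "sinh (w * (s + t)) / w = sinh (w * s) / w * cosh (w * t) + cosh (w * s) * (sinh (w * t) / w)" for s t
      using w by (simp add: distrib_left sinh_add add_divide_distrib)
  qed (use w in \<open>auto intro!: derivative_eq_intros\<close>)
qed

text \<open>
  The matrix exponential in closed form. A traceless $2\times2$ matrix $\eta$ satisfies $\eta^2=\delta
  I$ with a scalar $\delta$, hence $\exp(t(\tau I+\eta))=e^{\tau t}(C(t)I+S(t)\eta)$ with the
  functions $C,S$ of the previous lemma.
\<close>

lemma one_parameter_group_2x2:
  fixes \<xi> :: "complex ^ 2 ^ 2"
  obtains \<gamma> :: "real \<Rightarrow> complex ^ 2 ^ 2"
  where "\<gamma> 0 = mat 1" "\<And>s t. \<gamma> (s + t) = \<gamma> s ** \<gamma> t" "(\<gamma> has_vector_derivative \<xi>) (at 0)"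
proof -
  define \<tau> where "\<tau> = (\<xi> $ 1 $ 1 + \<xi> $ 2 $ 2) / 2"
  define p where "p = (\<xi> $ 1 $ 1 - \<xi> $ 2 $ 2) / 2"
  define \<delta> where "\<delta> = p * p + \<xi> $ 1 $ 2 * \<xi> $ 2 $ 1"
  obtain C S where CS: "C 0 = 1" "S 0 = 0"
    "\<And>s t. C (s + t) = C s * C t + \<delta> * (S s * S t)"
    "\<And>s t. S (s + t) = S s * C t + C s * S t"
    "(C has_field_derivative 0) (at 0)" "(S has_field_derivative 1) (at 0)"
    using exponential_coefficients by blast
  define \<eta> :: "complex ^ 2 ^ 2" where "\<eta> = vector [vector [p, \<xi> $ 1 $ 2], vector [\<xi> $ 2 $ 1, - p]]"
  define e :: "complex ^ 2 ^ 2" where "e = mat 1"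
  define E where "E z i j = exp (\<tau> * z) * (C z * e $ i $ j + S z * \<eta> $ i $ j)" for z i j
  define \<gamma> :: "real \<Rightarrow> complex ^ 2 ^ 2" where "\<gamma> t = (\<chi> i j. E (of_real t) i j)" for t
  have e_nth: "e $ 1 $ 1 = 1" "e $ 1 $ 2 = 0" "e $ 2 $ 1 = 0" "e $ 2 $ 2 = 1"
    by (simp_all add: e_def mat_def)
  show thesis
  proof
    show "\<gamma> 0 = mat 1" by (simp add: \<gamma>_def E_def CS e_def vec_eq_iff)
    show "\<gamma> (s + t) = \<gamma> s ** \<gamma> t" for s t
      unfolding vec_eq_iff forall_2 matrix_matrix_mult_def \<gamma>_def vec_lambda_beta sum_2 E_def
        of_real_add CS(3,4) e_nth \<eta>_def vector_2 distrib_left[of \<tau>] exp_add \<delta>_def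
      by (intro conjI; simp add: algebra_simps)
    show "(\<gamma> has_vector_derivative \<xi>) (at 0)"
      unfolding has_vector_derivative_def
    proof (intro has_derivative_vec)
      fix i j :: 2
      have "((\<lambda>z. E z i j) has_field_derivative (\<tau> * e $ i $ j + \<eta> $ i $ j)) (at (of_real 0))"
        unfolding E_def using CS by (auto intro!: derivative_eq_intros)
      from has_vector_derivative_real_field[OF this]
      have "((\<lambda>t. \<gamma> t $ i $ j) has_vector_derivative (\<tau> * e $ i $ j + \<eta> $ i $ j)) (at 0)"
        by (simp add: \<gamma>_def)
      moreover have "\<forall>i j. \<tau> * e $ i $ j + \<eta> $ i $ j = \<xi> $ i $ j"
        unfolding forall_2 e_nth \<eta>_def vector_2 \<tau>_def p_def by (simp add: field_simps)
      ultimately show "((\<lambda>t. \<gamma> t $ i $ j) has_derivative (\<lambda>t. (t *\<^sub>R \<xi>) $ i $ j)) (at 0)"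
        by (simp add: has_vector_derivative_def)
    qed
  qed
qed

text \<open>
  The linearisations at the identity of $U^*U=I$ and $U^tD_\sigma U=D_\sigma$.
\<close>

definition lie :: "real \<times> real \<Rightarrow> (complex ^ 2 ^ 2) set" where
  "lie \<sigma> = {\<xi>. adjoint_mat \<xi> + \<xi> = 0 \<and> transpose \<xi> ** D_mat \<sigma> + D_mat \<sigma> ** \<xi> = 0}"

lemma matrix_mult_zero [simp]: "A ** (0 :: complex ^ 'n ^ 'm) = 0"
  by (simp add: matrix_matrix_mult_def vec_eq_iff)

lemma unitary_sesqui_derivative:
  "((\<lambda>U. adjoint_mat U ** U) has_derivative (\<lambda>\<xi>. adjoint_mat \<xi> + \<xi>)) (at (mat 1 :: complex ^ 2 ^ 2))"
  by (rule has_derivative_eq_rhs[OF bounded_bilinear.FDERIV[OF bounded_bilinear_matrix_mult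
      bounded_linear.has_derivative[OF bounded_linear_adjoint_mat has_derivative_ident] has_derivative_ident]])
    (simp add: add.commute fun_eq_iff)

lemma transpose_congruence_derivative:
  fixes D :: "complex ^ 2 ^ 2"
  shows "((\<lambda>U. transpose U ** D ** U) has_derivative (\<lambda>\<xi>. transpose \<xi> ** D + D ** \<xi>)) (at (mat 1))"
  by (rule has_derivative_eq_rhs[OF bounded_bilinear.FDERIV[OF bounded_bilinear_matrix_mult
      bounded_bilinear.FDERIV[OF bounded_bilinear_matrix_mult
      bounded_linear.has_derivative[OF bounded_linear_transpose has_derivative_ident] has_derivative_const]
      has_derivative_ident]])
    (simp add: add.commute fun_eq_iff transpose_mat)

lemma G_one: "mat 1 \<in> G \<sigma>"
  by (simp add: G_def unitary_def transpose_mat)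

lemma G_mult:
  assumes "U \<in> G \<sigma>" "W \<in> G \<sigma>" shows "U ** W \<in> G \<sigma>"
proof -
  have "adjoint_mat (U ** W) ** (U ** W) = adjoint_mat W ** (adjoint_mat U ** U) ** W"
    by (simp add: adjoint_mat_mult matrix_mul_assoc)
  moreover have "transpose (U ** W) ** D_mat \<sigma> ** (U ** W) =
      transpose W ** (transpose U ** D_mat \<sigma> ** U) ** W"
    by (simp add: matrix_transpose_mul matrix_mul_assoc)
  ultimately show ?thesis using assms by (simp add: G_def unitary_def)
qed

lemma G_adjoint:
  assumes "U \<in> G \<sigma>" shows "adjoint_mat U \<in> G \<sigma>"
proof -
  let ?D = "D_mat \<sigma>" and ?V = "adjoint_mat U"
  have U: "unitary U" "transpose U ** ?D ** U = ?D" using assms by (auto simp: G_def)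
  have UV: "U ** ?V = mat 1" by (rule unitary_right[OF U(1)])
  have VU: "transpose ?V ** transpose U = mat 1"
    by (simp only: matrix_transpose_mul[symmetric] UV transpose_mat)
  have "transpose ?V ** (transpose U ** ?D ** U) ** ?V = (transpose ?V ** transpose U) ** ?D ** (U ** ?V)"
    by (simp add: matrix_mul_assoc)
  then have "transpose ?V ** ?D ** ?V = ?D" unfolding U(2) UV VU by simp
  then show ?thesis using UV by (simp add: G_def unitary_def)
qed

lemma compact_unitary: "compact {U :: complex ^ 'n ^ 'n. unitary U}"
proof -
  have "norm U = norm (mat 1 :: complex ^ 'n ^ 'n)" if "unitary U" for U :: "complex ^ 'n ^ 'n"
    using norm_unitary_mult[OF that, of "mat 1"] by simp
  then have "bounded {U :: complex ^ 'n ^ 'n. unitary U}" unfolding bounded_iff by force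
  moreover have "closed {U :: complex ^ 'n ^ 'n. unitary U}"
    unfolding unitary_def
    by (intro closed_Collect_eq matrix_mult_continuous_on adjoint_mat_continuous_on continuous_on_id continuous_on_const)
  ultimately show ?thesis by (simp add: compact_eq_bounded_closed)
qed

lemma compact_G: "compact (G \<sigma>)"
proof -
  have cl: "closed {U. transpose U ** D_mat \<sigma> ** U = D_mat \<sigma>}"
    by (intro closed_Collect_eq matrix_mult_continuous_on bounded_linear.continuous_on[OF bounded_linear_transpose]
        continuous_on_id continuous_on_const)
  have "G \<sigma> = {U. unitary U} \<inter> {U. transpose U ** D_mat \<sigma> ** U = D_mat \<sigma>}"
    by (auto simp: G_def)
  then show ?thesis using compact_Int_closed[OF compact_unitary cl] by (simp only:)
qed

lemma subspace_lie: "subspace (lie \<sigma>)"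
proof -
  have "linear (\<lambda>\<xi>. adjoint_mat \<xi> + \<xi> :: complex ^ 2 ^ 2)"
    using has_derivative_linear[OF unitary_sesqui_derivative] .
  moreover have "linear (\<lambda>\<xi>. transpose \<xi> ** D_mat \<sigma> + D_mat \<sigma> ** \<xi>)"
    using has_derivative_linear[OF transpose_congruence_derivative] .
  ultimately show ?thesis
    unfolding lie_def Collect_conj_eq by (intro subspace_inter linear_subspace_kernel)
qed

text \<open>
  The expressions $U^*U$ and $U^tD_\sigma U$ are of the form \<open>B U\<close> with \<open>B (U ** W)
  = P W (B U)\<close> and \<open>P W\<close> linear. If the derivative of \<open>B\<close> at the
  identity kills \<open>\<xi>\<close>, then \<open>B\<close> is constant along the one-parameter group
  of \<open>\<xi>\<close>.
\<close>

lemma lie_exp: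
  assumes \<xi>: "\<xi> \<in> lie \<sigma>"
  shows "\<exists>\<gamma>. \<gamma> 0 = mat 1 \<and> (\<forall>s t. \<gamma> (s + t) = \<gamma> s ** \<gamma> t) \<and> range \<gamma> \<subseteq> G \<sigma> \<and>
     (\<gamma> has_vector_derivative \<xi>) (at 0)"
proof -
  obtain \<gamma> :: "real \<Rightarrow> complex ^ 2 ^ 2" where \<gamma>: "\<gamma> 0 = mat 1" "\<And>s t. \<gamma> (s + t) = \<gamma> s ** \<gamma> t"
     "(\<gamma> has_vector_derivative \<xi>) (at 0)"
    using one_parameter_group_2x2 by blast
  have const: "B (\<gamma> t) = B (mat 1)"
    if B: "(B has_derivative B') (at (mat 1))" "B' \<xi> = 0"
      and eqv: "\<And>U W. B (U ** W) = P W (B U)" and P: "\<And>W. bounded_linear (P W)"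
    for B B' and P :: "complex ^ 2 ^ 2 \<Rightarrow> complex ^ 2 ^ 2 \<Rightarrow> complex ^ 2 ^ 2" and t
  proof -
    have "((\<lambda>h. B (\<gamma> h)) has_derivative (\<lambda>h. B' (h *\<^sub>R \<xi>))) (at 0)"
      by (rule has_derivative_compose[OF \<gamma>(3)[unfolded has_vector_derivative_def]]) (simp add: B(1) \<gamma>(1))
    then have B0: "((\<lambda>h. B (\<gamma> h)) has_derivative (\<lambda>h. 0)) (at 0)"
      using linear_scale[OF has_derivative_linear[OF B(1)]] B(2) by simp
    have "B (\<gamma> (u + t)) = P (\<gamma> t) (B (\<gamma> u))" for t u by (simp only: \<gamma>(2) eqv)
    then have "B (\<gamma> t) = B (\<gamma> 0)" by (rule zero_velocity_imp_constant[OF B0 P])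
    then show ?thesis by (simp only: \<gamma>(1))
  qed
  have bl: "bounded_linear (\<lambda>X. A ** X ** W)" for A W :: "complex ^ 2 ^ 2"
    by (rule bounded_linear_compose[OF bounded_bilinear.bounded_linear_left[OF bounded_bilinear_matrix_mult]
        bounded_bilinear.bounded_linear_right[OF bounded_bilinear_matrix_mult]])
  have "adjoint_mat (\<gamma> t) ** \<gamma> t = mat 1" for t
  proof -
    have "adjoint_mat (\<gamma> t) ** \<gamma> t = adjoint_mat (mat 1) ** mat 1"
      by (rule const[where P = "\<lambda>W X. adjoint_mat W ** X ** W", OF unitary_sesqui_derivative _ _ bl])
         (use \<xi> in \<open>simp_all add: lie_def adjoint_mat_mult matrix_mul_assoc\<close>)
    then show ?thesis by simp
  qed
  moreover have "transpose (\<gamma> t) ** D_mat \<sigma> ** \<gamma> t = D_mat \<sigma>" for t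
  proof -
    have "transpose (\<gamma> t) ** D_mat \<sigma> ** \<gamma> t = transpose (mat 1) ** D_mat \<sigma> ** mat 1"
      by (rule const[where P = "\<lambda>W X. transpose W ** X ** W", OF transpose_congruence_derivative _ _ bl])
         (use \<xi> in \<open>simp_all add: lie_def matrix_transpose_mul matrix_mul_assoc\<close>)
    then show ?thesis by (simp add: transpose_mat)
  qed
  ultimately have "range \<gamma> \<subseteq> G \<sigma>" by (auto simp: G_def unitary_def)
  then show ?thesis using \<gamma> by blast
qed

text \<open>
  Both defining expressions of the group are constant along the sequence, so their derivatives vanish
  on the limit direction.
\<close>

lemma G_tangent:
  assumes g: "\<And>n. g n \<in> G \<sigma>" "\<And>n. g n \<noteq> mat 1" "g \<longlonglongrightarrow> mat 1"
    and \<tau>: "(\<lambda>n. (g n - mat 1) /\<^sub>R norm (g n - mat 1)) \<longlonglongrightarrow> \<tau>"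
  shows "\<tau> \<in> lie \<sigma>"
proof -
  have zero: "B' \<tau> = 0" if "(B has_derivative B') (at (mat 1))" "\<And>n. B (g n) = B (mat 1)"
    for B B' :: "complex ^ 2 ^ 2 \<Rightarrow> complex ^ 2 ^ 2"
    using has_derivative_sequential_quotient[OF that(1) g(3,2) \<tau>] that(2)
    by (simp add: LIMSEQ_const_iff)
  have "adjoint_mat \<tau> + \<tau> = 0"
    by (rule zero[OF unitary_sesqui_derivative]) (use g(1) in \<open>simp add: G_def unitary_def\<close>)
  moreover have "transpose \<tau> ** D_mat \<sigma> + D_mat \<sigma> ** \<tau> = 0"
    by (rule zero[OF transpose_congruence_derivative]) (use g(1) in \<open>simp add: G_def transpose_mat\<close>)
  ultimately show ?thesis by (simp add: lie_def)
qed

lemma act_isometric_matrix_action: "isometric_matrix_action (G \<sigma>) act act_deriv (lie \<sigma>)"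
proof (rule isometric_matrix_action.intro)
  show "norm (act U x) = norm x" if "U \<in> G \<sigma>" for U x
    using that norm_act by (simp add: G_def)
qed (auto intro: compact_G G_one G_mult act_mult act_one linear_act continuous_on_act act_has_derivative
    subspace_lie lie_exp G_tangent)

text \<open>
  The action with the parameter as a passive coordinate, for the strata in which $\sigma$ varies.
\<close>

definition pair_act :: "complex ^ 2 ^ 2 \<Rightarrow> param_gram \<Rightarrow> param_gram" where
  "pair_act U x = (fst x, act U (snd x))"

lemma pair_act_isometric_matrix_action:
  "isometric_matrix_action (G \<sigma>) pair_act (\<lambda>x \<xi>. (0, act_deriv (snd x) \<xi>)) (lie \<sigma>)"
proof (rule isometric_matrix_action.intro)
  show "norm (pair_act U x) = norm x" if "U \<in> G \<sigma>" for U x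
    using that norm_act by (simp add: G_def pair_act_def norm_prod_def)
  show "linear (pair_act U)" for U
    using linear_act[of U] by (simp add: linear_iff pair_act_def)
  show "continuous_on UNIV (\<lambda>(U, x). pair_act U x)"
    unfolding pair_act_def case_prod_unfold
    by (intro continuous_on_Pair continuous_intros
        continuous_on_compose2[OF continuous_on_act, of _ "\<lambda>x. (fst x, snd (snd x))", unfolded case_prod_unfold fst_conv snd_conv]) auto
  show "((\<lambda>U. pair_act U x) has_derivative (\<lambda>\<xi>. (0, act_deriv (snd x) \<xi>))) (at (mat 1))" for x
    unfolding pair_act_def by (intro has_derivative_Pair has_derivative_const act_has_derivative)
qed (auto intro: compact_G G_one G_mult subspace_lie lie_exp G_tangent simp: pair_act_def act_mult act_one)

lemma lie_iff:
  "\<xi> \<in> lie \<sigma> \<longleftrightarrow> cnj (\<xi> $ 1 $ 1) + \<xi> $ 1 $ 1 = 0 \<and> cnj (\<xi> $ 2 $ 2) + \<xi> $ 2 $ 2 = 0 \<and>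
     \<xi> $ 2 $ 1 = - cnj (\<xi> $ 1 $ 2) \<and> fst \<sigma> *\<^sub>R \<xi> $ 1 $ 1 = 0 \<and> snd \<sigma> *\<^sub>R \<xi> $ 2 $ 2 = 0 \<and>
     fst \<sigma> *\<^sub>R \<xi> $ 1 $ 2 = snd \<sigma> *\<^sub>R cnj (\<xi> $ 1 $ 2)"
proof -
  obtain a b c e where \<xi>: "\<xi> $ 1 $ 1 = a" "\<xi> $ 1 $ 2 = b" "\<xi> $ 2 $ 1 = c" "\<xi> $ 2 $ 2 = e" by blast
  have 1: "cnj c + b = 0 \<longleftrightarrow> c = - cnj b" "cnj b + c = 0 \<longleftrightarrow> c = - cnj b"
    by (auto simp: complex_eq_iff)
  have 2: "c * of_real (snd \<sigma>) + of_real (fst \<sigma>) * b = 0 \<longleftrightarrow> fst \<sigma> *\<^sub>R b = snd \<sigma> *\<^sub>R cnj b"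
    "b * of_real (fst \<sigma>) + of_real (snd \<sigma>) * c = 0 \<longleftrightarrow> fst \<sigma> *\<^sub>R b = snd \<sigma> *\<^sub>R cnj b"
    if "c = - cnj b"
    using that by (auto simp: complex_eq_iff mult.commute[of "Im b"] mult.commute[of "Re b"]; linarith)+
  show ?thesis
    unfolding lie_def mem_Collect_eq vec_eq_iff forall_2 matrix_matrix_mult_def transpose_def adjoint_mat_def
      vec_lambda_beta sum_2 D_mat_def vector_2 vector_add_component zero_index \<xi> 1
    using 2 by (auto simp: scaleR_conv_of_real)
qed

lemma lie_generic:
  assumes "\<sigma>1 > \<sigma>2" "\<sigma>2 > 0" shows "lie (\<sigma>1, \<sigma>2) = {0}"
proof -
  have "\<xi> = 0" if "\<xi> \<in> lie (\<sigma>1, \<sigma>2)" for \<xi>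
  proof -
    note \<xi> = that[unfolded lie_iff fst_conv snd_conv]
    have "norm (\<sigma>1 *\<^sub>R \<xi> $ 1 $ 2) = norm (\<sigma>2 *\<^sub>R cnj (\<xi> $ 1 $ 2))" using \<xi> by simp
    then have "\<xi> $ 1 $ 2 = 0" using assms by simp
    then show ?thesis using \<xi> assms by (simp add: vec_eq_iff forall_2)
  qed
  then show ?thesis using subspace_0[OF subspace_lie] by blast
qed

lemma dim_lie_generic: "\<sigma>1 > \<sigma>2 \<Longrightarrow> \<sigma>2 > 0 \<Longrightarrow> dim (lie (\<sigma>1, \<sigma>2)) = 0"
  by (simp add: lie_generic)

lemma dim_lie_eq_1:
  assumes "J \<in> lie \<sigma>" "J \<noteq> 0" "\<And>\<xi>. \<xi> \<in> lie \<sigma> \<Longrightarrow> \<exists>c. \<xi> = c *\<^sub>R J"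
  shows "dim (lie \<sigma>) = 1"
proof -
  have "lie \<sigma> = span {J}"
    using assms(1,3) subspace_scale[OF subspace_lie[of \<sigma>]] by (auto simp: span_singleton)
  then show ?thesis using assms(2) by (simp add: dim_singleton)
qed

lemma dim_lie_diagonal:
  assumes "\<sigma> > 0" shows "dim (lie (\<sigma>, \<sigma>)) = 1"
proof (rule dim_lie_eq_1)
  let ?J = "vector [vector [0, 1], vector [-1, 0]] :: complex ^ 2 ^ 2"
  show "?J \<in> lie (\<sigma>, \<sigma>)" "?J \<noteq> 0" by (simp_all add: lie_iff vec_eq_iff forall_2)
  fix \<xi> assume "\<xi> \<in> lie (\<sigma>, \<sigma>)"
  then have "\<xi> = Re (\<xi> $ 1 $ 2) *\<^sub>R ?J"
    using assms by (auto simp: lie_iff vec_eq_iff forall_2 complex_eq_iff)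
  then show "\<exists>c. \<xi> = c *\<^sub>R ?J" ..
qed

lemma dim_lie_axis:
  assumes "\<sigma> > 0" shows "dim (lie (\<sigma>, 0)) = 1"
proof (rule dim_lie_eq_1)
  let ?J = "vector [vector [0, 0], vector [0, \<i>]] :: complex ^ 2 ^ 2"
  show "?J \<in> lie (\<sigma>, 0)" "?J \<noteq> 0" by (simp_all add: lie_iff vec_eq_iff forall_2)
  fix \<xi> assume "\<xi> \<in> lie (\<sigma>, 0)"
  then have "\<xi> = Im (\<xi> $ 2 $ 2) *\<^sub>R ?J"
    using assms by (auto simp: lie_iff vec_eq_iff forall_2 complex_eq_iff)
  then show "\<exists>c. \<xi> = c *\<^sub>R ?J" ..
qed

lemma dim_lie_zero: "dim (lie (0, 0)) = 4"
proof -
  define f :: "real ^ 2 ^ 2 \<Rightarrow> complex ^ 2 ^ 2"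
    where "f S = (\<chi> i j. Complex (S $ i $ j - S $ j $ i) (S $ i $ j + S $ j $ i))" for S
  have lin: "linear f"
    by (auto simp: linear_iff f_def vec_eq_iff complex_eq_iff algebra_simps)
  have "inj f"
  proof (rule injI)
    fix S T assume "f S = f T"
    then have "S $ i $ j - S $ j $ i = T $ i $ j - T $ j $ i \<and> S $ i $ j + S $ j $ i = T $ i $ j + T $ j $ i" for i j
      by (simp add: f_def vec_eq_iff)
    then have "S $ i $ j = T $ i $ j" for i j
      by (smt (verit) field_sum_of_halves)
    then show "S = T" by (simp add: vec_eq_iff)
  qed
  have "lie (0, 0) = range f"
  proof
    show "lie (0, 0) \<subseteq> range f"
    proof
      fix \<xi> assume "\<xi> \<in> lie (0, 0)"
      then have "\<xi> = f (\<chi> i j. (Re (\<xi> $ i $ j) + Im (\<xi> $ i $ j)) / 2)"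
        by (auto simp: lie_iff f_def vec_eq_iff forall_2 complex_eq_iff field_simps)
      then show "\<xi> \<in> range f" by blast
    qed
    show "range f \<subseteq> lie (0, 0)"
      by (auto simp: lie_iff f_def complex_eq_iff)
  qed
  then have "dim (lie (0, 0)) = dim (UNIV :: (real ^ 2 ^ 2) set)"
    using dim_image_eq[OF lin, of UNIV] \<open>inj f\<close> by simp
  then show ?thesis by simp
qed

section \<open>The full-rank Gram matrices\<close>

definition quad :: "real \<times> real \<Rightarrow> complex ^ 2 \<Rightarrow> complex" where
  "quad \<sigma> z = of_real (fst \<sigma>) * (z $ 1)\<^sup>2 + of_real (snd \<sigma>) * (z $ 2)\<^sup>2"

text \<open>
  A $G_\sigma$-invariant origin of the affine space of Gram matrices over $\sigma$. Its form is
  $|g_\sigma|^2+(\|z\|^2-1)(g_\sigma+\bar g_\sigma-1)$, in which the terms without a factor $z_i\bar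
  z_j$ cancel.
\<close>

definition base_gram :: "real \<times> real \<Rightarrow> complex ^ 9 ^ 9" where
  "base_gram \<sigma> = (let s = of_real (fst \<sigma>); t = of_real (snd \<sigma>); r = of_real (1 / sqrt 3) in
    vector [
      vector [1, 0, 0, 0, 0, s, 0, r * t, 0],
      vector [0, 1, 0, 0, 0, 0, r * s, 0, t],
      vector [0, 0, s * s, 0, s * t, 0, 0, 0, 0],
      vector [0, 0, 0, 0, 0, 0, 0, 0, 0],
      vector [0, 0, s * t, 0, t * t, 0, 0, 0, 0],
      vector [s, 0, 0, 0, 0, 0, 0, 0, 0],
      vector [0, r * s, 0, 0, 0, 0, 0, 0, 0],
      vector [r * t, 0, 0, 0, 0, 0, 0, 0, 0],
      vector [0, t, 0, 0, 0, 0, 0, 0, 0]])"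

lemma cdot_matrix_rows: "cdot v (M *v w) = (\<Sum>i\<in>UNIV. cnj (v $ i) * (\<Sum>j\<in>UNIV. M $ i $ j * w $ j))"
  by (simp add: cdot_def matrix_vector_mult_def)

lemma base_gram_form:
  "cdot (V z) (base_gram \<sigma> *v V z) =
     cdot z z + cnj (quad \<sigma> z) * quad \<sigma> z + cdot z z * (quad \<sigma> z + cnj (quad \<sigma> z))"
proof -
  obtain q r where qr: "complex_of_real (1 / sqrt 3) = q" "complex_of_real (sqrt 3) = r" by blast
  have q: "q * r = 1" unfolding qr[symmetric] of_real_mult[symmetric] by simp
  have q': "q * (r * x) = x" for x by (simp add: q flip: mult.assoc)
  have c: "cnj q = q" "cnj r = r" by (simp_all flip: qr)
  show ?thesis
    unfolding cdot_matrix_rows sum_9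
    unfolding base_gram_def Let_def vector_9 qr V_nth quad_def cdot_def sum_2
      complex_cnj_mult complex_cnj_power complex_cnj_add complex_cnj_complex_of_real c
    by (simp add: power2_eq_square power3_eq_cube algebra_simps q q')
qed

lemma hermitian_base_gram: "hermitian (base_gram \<sigma>)"
  unfolding hermitian_nth forall_9 base_gram_def Let_def vector_9 by simp

lemma eval_g: "eval2 (g_poly \<sigma>) z = 1 + quad \<sigma> z"
  by (simp add: eval2_g_poly quad_def)

lemma cmod_one_plus_sq: "complex_of_real ((cmod (1 + q))\<^sup>2) = 1 + cnj q * q + (q + cnj q)"
proof -
  have "(complex_of_real (cmod (1 + q)))\<^sup>2 = (1 + q) * cnj (1 + q)"
    using complex_norm_square[of "1 + q"] by simp
  then show ?thesis by (simp add: algebra_simps)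
qed

text \<open>
  On the sphere the form of \<open>base_gram \<sigma>\<close> is $|g_\sigma|^2$.
\<close>

lemma represents_iff:
  assumes "hermitian H"
  shows "represents_on_sphere \<sigma> H \<longleftrightarrow> H - base_gram \<sigma> \<in> kernel_forms"
proof -
  have "hermitian (H - base_gram \<sigma>)"
    using subspace_diff[OF subspace_hermitian] assms hermitian_base_gram by blast
  moreover have "cdot (V z) (base_gram \<sigma> *v V z) = of_real ((cmod (eval2 (g_poly \<sigma>) z))\<^sup>2)"
    if "z \<in> sphere 0 1" for z
    using that unfolding base_gram_form eval_g cmod_one_plus_sq by (simp add: cdot_self)
  ultimately show ?thesis
    unfolding represents_on_sphere_def kernel_forms_def mem_Collect_eq cdot_matrix_linear by simp
qed

lemma S_fr_iff: "H \<in> S_fr \<sigma> \<longleftrightarrow> pos_def H \<and> H - base_gram \<sigma> \<in> kernel_forms"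
  using represents_iff[of H \<sigma>] by (auto simp: S_fr_def pos_def_def)

lemma quad_G:
  assumes "U \<in> G \<sigma>" shows "quad \<sigma> (U *v z) = quad \<sigma> z"
proof -
  obtain a b c e s t where *: "U $ 1 $ 1 = a" "U $ 1 $ 2 = b" "U $ 2 $ 1 = c" "U $ 2 $ 2 = e"
    "complex_of_real (fst \<sigma>) = s" "complex_of_real (snd \<sigma>) = t" by blast
  have "transpose U ** D_mat \<sigma> ** U = D_mat \<sigma>" using assms by (simp add: G_def)
  then have eq: "a * s * a + c * t * c = s" "a * s * b + c * t * e = 0" "b * s * b + e * t * e = t"
    unfolding vec_eq_iff forall_2 matrix_matrix_mult_def transpose_def vec_lambda_beta sum_2 D_mat_def vector_2 *
    by auto
  obtain x y where xy: "z $ 1 = x" "z $ 2 = y" by blast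
  have "s * (a * x + b * y)\<^sup>2 + t * (c * x + e * y)\<^sup>2 =
     (a * s * a + c * t * c) * x\<^sup>2 + 2 * (a * s * b + c * t * e) * (x * y) + (b * s * b + e * t * e) * y\<^sup>2"
    by (simp add: power2_eq_square algebra_simps)
  then show ?thesis
    unfolding quad_def matrix_vector_mult_def vec_lambda_beta sum_2 * xy eq by simp
qed

lemma hermitian_act: "hermitian H \<Longrightarrow> hermitian (act U H)"
  unfolding act_def by (rule hermitian_congruence)

text \<open>
  The form of \<open>base_gram \<sigma>\<close> depends only on $\|z\|$ and \<open>quad
  \<sigma>\<close>, which $G_\sigma$ preserves.
\<close>

lemma act_base_gram:
  assumes "U \<in> G \<sigma>" shows "act U (base_gram \<sigma>) = base_gram \<sigma>"
proof -
  have U: "unitary U" using assms by (simp add: G_def)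
  have "act U (base_gram \<sigma>) - base_gram \<sigma> = 0"
    by (rule form_eq_zero_imp_zero)
       (simp add: cdot_matrix_linear cdot_act base_gram_form quad_G[OF assms] unitary_cdot[OF U])
  then show ?thesis by simp
qed

lemma act_kernel_forms:
  assumes "unitary U" "K \<in> kernel_forms" shows "act U K \<in> kernel_forms"
  using assms hermitian_act by (auto simp: kernel_forms_def cdot_act unitary_norm)

lemma pos_def_act:
  assumes "unitary U" "pos_def H" shows "pos_def (act U H)"
  unfolding pos_def_def
proof (intro conjI allI impI)
  show "hermitian (act U H)" using assms(2) hermitian_act by (simp add: pos_def_def)
  fix v :: "complex ^ 9" assume "v \<noteq> 0"
  then have "rho U *v v \<noteq> 0" using unitary_norm[OF unitary_rho[OF assms(1)], of v] by auto
  then show "0 < Re (cdot v (act U H *v v))"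
    unfolding act_def cdot_congruence using assms(2) by (simp add: pos_def_def)
qed

lemma act_S_fr:
  assumes "U \<in> G \<sigma>" "H \<in> S_fr \<sigma>" shows "act U H \<in> S_fr \<sigma>"
proof -
  have U: "unitary U" using assms(1) by (simp add: G_def)
  have "act U H - base_gram \<sigma> = act U (H - base_gram \<sigma>)"
    by (simp add: linear_diff[OF linear_act] act_base_gram[OF assms(1)])
  then show ?thesis
    using assms(2) pos_def_act[OF U] act_kernel_forms[OF U] by (simp add: S_fr_iff)
qed

lemma continuous_base_gram: "continuous_on UNIV base_gram"
proof -
  have "\<forall>i j. continuous_on UNIV (\<lambda>\<sigma>. base_gram \<sigma> $ i $ j)"
    unfolding forall_9 base_gram_def Let_def vector_9 by (intro conjI continuous_intros)
  then have "continuous_on UNIV (\<lambda>\<sigma>. \<chi> i j. base_gram \<sigma> $ i $ j)"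
    by (intro continuous_on_vec_lambda) blast
  then show ?thesis by simp
qed

text \<open>
  Put $q=g_\sigma+\bar g_\sigma-1+\alpha+\beta$ in $|g_\sigma|^2+(\|z\|^2-1)q$ with
  $\alpha=a|z_1|^2+b|z_2|^2$ and a form $\beta$ of bidegree $(2,2)$. The part of bidegree $(2,2)$ is
  then $|g_\sigma-1|^2+\|z\|^2\alpha-\beta$. The choice of $\beta$ makes this equal to
  $\epsilon\|z\|^4$, that is, as small as positivity allows, which leaves the most room for the
  coupling between degrees one and three.
\<close>

definition explicit_gram :: "real \<times> real \<Rightarrow> real \<Rightarrow> real \<Rightarrow> real \<Rightarrow> complex ^ 9 ^ 9" where
  "explicit_gram \<sigma> a b \<epsilon> = (let s = of_real (fst \<sigma>); t = of_real (snd \<sigma>); r = of_real (1 / sqrt 3);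
       A = of_real a; B = of_real b; d = of_real \<epsilon> in
    vector [
      vector [1 - A, 0, 0, 0, 0, s, 0, r * t, 0],
      vector [0, 1 - B, 0, 0, 0, 0, r * s, 0, t],
      vector [0, 0, d, 0, 0, 0, 0, 0, 0],
      vector [0, 0, 0, d, 0, 0, 0, 0, 0],
      vector [0, 0, 0, 0, d, 0, 0, 0, 0],
      vector [s, 0, 0, 0, 0, s * s + A - d, 0, r * s * t, 0],
      vector [0, r * s, 0, 0, 0, 0, (s * s + 2 * A + B) / 3 - d, 0, r * s * t],
      vector [r * t, 0, 0, 0, 0, r * s * t, 0, (t * t + A + 2 * B) / 3 - d, 0],
      vector [0, t, 0, 0, 0, 0, r * s * t, 0, t * t + B - d]])"

lemma explicit_gram_form:
  fixes z :: "complex ^ 2" and a b \<epsilon> :: real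
  defines "N \<equiv> cdot z z"
    and "A \<equiv> of_real a * (cnj (z $ 1) * z $ 1) + of_real b * (cnj (z $ 2) * z $ 2)"
  shows "cdot (V z) (explicit_gram \<sigma> a b \<epsilon> *v V z) =
     N - A + of_real \<epsilon> * (N * N) + N * (quad \<sigma> z + cnj (quad \<sigma> z)) + N * (cnj (quad \<sigma> z) * quad \<sigma> z) + N * N * A - of_real \<epsilon> * (N * N * N)"
proof -
  obtain q r p where qr: "complex_of_real (1 / sqrt 3) = q" "complex_of_real (sqrt 3) = r"
     "complex_of_real (sqrt 2) = p" by blast
  have q: "q * r = 1" unfolding qr[symmetric] of_real_mult[symmetric] by simp
  have q': "q * (r * x) = x" for x by (simp add: q flip: mult.assoc)
  have r: "r * r = 3" "p * p = 2" using sqrt_2_3_squares by (simp_all flip: qr)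
  have r': "r * (r * x) = 3 * x" "p * (p * x) = 2 * x" for x by (simp_all add: r flip: mult.assoc)
  have c: "cnj q = q" "cnj r = r" "cnj p = p" by (simp_all flip: qr)
  show ?thesis
    unfolding cdot_matrix_rows sum_9
    unfolding explicit_gram_def Let_def vector_9 qr V_nth quad_def N_def A_def cdot_def sum_2
      complex_cnj_mult complex_cnj_power complex_cnj_add complex_cnj_complex_of_real c
    by (simp add: power2_eq_square power3_eq_cube algebra_simps add_divide_distrib q q' r r')
qed

lemma hermitian_explicit_gram: "hermitian (explicit_gram \<sigma> a b \<epsilon>)"
  unfolding hermitian_nth forall_9 explicit_gram_def Let_def vector_9 by simp

lemma explicit_gram_represents: "represents_on_sphere \<sigma> (explicit_gram \<sigma> a b \<epsilon>)"
  unfolding represents_on_sphere_def explicit_gram_form eval_g cmod_one_plus_sq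
  by (simp add: cdot_self)

lemma explicit_gram_quadratic:
  fixes v :: "complex ^ 9" and \<sigma> :: "real \<times> real"
  defines "w1 \<equiv> fst \<sigma> *\<^sub>R v $ 6 + (snd \<sigma> / sqrt 3) *\<^sub>R v $ 8"
    and "w2 \<equiv> (fst \<sigma> / sqrt 3) *\<^sub>R v $ 7 + snd \<sigma> *\<^sub>R v $ 9"
  shows "Re (cdot v (explicit_gram \<sigma> a b \<epsilon> *v v)) =
     ((1 - a) * (cmod (v $ 1))\<^sup>2 + 2 * Re (cnj (v $ 1) * w1) + (cmod w1)\<^sup>2) +
     ((1 - b) * (cmod (v $ 2))\<^sup>2 + 2 * Re (cnj (v $ 2) * w2) + (cmod w2)\<^sup>2) +
     \<epsilon> * ((cmod (v $ 3))\<^sup>2 + (cmod (v $ 4))\<^sup>2 + (cmod (v $ 5))\<^sup>2) +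
     (a * (cmod (v $ 6))\<^sup>2 + (a + 2 * b) / 3 * (cmod (v $ 8))\<^sup>2) +
     (b * (cmod (v $ 9))\<^sup>2 + (2 * a + b) / 3 * (cmod (v $ 7))\<^sup>2) -
     \<epsilon> * ((cmod (v $ 6))\<^sup>2 + (cmod (v $ 7))\<^sup>2 + (cmod (v $ 8))\<^sup>2 + (cmod (v $ 9))\<^sup>2)"
proof -
  obtain q where q0: "1 / sqrt 3 = q" by blast
  have d: "x / sqrt 3 = q * x" for x by (simp flip: q0)
  have qq: "q * q = 1 / 3" by (simp flip: q0)
  have qq': "q * (q * x) = x / 3" for x by (simp add: qq flip: mult.assoc)
  show ?thesis
    unfolding cdot_matrix_rows sum_9
    unfolding explicit_gram_def Let_def vector_9 q0 w1_def w2_def d cmod_power2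
    by (simp add: power2_eq_square algebra_simps add_divide_distrib qq qq')
qed

lemma coupled_square_bound:
  fixes x w :: complex
  assumes "0 < a" "a < 1"
  shows "(1 - a) * (cmod x)\<^sup>2 + 2 * Re (cnj x * w) + (cmod w)\<^sup>2 \<ge> - (a / (1 - a)) * (cmod w)\<^sup>2"
proof -
  have "0 \<le> (cmod ((1 - a) *\<^sub>R x + w))\<^sup>2" by simp
  also have "\<dots> = (1 - a) * ((1 - a) * (cmod x)\<^sup>2 + 2 * Re (cnj x * w) + (cmod w)\<^sup>2) + a * (cmod w)\<^sup>2"
    unfolding cmod_power2 by (simp add: power2_eq_square algebra_simps)
  finally show ?thesis using assms by (simp add: field_simps)
qed

lemma weighted_Cauchy_Schwarz:
  fixes x y :: complex
  assumes "c > 0" "d > 0"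
  shows "(cmod (s *\<^sub>R x + t *\<^sub>R y))\<^sup>2 \<le> (s\<^sup>2 / c + t\<^sup>2 / d) * (c * (cmod x)\<^sup>2 + d * (cmod y)\<^sup>2)"
proof -
  have "(cmod (s *\<^sub>R x + t *\<^sub>R y))\<^sup>2 \<le> (\<bar>s\<bar> * cmod x + \<bar>t\<bar> * cmod y)\<^sup>2"
    using norm_triangle_ineq[of "s *\<^sub>R x" "t *\<^sub>R y"] by (intro power_mono) auto
  also have "\<dots> \<le> (s\<^sup>2 / c + t\<^sup>2 / d) * (c * (cmod x)\<^sup>2 + d * (cmod y)\<^sup>2)"
  proof -
    have "(s\<^sup>2 / c + t\<^sup>2 / d) * (c * (cmod x)\<^sup>2 + d * (cmod y)\<^sup>2) - (\<bar>s\<bar> * cmod x + \<bar>t\<bar> * cmod y)\<^sup>2 =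
       (\<bar>s\<bar> * d * cmod y - \<bar>t\<bar> * c * cmod x)\<^sup>2 / (c * d)"
      using assms by (simp add: field_simps power2_eq_square)
    also have "\<dots> \<ge> 0" using assms by simp
    finally show ?thesis by simp
  qed
  finally show ?thesis .
qed

text \<open>
  What eliminating \<open>x\<close> costs, in terms of the weighted norm of the two entries to which
  it is coupled.
\<close>

lemma coupled_form_lower_bound:
  fixes x y z :: complex
  assumes a: "0 < a" "a < 1" and cd: "c > 0" "d > 0" and k: "a / (1 - a) * (s\<^sup>2 / c + t\<^sup>2 / d) \<le> k"
  shows "(1 - a) * (cmod x)\<^sup>2 + 2 * Re (cnj x * (s *\<^sub>R y + t *\<^sub>R z)) + (cmod (s *\<^sub>R y + t *\<^sub>R z))\<^sup>2
     \<ge> - (k * (c * (cmod y)\<^sup>2 + d * (cmod z)\<^sup>2))"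
proof -
  let ?n = "c * (cmod y)\<^sup>2 + d * (cmod z)\<^sup>2"
  have "a / (1 - a) * (cmod (s *\<^sub>R y + t *\<^sub>R z))\<^sup>2 \<le> a / (1 - a) * ((s\<^sup>2 / c + t\<^sup>2 / d) * ?n)"
    using a weighted_Cauchy_Schwarz[OF cd] by (intro mult_left_mono) auto
  also have "\<dots> \<le> k * ?n"
    unfolding mult.assoc[symmetric] by (rule mult_right_mono[OF k]) (use cd in simp)
  finally show ?thesis
    using coupled_square_bound[OF a, where x = x and w = "s *\<^sub>R y + t *\<^sub>R z", unfolded mult_minus_left]
    by linarith
qed

text \<open>
  The left-hand sides in \<open>ka\<close> and \<open>kb\<close> measure how much of the degree-three
  part is used up when the coupling to $v_1$ and $v_2$ is eliminated by completing squares.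
\<close>

lemma explicit_gram_pos_def:
  assumes a: "0 < a" "a < 1" and b: "0 < b" "b < 1"
    and ka: "a / (1 - a) * ((fst \<sigma>)\<^sup>2 / a + (snd \<sigma>)\<^sup>2 / (a + 2 * b)) < 1"
    and kb: "b / (1 - b) * ((fst \<sigma>)\<^sup>2 / (2 * a + b) + (snd \<sigma>)\<^sup>2 / b) < 1"
  shows "\<exists>\<epsilon>. pos_def (explicit_gram \<sigma> a b \<epsilon>)"
proof -
  define k where "k = max (a / (1 - a) * ((fst \<sigma>)\<^sup>2 / a + (snd \<sigma>)\<^sup>2 / (a + 2 * b)))
     (b / (1 - b) * ((fst \<sigma>)\<^sup>2 / (2 * a + b) + (snd \<sigma>)\<^sup>2 / b))"
  define m where "m = min a b"
  \<comment> \<open>The slack in degree three is at least $(1-k)m$ times the squared norm; half of it is kept for definiteness.\<close>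
  define \<epsilon> where "\<epsilon> = (1 - k) * m / 2"
  have k: "k < 1" using ka kb by (simp add: k_def)
  have m: "m > 0" using a b by (simp add: m_def)
  have \<epsilon>: "\<epsilon> > 0" using k m by (simp add: \<epsilon>_def)
  have "0 < Re (cdot v (explicit_gram \<sigma> a b \<epsilon> *v v))" if v: "v \<noteq> 0" for v
  proof -
    define w1 where "w1 = fst \<sigma> *\<^sub>R v $ 6 + (snd \<sigma> / sqrt 3) *\<^sub>R v $ 8"
    define w2 where "w2 = (fst \<sigma> / sqrt 3) *\<^sub>R v $ 7 + snd \<sigma> *\<^sub>R v $ 9"
    define n1 where "n1 = a * (cmod (v $ 6))\<^sup>2 + (a + 2 * b) / 3 * (cmod (v $ 8))\<^sup>2"
    define n2 where "n2 = (2 * a + b) / 3 * (cmod (v $ 7))\<^sup>2 + b * (cmod (v $ 9))\<^sup>2"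
    define low where "low = (cmod (v $ 3))\<^sup>2 + (cmod (v $ 4))\<^sup>2 + (cmod (v $ 5))\<^sup>2"
    define top where "top = (cmod (v $ 6))\<^sup>2 + (cmod (v $ 7))\<^sup>2 + (cmod (v $ 8))\<^sup>2 + (cmod (v $ 9))\<^sup>2"
    have form: "Re (cdot v (explicit_gram \<sigma> a b \<epsilon> *v v)) =
       ((1 - a) * (cmod (v $ 1))\<^sup>2 + 2 * Re (cnj (v $ 1) * w1) + (cmod w1)\<^sup>2) +
       ((1 - b) * (cmod (v $ 2))\<^sup>2 + 2 * Re (cnj (v $ 2) * w2) + (cmod w2)\<^sup>2) +
       \<epsilon> * low + n1 + n2 - \<epsilon> * top"
      unfolding explicit_gram_quadratic w1_def w2_def n1_def n2_def low_def top_def by simp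
    have n: "m * top \<le> n1 + n2"
    proof -
      have "m * (cmod (v $ 6))\<^sup>2 \<le> a * (cmod (v $ 6))\<^sup>2" "m * (cmod (v $ 8))\<^sup>2 \<le> (a + 2 * b) / 3 * (cmod (v $ 8))\<^sup>2"
        "m * (cmod (v $ 7))\<^sup>2 \<le> (2 * a + b) / 3 * (cmod (v $ 7))\<^sup>2" "m * (cmod (v $ 9))\<^sup>2 \<le> b * (cmod (v $ 9))\<^sup>2"
        by (intro mult_right_mono; simp add: m_def)+
      then show ?thesis unfolding n1_def n2_def top_def distrib_left by linarith
    qed
    have third: "(x / sqrt 3)\<^sup>2 / (y / 3) = x\<^sup>2 / y" for x y :: real by (simp add: power_divide)
    have w1: "(1 - a) * (cmod (v $ 1))\<^sup>2 + 2 * Re (cnj (v $ 1) * w1) + (cmod w1)\<^sup>2 \<ge> - (k * n1)"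
    proof -
      have "a / (1 - a) * ((fst \<sigma>)\<^sup>2 / a + (snd \<sigma> / sqrt 3)\<^sup>2 / ((a + 2 * b) / 3)) \<le> k"
        unfolding third k_def by (rule max.cobounded1)
      from coupled_form_lower_bound[OF a _ _ this] show ?thesis unfolding w1_def n1_def using a b by simp
    qed
    have w2: "(1 - b) * (cmod (v $ 2))\<^sup>2 + 2 * Re (cnj (v $ 2) * w2) + (cmod w2)\<^sup>2 \<ge> - (k * n2)"
    proof -
      have "b / (1 - b) * ((fst \<sigma> / sqrt 3)\<^sup>2 / ((2 * a + b) / 3) + (snd \<sigma>)\<^sup>2 / b) \<le> k"
        unfolding third k_def by (rule max.cobounded2)
      from coupled_form_lower_bound[OF b _ _ this] show ?thesis unfolding w2_def n2_def using a b by simp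
    qed
    have top: "(1 - k) * (n1 + n2) - \<epsilon> * top \<ge> \<epsilon> * top"
    proof -
      have "(1 - k) * (m * top) \<le> (1 - k) * (n1 + n2)" using n k by (intro mult_left_mono) auto
      moreover have "(1 - k) * (m * top) = \<epsilon> * top + \<epsilon> * top" by (simp add: \<epsilon>_def field_simps)
      ultimately show ?thesis by linarith
    qed
    have lower: "Re (cdot v (explicit_gram \<sigma> a b \<epsilon> *v v)) \<ge> \<epsilon> * (low + top)"
    proof -
      have "(1 - k) * (n1 + n2) = n1 + n2 - k * n1 - k * n2" by (simp add: algebra_simps)
      moreover have "\<epsilon> * (low + top) = \<epsilon> * low + \<epsilon> * top" by (rule distrib_left)
      ultimately show ?thesis
        using w1 w2 top unfolding form by linarith
    qed
    show ?thesis
    proof (cases "low + top = 0")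
      case False
      have "low + top \<ge> 0" by (simp add: low_def top_def)
      then have "\<epsilon> * (low + top) > 0" using False \<epsilon> by simp
      then show ?thesis using lower by linarith
    next
      case True
      then have zero: "v $ 3 = 0" "v $ 4 = 0" "v $ 5 = 0" "v $ 6 = 0" "v $ 7 = 0" "v $ 8 = 0" "v $ 9 = 0"
        unfolding low_def top_def by (smt (verit) zero_le_power2 zero_eq_power2 norm_eq_zero)+
      then have "v $ 1 \<noteq> 0 \<or> v $ 2 \<noteq> 0" using v by (auto simp: vec_eq_iff forall_9)
      then have "(1 - a) * (cmod (v $ 1))\<^sup>2 + (1 - b) * (cmod (v $ 2))\<^sup>2 > 0"
        using a b by (auto intro: add_pos_nonneg add_nonneg_pos)
      then show ?thesis
        unfolding form using zero by (simp add: w1_def w2_def n1_def n2_def low_def top_def)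
    qed
  qed
  then have "pos_def (explicit_gram \<sigma> a b \<epsilon>)" by (simp add: pos_def_def hermitian_explicit_gram)
  then show ?thesis by blast
qed

text \<open>
  With $x=\sqrt{1-\sigma_1^2}$ and $y=\sqrt{1-\sigma_2^2}$ the two conditions of
  \<open>explicit_gram_pos_def\<close> become, for small $a$ and $b$ in the ratio $x:y$, the single
  inequality $(x+y)^2>1$, which is the condition that defines $\Sigma$.
\<close>

lemma S_fr_nonempty:
  assumes "\<sigma> \<in> Sigma_set" shows "S_fr \<sigma> \<noteq> {}"
proof -
  obtain s1 s2 where \<sigma>: "\<sigma> = (s1, s2)" "0 \<le> s2" "s2 \<le> s1" "s1 < 1"
     "sqrt (1 - s1\<^sup>2) + sqrt (1 - s2\<^sup>2) > 1"
    using assms by (auto simp: Sigma_set_def)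
  define x y where "x = sqrt (1 - s1\<^sup>2)" and "y = sqrt (1 - s2\<^sup>2)"
  have "s1\<^sup>2 < 1" "s2\<^sup>2 < 1" using \<sigma> by (auto simp: abs_square_less_1)
  then have xy: "x > 0" "y > 0" "s1\<^sup>2 = 1 - x\<^sup>2" "s2\<^sup>2 = 1 - y\<^sup>2" "x + y > 1"
    using \<sigma>(5) by (auto simp: x_def y_def)
  have "1 * 1 < (x + y) * (x + y)" using xy by (intro mult_strict_mono) auto
  then have sq: "1 < x * x + 2 * (x * y) + y * y" by (simp add: algebra_simps)
  define k1 where "k1 = s1\<^sup>2 + s2\<^sup>2 * (x / (x + 2 * y))"
  define k2 where "k2 = s2\<^sup>2 + s1\<^sup>2 * (y / (2 * x + y))"
  have k1: "k1 < 1"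
  proof -
    have "(1 - y\<^sup>2) * x < x\<^sup>2 * (x + 2 * y)"
      using mult_strict_left_mono[OF sq xy(1)] by (simp add: power2_eq_square algebra_simps)
    then show ?thesis unfolding k1_def xy using xy(1,2) by (simp add: field_simps)
  qed
  have k2: "k2 < 1"
  proof -
    have "(1 - x\<^sup>2) * y < y\<^sup>2 * (2 * x + y)"
      using mult_strict_left_mono[OF sq xy(2)] by (simp add: power2_eq_square algebra_simps)
    then show ?thesis unfolding k2_def xy using xy(1,2) by (simp add: field_simps)
  qed
  define \<eta> where "\<eta> = min ((1 - k1) / x) ((1 - k2) / y) / 2"
  have "(1 - k1) / x > 0" "(1 - k2) / y > 0" using k1 k2 xy(1,2) by auto
  moreover have "0 < min p q / 2 \<and> min p q / 2 < p \<and> min p q / 2 < q" if "0 < p" "0 < q" for p q :: real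
    using that by (auto simp: min_def)
  ultimately have \<eta>: "\<eta> > 0" "\<eta> < (1 - k1) / x" "\<eta> < (1 - k2) / y" unfolding \<eta>_def by blast+
  \<comment> \<open>The ratio $x:y$ serves both conditions at once; see \<open>sq\<close>.\<close>
  define a b where "a = \<eta> * x" and "b = \<eta> * y"
  have ab: "a > 0" "b > 0" "a < 1 - k1" "b < 1 - k2"
    using \<eta> xy by (auto simp: a_def b_def field_simps)
  have k0: "k1 \<ge> 0" "k2 \<ge> 0" using xy(1,2) by (auto simp: k1_def k2_def)
  have ab1: "a < 1" "b < 1" using ab k0 by auto
  have frac: "c / (1 - c) * X < 1" if "c * X = k" "c < 1 - k" "c < 1" for c X k :: real
  proof -
    have "c / (1 - c) * X = k / (1 - c)" using that(1) by auto
    then show ?thesis using that(2,3) by simp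
  qed
  have "a * (s1\<^sup>2 / a + s2\<^sup>2 / (a + 2 * b)) = k1"
  proof -
    have "a / (a + 2 * b) = x / (x + 2 * y)"
      using \<eta>(1) by (simp add: a_def b_def flip: distrib_left mult.left_commute[of \<eta>])
    moreover have "a * (s1\<^sup>2 / a + s2\<^sup>2 / (a + 2 * b)) = s1\<^sup>2 + s2\<^sup>2 * (a / (a + 2 * b))"
      using ab(1) by (simp add: distrib_left)
    ultimately show ?thesis by (simp only: k1_def)
  qed
  then have 1: "a / (1 - a) * (s1\<^sup>2 / a + s2\<^sup>2 / (a + 2 * b)) < 1"
    by (rule frac[OF _ ab(3) ab1(1)])
  have "b * (s1\<^sup>2 / (2 * a + b) + s2\<^sup>2 / b) = k2"
  proof -
    have "b / (2 * a + b) = y / (2 * x + y)"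
      using \<eta>(1) by (simp add: a_def b_def flip: distrib_left mult.left_commute[of \<eta>])
    moreover have "b * (s1\<^sup>2 / (2 * a + b) + s2\<^sup>2 / b) = s2\<^sup>2 + s1\<^sup>2 * (b / (2 * a + b))"
      using ab(2) by (simp add: distrib_left)
    ultimately show ?thesis by (simp only: k2_def)
  qed
  then have 2: "b / (1 - b) * (s1\<^sup>2 / (2 * a + b) + s2\<^sup>2 / b) < 1"
    by (rule frac[OF _ ab(4) ab1(2)])
  obtain \<epsilon> where "pos_def (explicit_gram \<sigma> a b \<epsilon>)"
    using explicit_gram_pos_def[of a b \<sigma>] ab ab1 1 2 \<sigma>(1) by auto
  then have "explicit_gram \<sigma> a b \<epsilon> \<in> S_fr \<sigma>" using explicit_gram_represents by (simp add: S_fr_def)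
  then show ?thesis by blast
qed

section \<open>A polynomial condition for trivial isotropy\<close>

text \<open>
  Up to a scalar, the coefficients of the linear form obtained by applying the $U(2)$-invariant
  operator $\sum_k\partial_{z_k}\partial_{\bar z_k}$ to the part of bidegree $(2,1)$ of $\mathbf
  V^*H\mathbf V$.
\<close>

definition covector :: "complex ^ 9 ^ 9 \<Rightarrow> complex ^ 2" where
  "covector H = vector [of_real (sqrt 2) * H $ 1 $ 3 + H $ 2 $ 4, H $ 1 $ 4 + of_real (sqrt 2) * H $ 2 $ 5]"

definition covector_image :: "complex ^ 9 ^ 9 \<Rightarrow> complex ^ 2" where
  "covector_image H = (\<chi> j. if j = 1
     then covector H $ 1 * H $ 1 $ 1 + covector H $ 2 * H $ 2 $ 1
     else covector H $ 1 * H $ 1 $ 2 + covector H $ 2 * H $ 2 $ 2)"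

definition covector_det :: "complex ^ 9 ^ 9 \<Rightarrow> complex" where
  "covector_det H = covector H $ 1 * covector_image H $ 2 - covector H $ 2 * covector_image H $ 1"

text \<open>
  If $\rho(U)$ commutes with $H$, then $U$ commutes with the block in degree $(1,1)$ and intertwines
  the block in degree $(1,2)$ with the symmetric square of $U$. Contracting the latter relation gives
  the invariance of the covector; the former then gives that of its image.
\<close>

lemma covector_fixed:
  assumes U: "unitary U" and stable: "act U H = H"
  shows "covector H v* U = covector H" "covector_image H v* U = covector_image H"
proof -
  obtain a b c e where abce: "U $ 1 $ 1 = a" "U $ 1 $ 2 = b" "U $ 2 $ 1 = c" "U $ 2 $ 2 = e" by blast
  obtain s where s: "complex_of_real (sqrt 2) = s" by blast
  have ss: "s * s = 2" using sqrt_2_3_squares(1) s by simp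
  have ss': "s * (s * x) = 2 * x" for x by (simp add: ss flip: mult.assoc)
  have orth: "a * cnj a + b * cnj b = 1" "a * cnj c + b * cnj e = 0"
     "c * cnj a + e * cnj b = 0" "c * cnj c + e * cnj e = 1"
    using unitary_right[OF U]
    unfolding vec_eq_iff forall_2 matrix_matrix_mult_def adjoint_mat_def vec_lambda_beta sum_2 abce mat_def
    by simp_all
  have R: "rho U ** adjoint_mat (rho U) = mat 1" by (rule unitary_right[OF unitary_rho[OF U]])
  have "rho U ** act U H = (rho U ** adjoint_mat (rho U)) ** H ** rho U"
    by (simp add: act_def matrix_mul_assoc)
  then have comm: "rho U ** H = H ** rho U" by (simp add: R stable)
  have "(rho U ** H) $ i $ j = (H ** rho U) $ i $ j" for i j by (simp only: comm)
  note entry = this[unfolded matrix_matrix_mult_def vec_lambda_beta sum_9 rho_eq]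
  note ev = rho_matrix_def Let_def vector_9 abce s mult_zero_left mult_zero_right add_0_left add_0_right
  have A: "a * H $ 1 $ 1 + b * H $ 2 $ 1 = H $ 1 $ 1 * a + H $ 1 $ 2 * c"
    "a * H $ 1 $ 2 + b * H $ 2 $ 2 = H $ 1 $ 1 * b + H $ 1 $ 2 * e"
    "c * H $ 1 $ 1 + e * H $ 2 $ 1 = H $ 2 $ 1 * a + H $ 2 $ 2 * c"
    "c * H $ 1 $ 2 + e * H $ 2 $ 2 = H $ 2 $ 1 * b + H $ 2 $ 2 * e"
    using entry[of 1 1] entry[of 1 2] entry[of 2 1] entry[of 2 2] unfolding ev by blast+
  have B: "a * H $ 1 $ 3 + b * H $ 2 $ 3 = H $ 1 $ 3 * (a * a) + H $ 1 $ 4 * (s * a * c) + H $ 1 $ 5 * (c * c)"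
    "a * H $ 1 $ 4 + b * H $ 2 $ 4 = H $ 1 $ 3 * (s * a * b) + H $ 1 $ 4 * (a * e + b * c) + H $ 1 $ 5 * (s * c * e)"
    "a * H $ 1 $ 5 + b * H $ 2 $ 5 = H $ 1 $ 3 * (b * b) + H $ 1 $ 4 * (s * b * e) + H $ 1 $ 5 * (e * e)"
    "c * H $ 1 $ 3 + e * H $ 2 $ 3 = H $ 2 $ 3 * (a * a) + H $ 2 $ 4 * (s * a * c) + H $ 2 $ 5 * (c * c)"
    "c * H $ 1 $ 4 + e * H $ 2 $ 4 = H $ 2 $ 3 * (s * a * b) + H $ 2 $ 4 * (a * e + b * c) + H $ 2 $ 5 * (s * c * e)"
    "c * H $ 1 $ 5 + e * H $ 2 $ 5 = H $ 2 $ 3 * (b * b) + H $ 2 $ 4 * (s * b * e) + H $ 2 $ 5 * (e * e)"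
    using entry[of 1 3] entry[of 1 4] entry[of 1 5] entry[of 2 3] entry[of 2 4] entry[of 2 5]
    unfolding ev by (simp_all only: add_0_left add_0_right)
  have col: "cnj a * a + cnj c * c = 1" "cnj a * b + cnj c * e = 0"
     "cnj b * a + cnj e * c = 0" "cnj b * b + cnj e * e = 1"
    using U unfolding unitary_def vec_eq_iff forall_2 matrix_matrix_mult_def adjoint_mat_def vec_lambda_beta sum_2 abce mat_def
    by simp_all
  define X where "X i j = U $ i $ 1 * H $ 1 $ j + U $ i $ 2 * H $ 2 $ j" for i :: 2 and j :: 9
  have inv: "H $ 1 $ j = cnj a * X 1 j + cnj c * X 2 j" "H $ 2 $ j = cnj b * X 1 j + cnj e * X 2 j" for j
  proof -
    have "cnj a * X 1 j + cnj c * X 2 j = (cnj a * a + cnj c * c) * H $ 1 $ j + (cnj a * b + cnj c * e) * H $ 2 $ j"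
      by (simp add: X_def abce algebra_simps)
    then show "H $ 1 $ j = cnj a * X 1 j + cnj c * X 2 j" by (simp add: col)
    have "cnj b * X 1 j + cnj e * X 2 j = (cnj b * a + cnj e * c) * H $ 1 $ j + (cnj b * b + cnj e * e) * H $ 2 $ j"
      by (simp add: X_def abce algebra_simps)
    then show "H $ 2 $ j = cnj b * X 1 j + cnj e * X 2 j" by (simp add: col)
  qed
  note X = X_def[of 1] X_def[of 2]
  obtain h13 h14 h15 h23 h24 h25 where h: "H $ 1 $ 3 = h13" "H $ 1 $ 4 = h14" "H $ 1 $ 5 = h15"
    "H $ 2 $ 3 = h23" "H $ 2 $ 4 = h24" "H $ 2 $ 5 = h25" by blast
  have XB: "X 1 3 = h13 * (a * a) + h14 * (s * a * c) + h15 * (c * c)"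
    "X 1 4 = h13 * (s * a * b) + h14 * (a * e + b * c) + h15 * (s * c * e)"
    "X 1 5 = h13 * (b * b) + h14 * (s * b * e) + h15 * (e * e)"
    "X 2 3 = h23 * (a * a) + h24 * (s * a * c) + h25 * (c * c)"
    "X 2 4 = h23 * (s * a * b) + h24 * (a * e + b * c) + h25 * (s * c * e)"
    "X 2 5 = h23 * (b * b) + h24 * (s * b * e) + h25 * (e * e)"
    using B unfolding X abce h by blast+
  define l1 l2 where "l1 = s * h13 + h24" and "l2 = h14 + s * h25"
  have l: "covector H $ 1 = l1" "covector H $ 2 = l2"
    by (simp_all add: covector_def s h l1_def l2_def)
  have e1: "l1 = l1 * a + l2 * c"
  proof -
    have "l1 = s * (cnj a * X 1 3 + cnj c * X 2 3) + (cnj b * X 1 4 + cnj e * X 2 4)"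
      unfolding l1_def using inv(1)[of 3] inv(2)[of 4] h by metis
    also have "\<dots> = s * h13 * (a * (a * cnj a + b * cnj b))
        + h14 * (c * (a * cnj a + b * cnj b) + a * (c * cnj a + e * cnj b))
        + s * h15 * (c * (c * cnj a + e * cnj b))
        + s * h23 * (a * (a * cnj c + b * cnj e))
        + h24 * (a * (c * cnj c + e * cnj e) + c * (a * cnj c + b * cnj e))
        + s * h25 * (c * (c * cnj c + e * cnj e))"
      unfolding XB by (simp add: algebra_simps ss ss')
    also have "\<dots> = l1 * a + l2 * c" unfolding orth l1_def l2_def by (simp add: algebra_simps)
    finally show ?thesis .
  qed
  have e2: "l2 = l1 * b + l2 * e"
  proof -
    have "l2 = (cnj a * X 1 4 + cnj c * X 2 4) + s * (cnj b * X 1 5 + cnj e * X 2 5)"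
      unfolding l2_def using inv(1)[of 4] inv(2)[of 5] h by metis
    also have "\<dots> = s * h13 * (b * (a * cnj a + b * cnj b))
        + h14 * (e * (a * cnj a + b * cnj b) + b * (c * cnj a + e * cnj b))
        + s * h15 * (e * (c * cnj a + e * cnj b))
        + s * h23 * (b * (a * cnj c + b * cnj e))
        + h24 * (b * (c * cnj c + e * cnj e) + e * (a * cnj c + b * cnj e))
        + s * h25 * (e * (c * cnj c + e * cnj e))"
      unfolding XB by (simp add: algebra_simps ss ss')
    also have "\<dots> = l1 * b + l2 * e" unfolding orth l1_def l2_def by (simp add: algebra_simps)
    finally show ?thesis .
  qed
  show "covector H v* U = covector H"
    unfolding vec_eq_iff forall_2 vector_matrix_mult_def vec_lambda_beta sum_2 l abce
    using e1 e2 by (simp add: mult.commute)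
  define m1 m2 where "m1 = l1 * H $ 1 $ 1 + l2 * H $ 2 $ 1" and "m2 = l1 * H $ 1 $ 2 + l2 * H $ 2 $ 2"
  have m: "covector_image H $ 1 = m1" "covector_image H $ 2 = m2"
    by (simp_all add: covector_image_def l m1_def m2_def)
  have "m1 * a + m2 * c = l1 * (H $ 1 $ 1 * a + H $ 1 $ 2 * c) + l2 * (H $ 2 $ 1 * a + H $ 2 $ 2 * c)"
    by (simp add: m1_def m2_def algebra_simps)
  also have "\<dots> = (l1 * a + l2 * c) * H $ 1 $ 1 + (l1 * b + l2 * e) * H $ 2 $ 1"
    unfolding A[symmetric] by (simp add: algebra_simps)
  finally have f1: "m1 * a + m2 * c = m1" unfolding e1[symmetric] e2[symmetric] m1_def .
  have "m1 * b + m2 * e = l1 * (H $ 1 $ 1 * b + H $ 1 $ 2 * e) + l2 * (H $ 2 $ 1 * b + H $ 2 $ 2 * e)"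
    by (simp add: m1_def m2_def algebra_simps)
  also have "\<dots> = (l1 * a + l2 * c) * H $ 1 $ 2 + (l1 * b + l2 * e) * H $ 2 $ 2"
    unfolding A[symmetric] by (simp add: algebra_simps)
  finally have f2: "m1 * b + m2 * e = m2" unfolding e1[symmetric] e2[symmetric] m2_def .
  show "covector_image H v* U = covector_image H"
    unfolding vec_eq_iff forall_2 vector_matrix_mult_def vec_lambda_beta sum_2 m abce
    using f1 f2 by (simp add: mult.commute)
qed

text \<open>
  A matrix that fixes two linearly independent covectors is the identity.
\<close>

lemma covector_det_imp_trivial_isotropy:
  assumes "covector_det H \<noteq> 0" "unitary U" "act U H = H"
  shows "U = mat 1"
proof -
  note fixed = covector_fixed[OF assms(2,3)]
  define u where "u j = U $ 1 $ j - (if j = 1 then 1 else 0)" for j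
  define w where "w j = U $ 2 $ j - (if j = 2 then 1 else 0)" for j
  have eq: "covector H $ 1 * u j + covector H $ 2 * w j = 0"
       "covector_image H $ 1 * u j + covector_image H $ 2 * w j = 0" for j
  proof -
    have *: "(\<forall>j. (x v* U) $ j = x $ j) \<longrightarrow> x $ 1 * u j + x $ 2 * w j = 0" for x :: "complex ^ 2"
      using exhaust_2[of j]
      by (auto simp: vector_matrix_mult_def sum_2 forall_2 u_def w_def algebra_simps)
    show "covector H $ 1 * u j + covector H $ 2 * w j = 0"
       "covector_image H $ 1 * u j + covector_image H $ 2 * w j = 0"
      using *[of "covector H"] *[of "covector_image H"] fixed by simp_all
  qed
  have "u j = 0" for j
  proof -
    have "covector_det H * u j = covector_image H $ 2 * (covector H $ 1 * u j + covector H $ 2 * w j)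
        - covector H $ 2 * (covector_image H $ 1 * u j + covector_image H $ 2 * w j)"
      by (simp add: covector_det_def algebra_simps)
    then show ?thesis using eq[of j] assms(1) by simp
  qed
  moreover have "w j = 0" for j
  proof -
    have "covector_det H * w j = covector H $ 1 * (covector_image H $ 1 * u j + covector_image H $ 2 * w j)
        - covector_image H $ 1 * (covector H $ 1 * u j + covector H $ 2 * w j)"
      by (simp add: covector_det_def algebra_simps)
    then show ?thesis using eq[of j] assms(1) by simp
  qed
  ultimately show ?thesis
    unfolding vec_eq_iff by (auto simp: forall_2 mat_def u_def w_def)
qed

text \<open>
  The determinant is polynomial, so along a line it either vanishes identically or only finitely
  often.
\<close>

lemma covector_det_along_line:
  "\<exists>p. \<forall>t::real. covector_det (A + t *\<^sub>R (B - A)) = poly p (of_real t)"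
proof -
  define e where "e i j = [: A $ i $ j, B $ i $ j - A $ i $ j :]" for i j :: 9
  have e: "(A + t *\<^sub>R (B - A)) $ i $ j = poly (e i j) (of_real t)" for t i j
    by (simp add: e_def scaleR_conv_of_real[where 'a = complex])
  define l1 where "l1 = smult (of_real (sqrt 2)) (e 1 3) + e 2 4"
  define l2 where "l2 = e 1 4 + smult (of_real (sqrt 2)) (e 2 5)"
  define p where "p = l1 * (l1 * e 1 2 + l2 * e 2 2) - l2 * (l1 * e 1 1 + l2 * e 2 1)"
  have "covector_det (A + t *\<^sub>R (B - A)) = poly p (of_real t)" for t
    unfolding covector_det_def covector_image_def covector_def vector_2 vec_lambda_beta e p_def l1_def l2_def
    by simp
  then show ?thesis by blast
qed

lemma covector_det_nonzero_nearby:
  assumes "covector_det B \<noteq> 0" "\<delta> > 0"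
  obtains t where "0 < t" "t < \<delta>" "covector_det (A + t *\<^sub>R (B - A)) \<noteq> 0"
proof -
  obtain p where p: "\<And>t::real. covector_det (A + t *\<^sub>R (B - A)) = poly p (of_real t)"
    using covector_det_along_line by blast
  have "p \<noteq> 0" using p[of 1] assms(1) by auto
  then have fin: "finite {x. poly p x = 0}" by (rule poly_roots_finite)
  have "infinite (complex_of_real ` {0<..<\<delta>})"
    using assms(2) by (subst finite_image_iff) (auto simp: inj_on_def infinite_Ioo)
  then have "\<not> complex_of_real ` {0<..<\<delta>} \<subseteq> {x. poly p x = 0}" using fin finite_subset by blast
  then obtain x where "x \<in> complex_of_real ` {0<..<\<delta>}" "poly p x \<noteq> 0" by blast
  then obtain t where "0 < t" "t < \<delta>" "poly p (of_real t) \<noteq> 0" by auto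
  then show thesis using that[of t] p by simp
qed

lemma covector_det_nonzero_exists: "\<exists>B. B - base_gram \<sigma> \<in> kernel_forms \<and> covector_det B \<noteq> 0"
proof -
  \<comment> \<open>With this choice the block in degree $(1,1)$ has all entries 1 and the covector is $(\sqrt2,0)$.\<close>
  define Q :: "complex ^ 9 ^ 9"
    where "Q = (\<chi> i j. if (i = 1 \<and> (j = 2 \<or> j = 3)) \<or> (j = 1 \<and> (i = 2 \<or> i = 3)) then -1 else 0)"
  have Q: "Q \<in> low_forms"
    by (auto simp: low_forms_def hermitian_nth Q_def)
  define B where "B = base_gram \<sigma> + sphere_multiple Q"
  have row1: "B $ 1 $ j = base_gram \<sigma> $ 1 $ j - Q $ 1 $ j" and row2: "B $ 2 $ j = base_gram \<sigma> $ 2 $ j - Q $ 2 $ j" for j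
    using sphere_multiple_top_rows[of 1 Q j] sphere_multiple_top_rows[of 2 Q j] by (simp_all add: B_def)
  have "covector_det B = of_real (sqrt 2) * of_real (sqrt 2)"
    unfolding covector_det_def covector_image_def covector_def vector_2 vec_lambda_beta row1 row2
    by (simp add: Q_def base_gram_def Let_def)
  then have "covector_det B \<noteq> 0" by simp
  moreover have "B - base_gram \<sigma> \<in> kernel_forms"
    using sphere_multiple_in_kernel[OF Q] by (simp add: B_def)
  ultimately show ?thesis by blast
qed

text \<open>
  Positive definiteness without the Hermitian condition; unlike \<open>pos_def\<close> it is open
  among all matrices.
\<close>

definition sphere_positive :: "(complex ^ 9 ^ 9) set" where
  "sphere_positive = {H. \<forall>v\<in>sphere 0 1. 0 < Re (cdot v (H *v v))}"

lemma open_sphere_positive: "open sphere_positive"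
proof -
  have "continuous_on UNIV (\<lambda>x :: (complex ^ 9) \<times> (complex ^ 9 ^ 9). Re (cdot (fst x) (snd x *v fst x)))"
    unfolding cdot_matrix case_prod_unfold by (intro continuous_intros)
  then have "closed {x :: (complex ^ 9) \<times> (complex ^ 9 ^ 9). Re (cdot (fst x) (snd x *v fst x)) \<le> 0}"
    by (intro closed_Collect_le continuous_on_const)
  from closed_compact_projection[OF compact_sphere[of "0 :: complex ^ 9" 1] this]
  have "open (- {H :: complex ^ 9 ^ 9. \<exists>v. v \<in> sphere 0 1 \<and> (v, H) \<in> {x. Re (cdot (fst x) (snd x *v fst x)) \<le> 0}})"
    by (rule open_Compl)
  moreover have "sphere_positive =
      - {H :: complex ^ 9 ^ 9. \<exists>v. v \<in> sphere 0 1 \<and> (v, H) \<in> {x. Re (cdot (fst x) (snd x *v fst x)) \<le> 0}}"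
    by (force simp: sphere_positive_def not_le)
  ultimately show ?thesis by metis
qed

lemma pos_def_iff: "pos_def H \<longleftrightarrow> hermitian H \<and> H \<in> sphere_positive"
proof
  assume "pos_def H"
  then show "hermitian H \<and> H \<in> sphere_positive"
    unfolding pos_def_def sphere_positive_def by (auto; metis norm_zero zero_neq_one)
next
  assume H: "hermitian H \<and> H \<in> sphere_positive"
  have "0 < Re (cdot v (H *v v))" if v: "v \<noteq> 0" for v
  proof -
    have eq: "v = of_real (norm v) *s (inverse (norm v) *\<^sub>R v)"
      using v by (simp add: vec_eq_iff scaleR_conv_of_real[where 'a = complex])
    have "Re (cdot v (H *v v)) = (norm v)\<^sup>2 * Re (cdot (inverse (norm v) *\<^sub>R v) (H *v (inverse (norm v) *\<^sub>R v)))"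
      by (subst eq, subst (2) eq) (simp only: cdot_smult, simp add: power2_eq_square)
    moreover have "inverse (norm v) *\<^sub>R v \<in> sphere 0 1" using v by simp
    ultimately show ?thesis using H v by (simp add: sphere_positive_def)
  qed
  then show "pos_def H" using H by (simp add: pos_def_def)
qed

lemma kernel_forms_hermitian: "H - base_gram \<sigma> \<in> kernel_forms \<Longrightarrow> hermitian H"
  using subspace_add[OF subspace_hermitian, of "H - base_gram \<sigma>" "base_gram \<sigma>"] hermitian_base_gram[of \<sigma>]
  by (simp add: kernel_forms_def)

lemma S_fr_iff_open: "H \<in> S_fr \<sigma> \<longleftrightarrow> H \<in> sphere_positive \<and> H - base_gram \<sigma> \<in> kernel_forms"
  using kernel_forms_hermitian[of H \<sigma>] by (auto simp: S_fr_iff pos_def_iff)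

lemma affine_combination_in_kernel:
  assumes "A - C \<in> kernel_forms" "B - C \<in> kernel_forms"
  shows "A + t *\<^sub>R (B - A) - C \<in> kernel_forms"
proof -
  have "A + t *\<^sub>R (B - A) - C = (A - C) + t *\<^sub>R ((B - C) - (A - C))" by simp
  then show ?thesis
    using assms subspace_kernel_forms by (metis subspace_add subspace_diff subspace_scale)
qed

lemma line_eventually_in_open:
  fixes A :: "'a::real_normed_vector"
  assumes "open S" "A \<in> S"
  obtains \<delta> where "\<delta> > 0" "\<And>t. 0 < t \<Longrightarrow> t < \<delta> \<Longrightarrow> A + t *\<^sub>R D \<in> S"
proof -
  have "((\<lambda>t. A + t *\<^sub>R D) \<longlongrightarrow> A + 0 *\<^sub>R D) (at_right (0::real))"
    by (intro tendsto_intros)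
  then have "\<forall>\<^sub>F t in at_right 0. A + t *\<^sub>R D \<in> S" using assms by (auto dest: topological_tendstoD)
  then show thesis using that by (auto simp: eventually_at_right_field)
qed

text \<open>
  Move first towards a positive definite matrix, which makes \<open>H\<close> positive definite, and
  then by a smaller amount towards a matrix whose covector determinant does not vanish.
\<close>

lemma S_fr_covector_det_dense:
  assumes "\<sigma> \<in> Sigma_set" "H \<in> S_red \<sigma>" "e > 0"
  obtains K where "K \<in> S_fr \<sigma>" "covector_det K \<noteq> 0" "dist K H < e"
proof -
  have H: "hermitian H" "\<And>v. 0 \<le> Re (cdot v (H *v v))" "H - base_gram \<sigma> \<in> kernel_forms"
    using assms(2) represents_iff[of H \<sigma>] by (auto simp: S_red_def pos_semidef_def)
  obtain P where P: "pos_def P" "P - base_gram \<sigma> \<in> kernel_forms"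
    using S_fr_nonempty[OF assms(1)] S_fr_iff by blast
  obtain \<delta> where \<delta>: "\<delta> > 0" "\<And>t. 0 < t \<Longrightarrow> t < \<delta> \<Longrightarrow> H + t *\<^sub>R (P - H) \<in> ball H e"
    using line_eventually_in_open[of "ball H e" H] assms(3) by auto
  define t where "t = min \<delta> 1 / 2"
  have t: "0 < t" "t < \<delta>" "t < 1" using \<delta>(1) by (auto simp: t_def min_def)
  define L where "L = H + t *\<^sub>R (P - H)"
  have Lk: "L - base_gram \<sigma> \<in> kernel_forms" unfolding L_def by (rule affine_combination_in_kernel[OF H(3) P(2)])
  have "0 < Re (cdot v (L *v v))" if "v \<noteq> 0" for v
  proof -
    have "Re (cdot v (L *v v)) = (1 - t) * Re (cdot v (H *v v)) + t * Re (cdot v (P *v v))"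
      unfolding L_def cdot_matrix_linear by (simp add: algebra_simps)
    moreover have "(1 - t) * Re (cdot v (H *v v)) \<ge> 0" using t H(2) by simp
    moreover have "t * Re (cdot v (P *v v)) > 0" using t P(1) that by (simp add: pos_def_def)
    ultimately show ?thesis by linarith
  qed
  then have Lp: "L \<in> sphere_positive" by (auto simp: sphere_positive_def) (metis norm_zero zero_neq_one)
  have Lb: "L \<in> ball H e" unfolding L_def by (rule \<delta>(2)[OF t(1,2)])
  obtain B where B: "B - base_gram \<sigma> \<in> kernel_forms" "covector_det B \<noteq> 0" using covector_det_nonzero_exists by blast
  obtain \<delta>' where \<delta>': "\<delta>' > 0" "\<And>t. 0 < t \<Longrightarrow> t < \<delta>' \<Longrightarrow> L + t *\<^sub>R (B - L) \<in> ball H e \<inter> sphere_positive"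
    using line_eventually_in_open[of "ball H e \<inter> sphere_positive" L] Lp Lb open_sphere_positive
    by (metis IntI open_Int open_ball)
  obtain s where s: "0 < s" "s < \<delta>'" "covector_det (L + s *\<^sub>R (B - L)) \<noteq> 0"
    using covector_det_nonzero_nearby[OF B(2) \<delta>'(1)] by blast
  show thesis
  proof (rule that[OF _ s(3)])
    show "L + s *\<^sub>R (B - L) \<in> S_fr \<sigma>"
      unfolding S_fr_iff_open using \<delta>'(2)[OF s(1,2)] affine_combination_in_kernel[OF Lk B(1)] by blast
    show "dist (L + s *\<^sub>R (B - L)) H < e"
      using \<delta>'(2)[OF s(1,2)] by (simp add: dist_commute)
  qed
qed

text \<open>
  If \<open>H\<close> is invertible, then both $z_1$ and $z_2$ belong to \<open>E_space H\<close>, and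
  they have no common factor.
\<close>

lemma S_fr_subset_S_red: "S_fr \<sigma> \<subseteq> S_red \<sigma>"
proof
  fix H assume "H \<in> S_fr \<sigma>"
  then have H: "pos_def H" "represents_on_sphere \<sigma> H" by (auto simp: S_fr_def)
  have pos: "0 < Re (cdot v (H *v v))" if "v \<noteq> 0" for v using H(1) that by (simp add: pos_def_def)
  have "pos_semidef H"
    unfolding pos_semidef_def
  proof (intro conjI allI)
    show "hermitian H" using H(1) by (simp add: pos_def_def)
    show "0 \<le> Re (cdot v (H *v v))" for v using pos[of v] by (cases "v = 0") auto
  qed
  moreover have "H $ 6 $ 6 \<noteq> 0"
  proof
    assume "H $ 6 $ 6 = 0"
    then have "cdot (axis 6 1) (H *v axis 6 1) = 0"
      unfolding cdot_def matrix_vector_mult_def axis_def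
      by (simp add: if_distrib[of "\<lambda>x. _ * x"] if_distrib[of "\<lambda>x. x * _"] if_distrib[of cnj] cong: if_cong)
    then show False using pos[of "axis 6 1"] by (simp add: axis_eq_0_iff)
  qed
  moreover have "\<not> nonconstant2 d" if d: "\<forall>p\<in>E_space H. d dvd p" for d
  proof -
    have "inj ((*v) H)"
    proof (rule injI)
      fix x y assume "H *v x = H *v y"
      then have "H *v (x - y) = 0" by (simp add: matrix_vector_mult_diff_distrib)
      then show "x = y" using pos[of "x - y"] by (cases "x - y = 0") auto
    qed
    then have "\<exists>B. H ** B = mat 1"
      using matrix_left_invertible_injective matrix_left_right_inverse by metis
    then have "surj ((*v) H)" using matrix_right_invertible_surjective by blast
    then have mem: "V_poly $ i \<in> E_space H" for i
    proof -
      have "V_poly $ i = (\<Sum>k\<in>UNIV. const2 (cnj (axis i 1 $ k)) * V_poly $ k)"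
      proof -
        have "(\<Sum>k\<in>UNIV. const2 (cnj (axis i 1 $ k)) * V_poly $ k) = (\<Sum>k\<in>UNIV. if k = i then V_poly $ k else 0)"
          by (rule sum.cong) (auto simp: axis_def one_pCons[symmetric])
        then show ?thesis by simp
      qed
      then show ?thesis using \<open>surj ((*v) H)\<close> unfolding E_space_def by blast
    qed
    have "d dvd Z1" "d dvd Z2" using d mem[of 1] mem[of 2] by (auto simp: V_poly_def)
    have "degree d = 0" using dvd_imp_degree_le[OF \<open>d dvd Z1\<close>] by simp
    then obtain q where q: "d = [:q:]" by (rule degree_eq_zeroE)
    have "q dvd coeff Z2 1" using \<open>d dvd Z2\<close> unfolding q const_poly_dvd_iff by blast
    then have "q dvd 1" by simp
    then have "degree q = 0" using dvd_imp_degree_le[of q 1] by simp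
    then obtain c where "q = [:c:]" by (rule degree_eq_zeroE)
    then show ?thesis by (simp add: nonconstant2_def q)
  qed
  ultimately show "H \<in> S_red \<sigma>" using H(2) unfolding S_red_def by blast
qed

section \<open>The moduli spaces\<close>

lemma quotient_map_eq_quotient_topology:
  assumes "quotient_map X Y f" shows "Y = quotient_topology X f"
  unfolding topology_eq openin_quotient_topology
proof
  fix U
  show "openin Y U \<longleftrightarrow> U \<subseteq> f ` topspace X \<and> openin X {x \<in> topspace X. f x \<in> U}"
    using assms openin_subset[of Y U] unfolding quotient_map_def by metis
qed

lemma homeomorphic_imp_quotient_map: "homeomorphic_map X Y f \<Longrightarrow> quotient_map X Y f"
  by (simp add: homeomorphic_map_def)

lemma dense_image:
  assumes "continuous_map X Y f" "f ` topspace X = topspace Y" "X closure_of P = topspace X"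
  shows "Y closure_of (f ` P) = topspace Y"
  using continuous_map_image_closure_subset[OF assms(1), of P] assms(2,3) closure_of_subset_topspace
  by fastforce

lemma dense_top_of_set:
  fixes S :: "'a::metric_space set"
  assumes "\<And>x e. x \<in> S \<Longrightarrow> e > 0 \<Longrightarrow> \<exists>y\<in>P. dist y x < e" "P \<subseteq> S"
  shows "top_of_set S closure_of P = topspace (top_of_set S)"
proof -
  have "S \<subseteq> closure P" using assms(1) by (auto simp: closure_approachable)
  then show ?thesis using assms(2) by (auto simp: closure_of_subtopology Int_absorb1)
qed

abbreviation trivial_stabilizer :: "(complex ^ 2 ^ 2) set \<Rightarrow> complex ^ 9 ^ 9 \<Rightarrow> bool" where
  "trivial_stabilizer \<Gamma> \<equiv> isometric_matrix_action.free \<Gamma> act"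

lemma free_iff: "trivial_stabilizer (G \<sigma>) H \<longleftrightarrow> (\<forall>U\<in>G \<sigma>. act U H = H \<longrightarrow> U = mat 1)"
  using isometric_matrix_action.free_def[OF act_isometric_matrix_action] .

lemma open_trivial_stabilizer: "open {H. trivial_stabilizer (G \<sigma>) H}"
  using isometric_matrix_action.open_free[OF act_isometric_matrix_action] .

lemma isotropy_eq: "isotropy (\<sigma>, H) = {mat 1} \<longleftrightarrow> trivial_stabilizer (G \<sigma>) H"
  using G_one[of \<sigma>] act_one by (auto simp: isotropy_def free_iff)

lemma covector_det_imp_free: "covector_det H \<noteq> 0 \<Longrightarrow> trivial_stabilizer (G \<sigma>) H"
  unfolding free_iff using covector_det_imp_trivial_isotropy by (auto simp: G_def)

lemma free_act:
  assumes U: "U \<in> G \<sigma>" and H: "trivial_stabilizer (G \<sigma>) H"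
  shows "trivial_stabilizer (G \<sigma>) (act U H)"
  unfolding free_iff
proof (intro ballI impI)
  fix W assume W: "W \<in> G \<sigma>" "act W (act U H) = act U H"
  let ?V = "adjoint_mat U"
  have V: "?V \<in> G \<sigma>" "U ** ?V = mat 1" "?V ** U = mat 1"
    using G_adjoint[OF U] U unitary_right[of U] by (simp_all add: G_def unitary_def)
  have "act (U ** W ** ?V) H = act (U ** ?V) H" using W(2) by (simp add: act_mult)
  then have "U ** W ** ?V = mat 1" using H U W V G_mult by (simp add: free_iff act_one)
  then have "?V ** (U ** W ** ?V) ** U = ?V ** U" by simp
  then have "(?V ** U) ** W ** (?V ** U) = ?V ** U" by (simp add: matrix_mul_assoc)
  then show "W = mat 1" by (simp add: V)
qed

definition full_rank_free :: "(real \<times> real) set \<Rightarrow> param_gram set" where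
  "full_rank_free A = {(\<sigma>, H). \<sigma> \<in> A \<and> H \<in> S_fr \<sigma> \<and> trivial_stabilizer (G \<sigma>) H}"

text \<open>
  Full-rank points with trivial isotropy exist over every parameter, so minimal isotropy means trivial
  isotropy.
\<close>

lemma principal_points_eq:
  assumes "A \<subseteq> Sigma_set" shows "principal_points A = full_rank_free A"
proof (rule set_eqI, clarify)
  fix \<sigma> H
  have one: "mat 1 \<in> isotropy (\<tau>, K)" for \<tau> K by (simp add: isotropy_def G_one act_one)
  show "(\<sigma>, H) \<in> principal_points A \<longleftrightarrow> (\<sigma>, H) \<in> full_rank_free A"
  proof
    assume P: "(\<sigma>, H) \<in> principal_points A"
    then have \<sigma>: "\<sigma> \<in> A" "H \<in> S_fr \<sigma>" by (auto simp: principal_points_def)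
    have "\<sigma> \<in> Sigma_set" "H \<in> S_red \<sigma>" using \<sigma> assms S_fr_subset_S_red[of \<sigma>] by blast+
    then obtain K where K: "K \<in> S_fr \<sigma>" "covector_det K \<noteq> 0" using S_fr_covector_det_dense[OF _ _ zero_less_one] by blast
    have iso: "isotropy (\<sigma>, K) = {mat 1}" using covector_det_imp_free[OF K(2)] by (simp add: isotropy_eq)
    obtain W where W: "W \<in> G \<sigma>" "isotropy (\<sigma>, H) \<subseteq> {W ** U ** adjoint_mat W | U. U \<in> isotropy (\<sigma>, K)}"
      using P \<sigma>(1) K(1) unfolding principal_points_def by blast
    have "W ** adjoint_mat W = mat 1" using W(1) by (simp add: G_def unitary_right)
    then have "isotropy (\<sigma>, H) = {mat 1}" using W(2) one[of \<sigma> H] by (auto simp: iso)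
    then show "(\<sigma>, H) \<in> full_rank_free A" using \<sigma> by (simp add: full_rank_free_def isotropy_eq)
  next
    assume F: "(\<sigma>, H) \<in> full_rank_free A"
    then have iso: "isotropy (\<sigma>, H) = {mat 1}" by (simp add: full_rank_free_def isotropy_eq)
    have "isotropy (\<sigma>, H) \<subseteq> {mat 1 ** U ** adjoint_mat (mat 1) | U. U \<in> isotropy (\<tau>, K)}" for \<tau> K
      using one[of \<tau> K] by (force simp: iso)
    then show "(\<sigma>, H) \<in> principal_points A"
      using F G_one unfolding principal_points_def full_rank_free_def by blast
  qed
qed

text \<open>
  Subtracting the invariant origin \<open>base_gram\<close> and translating the parameter by
  \<open>\<upsilon>\<close> identifies the free full-rank points equivariantly with an open subset of
  the linear space \<open>B \<times> kernel_forms\<close>, to which the slice theorem applies. A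
  single parameter is the case \<open>B = {0}\<close>.
\<close>

lemma manifold_full_rank_free:
  fixes f :: "param_gram \<Rightarrow> 'b"
  assumes A: "A \<subseteq> Sigma_set" "\<rho> \<in> A" "\<And>\<sigma>. \<sigma> \<in> A \<Longrightarrow> G \<sigma> = G \<rho>"
    and B: "subspace B" "A \<subseteq> (+) \<upsilon> ` B" "openin (top_of_set B) {\<tau> \<in> B. \<upsilon> + \<tau> \<in> A}"
    and fibre: "\<And>x y. x \<in> full_rank_free A \<Longrightarrow> y \<in> full_rank_free A \<Longrightarrow>
        f x = f y \<longleftrightarrow> (\<exists>U\<in>G (fst x). y = pair_act U x)"
  shows "manifold_of_dim (quotient_topology (top_of_set (full_rank_free A)) f) (dim B + 25 - dim (lie \<rho>))"
proof -
  interpret pair: isometric_matrix_action "G \<rho>" pair_act "\<lambda>x \<xi>. (0, act_deriv (snd x) \<xi>)" "lie \<rho>"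
    by (rule pair_act_isometric_matrix_action)
  define h :: "param_gram \<Rightarrow> param_gram" where "h x = (\<upsilon> + fst x, base_gram (\<upsilon> + fst x) + snd x)" for x
  define k :: "param_gram \<Rightarrow> param_gram" where "k x = (fst x - \<upsilon>, snd x - base_gram (fst x))" for x
  define M where "M = B \<times> kernel_forms"
  define X where "X = {x \<in> M. h x \<in> full_rank_free A}"
  have hk: "h (k x) = x" "k (h x) = x" for x by (simp_all add: h_def k_def)
  have ch: "continuous_on UNIV h"
    unfolding h_def
    by (intro continuous_intros continuous_on_compose2[OF continuous_base_gram]) auto
  have ck: "continuous_on UNIV k"
    unfolding k_def
    by (intro continuous_intros continuous_on_compose2[OF continuous_base_gram]) auto
  have kM: "k x \<in> M" if "x \<in> full_rank_free A" for x
    using that B(2) by (auto simp: full_rank_free_def k_def M_def S_fr_iff)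
  have "homeomorphic_maps (top_of_set X) (top_of_set (full_rank_free A)) h k"
    unfolding homeomorphic_maps_def
    using ch ck kM hk by (auto simp: X_def intro: continuous_on_subset)
  then have "homeomorphic_map (top_of_set X) (top_of_set (full_rank_free A)) h"
    using homeomorphic_maps_map by blast
  then have quo: "quotient_topology (top_of_set (full_rank_free A)) f = quotient_topology (top_of_set X) (f \<circ> h)"
    by (intro quotient_map_eq_quotient_topology quotient_map_compose[OF homeomorphic_imp_quotient_map
        quotient_map_quotient_topology])
  have M: "subspace M" unfolding M_def by (intro subspace_Times B subspace_kernel_forms)
  have dimM: "dim M = dim B + 25"
    unfolding M_def by (simp add: dim_Times B(1) subspace_kernel_forms dim_kernel_forms)
  have unitary: "unitary U" if "U \<in> G \<sigma>" for U \<sigma> using that by (simp add: G_def)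
  have h_act: "h (pair_act U x) = pair_act U (h x)" if "U \<in> G \<rho>" "\<upsilon> + fst x \<in> A" for U x
    using act_base_gram[of U "\<upsilon> + fst x"] that A(3)
    by (simp add: h_def pair_act_def linear_add[OF linear_act])
  have act_full: "pair_act U x \<in> full_rank_free A" if "U \<in> G \<rho>" "x \<in> full_rank_free A" for U x
  proof -
    obtain \<sigma> H where x: "x = (\<sigma>, H)" by (cases x)
    show ?thesis
      using that act_S_fr[of U \<sigma> H] free_act[of U \<sigma> H] A(3)[of \<sigma>]
      by (simp add: x full_rank_free_def pair_act_def)
  qed
  have XA: "\<upsilon> + fst x \<in> A" if "x \<in> X" for x
    using that by (auto simp: X_def h_def full_rank_free_def)
  have "manifold_of_dim (quotient_topology (top_of_set X) (f \<circ> h)) (dim M - dim (lie \<rho>))"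
  proof (rule pair.manifold_quotient[OF M])
    show "pair_act U x \<in> M" if "U \<in> G \<rho>" "x \<in> M" for U x
      using that act_kernel_forms unitary[of U \<rho>] by (auto simp: M_def pair_act_def)
    then show "pair_act U x \<in> X" if "U \<in> G \<rho>" "x \<in> X" for U x
      using that h_act[OF that(1) XA[OF that(2)]] act_full by (auto simp: X_def)
    show "openin (top_of_set M) X"
    proof -
      obtain Op where Op: "open Op" "{\<tau> \<in> B. \<upsilon> + \<tau> \<in> A} = B \<inter> Op"
        using B(3) by (auto simp: openin_open)
      have "X = M \<inter> ((Op \<times> UNIV) \<inter> h -` (UNIV \<times> (sphere_positive \<inter> {H. trivial_stabilizer (G \<rho>) H})))"
      proof (rule set_eqI)
        fix x :: param_gram
        obtain \<tau> K where x: "x = (\<tau>, K)" by (cases x)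
        have "\<tau> \<in> B \<Longrightarrow> \<upsilon> + \<tau> \<in> A \<longleftrightarrow> \<tau> \<in> Op" using Op(2) by blast
        then show "x \<in> X \<longleftrightarrow> x \<in> M \<inter> ((Op \<times> UNIV) \<inter> h -` (UNIV \<times> (sphere_positive \<inter> {H. trivial_stabilizer (G \<rho>) H})))"
          using A(3)[of "\<upsilon> + \<tau>"]
          by (auto simp: x X_def M_def h_def full_rank_free_def S_fr_iff_open)
      qed
      moreover have "open ((Op \<times> UNIV) \<inter> h -` (UNIV \<times> (sphere_positive \<inter> {H. trivial_stabilizer (G \<rho>) H})))"
        by (intro open_Int open_Times Op(1) open_UNIV open_vimage open_sphere_positive open_trivial_stabilizer ch)
      ultimately show ?thesis by (simp only: openin_open_Int)
    qed
    show "X \<noteq> {}"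
    proof -
      have \<rho>: "\<rho> \<in> Sigma_set" using A(1,2) by blast
      then obtain H where "H \<in> S_red \<rho>" using S_fr_nonempty S_fr_subset_S_red by blast
      then obtain K where "K \<in> S_fr \<rho>" "covector_det K \<noteq> 0"
        using S_fr_covector_det_dense[OF \<rho> _ zero_less_one] by blast
      then have "(\<rho>, K) \<in> full_rank_free A" using A(2) covector_det_imp_free by (simp add: full_rank_free_def)
      then have "k (\<rho>, K) \<in> X" using kM hk by (simp add: X_def)
      then show ?thesis by blast
    qed
    show "pair.free x" if "x \<in> X" for x
      unfolding pair.free_def
    proof (intro ballI impI)
      fix U assume U: "U \<in> G \<rho>" "pair_act U x = x"
      then have "pair_act U (h x) = h x" using h_act[OF U(1) XA[OF that]] by simp
      moreover have "trivial_stabilizer (G \<rho>) (snd (h x))"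
        using that A(3)[of "fst (h x)"] by (simp add: X_def full_rank_free_def case_prod_unfold)
      ultimately show "U = mat 1" using U(1) by (metis free_iff pair_act_def snd_conv)
    qed
    show "(f \<circ> h) x = (f \<circ> h) y \<longleftrightarrow> (\<exists>U\<in>G \<rho>. y = pair_act U x)" if "x \<in> X" "y \<in> X" for x y
    proof -
      have "fst (h x) \<in> A" using XA[OF that(1)] by (simp add: h_def)
      then have "(f \<circ> h) x = (f \<circ> h) y \<longleftrightarrow> (\<exists>U\<in>G \<rho>. h y = pair_act U (h x))"
        using fibre[of "h x" "h y"] that A(3) by (simp add: X_def)
      also have "\<dots> \<longleftrightarrow> (\<exists>U\<in>G \<rho>. h y = h (pair_act U x))"
        using h_act[OF _ XA[OF that(1)]] by auto
      also have "\<dots> \<longleftrightarrow> (\<exists>U\<in>G \<rho>. y = pair_act U x)" using hk by metis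
      finally show ?thesis .
    qed
  qed
  then show ?thesis by (simp add: quo dimM)
qed

lemma orbit_eq_iff: "orbit \<sigma> H = orbit \<sigma> K \<longleftrightarrow> (\<exists>U\<in>G \<sigma>. K = act U H)"
proof
  assume "orbit \<sigma> H = orbit \<sigma> K"
  moreover have "K \<in> orbit \<sigma> K" using G_one[of \<sigma>] act_one[of K] unfolding orbit_def by force
  ultimately show "\<exists>U\<in>G \<sigma>. K = act U H" by (auto simp: orbit_def)
next
  assume "\<exists>U\<in>G \<sigma>. K = act U H"
  then obtain U where U: "U \<in> G \<sigma>" "K = act U H" by blast
  have V: "adjoint_mat U \<in> G \<sigma>" "U ** adjoint_mat U = mat 1"
    using U(1) G_adjoint[OF U(1)] by (simp_all add: G_def unitary_right)
  have H: "H = act (adjoint_mat U) K" using U(2) V(2) by (simp add: act_one flip: act_mult)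
  show "orbit \<sigma> H = orbit \<sigma> K"
  proof
    show "orbit \<sigma> H \<subseteq> orbit \<sigma> K"
      unfolding orbit_def by (subst H) (use V(1) G_mult[of _ \<sigma>] in \<open>force simp flip: act_mult\<close>)
    show "orbit \<sigma> K \<subseteq> orbit \<sigma> H"
      unfolding orbit_def U(2) by (use U(1) G_mult[of _ \<sigma>] in \<open>force simp flip: act_mult\<close>)
  qed
qed

text \<open>
  The free full-rank matrices are open and saturated in \<open>S_red \<sigma>\<close>, so here the
  subspace topology is a quotient topology.
\<close>

proposition M_sigma_dim:
  assumes \<sigma>: "\<sigma> \<in> Sigma_set"
  shows "M_sigma_has_dim \<sigma> (25 - dim (lie \<sigma>))"
proof -
  define P where "P = {H. (\<sigma>, H) \<in> principal_points {\<sigma>}}"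
  have P: "P = {H \<in> S_fr \<sigma>. trivial_stabilizer (G \<sigma>) H}"
    using principal_points_eq[of "{\<sigma>}"] \<sigma> by (auto simp: P_def full_rank_free_def)
  have PS: "P \<subseteq> S_red \<sigma>" using S_fr_subset_S_red[of \<sigma>] by (auto simp: P)
  have quo: "quotient_map (top_of_set (S_red \<sigma>)) (M_sigma \<sigma>) (orbit \<sigma>)"
    unfolding M_sigma_def by (rule quotient_map_quotient_topology)
  have sat: "{H \<in> topspace (top_of_set (S_red \<sigma>)). orbit \<sigma> H \<in> orbit \<sigma> ` P} = P"
  proof -
    have "H \<in> P" if "orbit \<sigma> H = orbit \<sigma> K" "K \<in> P" for H K
    proof -
      have "\<exists>U\<in>G \<sigma>. H = act U K" using that(1) orbit_eq_iff[of \<sigma> K H] by simp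
      then obtain U where "U \<in> G \<sigma>" "H = act U K" by blast
      then show ?thesis using that(2) act_S_fr[of U \<sigma> K] free_act[of U \<sigma> K] by (simp add: P)
    qed
    then show ?thesis using PS by auto
  qed
  have Peq: "P = S_red \<sigma> \<inter> (sphere_positive \<inter> {H. trivial_stabilizer (G \<sigma>) H})"
    using PS by (auto simp: P S_fr_def S_red_def pos_semidef_def pos_def_iff)
  have openP: "openin (top_of_set (S_red \<sigma>)) P"
    by (subst Peq, intro openin_open_Int open_Int open_sphere_positive open_trivial_stabilizer)
  have open_image: "openin (M_sigma \<sigma>) (orbit \<sigma> ` P)"
    unfolding M_sigma_def openin_quotient_topology using sat openP PS by auto
  have "top_of_set (S_red \<sigma>) closure_of P = topspace (top_of_set (S_red \<sigma>))"
  proof (rule dense_top_of_set[OF _ PS])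
    fix H and e :: real assume "H \<in> S_red \<sigma>" "e > 0"
    then obtain K where "K \<in> S_fr \<sigma>" "covector_det K \<noteq> 0" "dist K H < e" using S_fr_covector_det_dense[OF \<sigma>] by blast
    then show "\<exists>y\<in>P. dist y H < e" using covector_det_imp_free[of K \<sigma>] by (auto simp: P)
  qed
  then have dense: "M_sigma \<sigma> closure_of (orbit \<sigma> ` P) = topspace (M_sigma \<sigma>)"
    by (intro dense_image[OF quotient_imp_continuous_map[OF quo]])
       (simp_all add: M_sigma_def topspace_quotient_topology)
  have "quotient_map (subtopology (top_of_set (S_red \<sigma>)) P) (subtopology (M_sigma \<sigma>) (orbit \<sigma> ` P)) (orbit \<sigma>)"
    by (rule quotient_map_restriction[OF quo sat]) (simp add: open_image)
  then have quoP: "quotient_map (top_of_set P) (subtopology (M_sigma \<sigma>) (orbit \<sigma> ` P)) (orbit \<sigma>)"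
    using PS by (simp add: subtopology_subtopology Int_absorb1)
  have F: "full_rank_free {\<sigma>} = Pair \<sigma> ` P" by (auto simp: full_rank_free_def P)
  have "homeomorphic_maps (top_of_set (full_rank_free {\<sigma>})) (top_of_set P) snd (Pair \<sigma>)"
    unfolding homeomorphic_maps_def F by (auto intro!: continuous_intros)
  then have hm: "homeomorphic_map (top_of_set (full_rank_free {\<sigma>})) (top_of_set P) snd"
    using homeomorphic_maps_map by blast
  have "quotient_map (top_of_set (full_rank_free {\<sigma>})) (subtopology (M_sigma \<sigma>) (orbit \<sigma> ` P)) (orbit \<sigma> \<circ> snd)"
    by (rule quotient_map_compose[OF homeomorphic_imp_quotient_map[OF hm] quoP])
  then have eq: "subtopology (M_sigma \<sigma>) (orbit \<sigma> ` P) =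
      quotient_topology (top_of_set (full_rank_free {\<sigma>})) (orbit \<sigma> \<circ> snd)"
    by (rule quotient_map_eq_quotient_topology)
  have "manifold_of_dim (subtopology (M_sigma \<sigma>) (orbit \<sigma> ` P)) (dim {0 :: real \<times> real} + 25 - dim (lie \<sigma>))"
    unfolding eq
  proof (rule manifold_full_rank_free[where \<upsilon> = \<sigma>])
    have "{\<tau> \<in> {0}. \<sigma> + \<tau> \<in> {\<sigma>}} = {0}" by auto
    then show "openin (top_of_set {0}) {\<tau> \<in> {0}. \<sigma> + \<tau> \<in> {\<sigma>}}" by simp
    show "(orbit \<sigma> \<circ> snd) x = (orbit \<sigma> \<circ> snd) y \<longleftrightarrow> (\<exists>U\<in>G (fst x). y = pair_act U x)"
      if "x \<in> full_rank_free {\<sigma>}" "y \<in> full_rank_free {\<sigma>}" for x y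
      using that by (auto simp: F orbit_eq_iff pair_act_def)
  qed (use \<sigma> in auto)
  then show ?thesis
    unfolding M_sigma_has_dim_def dim_via_open_dense_def P_def[symmetric]
    using open_image dense by simp
qed

definition full_rank :: "param_gram set" where
  "full_rank = {x. fst x \<in> Sigma_set \<and> snd x \<in> S_fr (fst x)}"

lemma full_rank_eq: "full_rank = total_space \<inter> (UNIV \<times> sphere_positive)"
proof (rule set_eqI)
  fix x :: param_gram
  obtain \<sigma> H where x: "x = (\<sigma>, H)" by (cases x)
  show "x \<in> full_rank \<longleftrightarrow> x \<in> total_space \<inter> (UNIV \<times> sphere_positive)"
    using S_fr_subset_S_red[of \<sigma>]
    by (auto simp: x full_rank_def total_space_def S_fr_def S_red_def pos_semidef_def pos_def_iff)
qed

lemma sim_class_eq_iff: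
  assumes "x \<in> total_space" "y \<in> total_space"
  shows "sim_class x = sim_class y \<longleftrightarrow> (\<exists>U\<in>G (fst x). y = pair_act U x)"
proof -
  obtain \<sigma> H \<tau> K where xy: "x = (\<sigma>, H)" "y = (\<tau>, K)" by (metis surj_pair)
  have cls: "sim_class (\<sigma>, H) = {(\<upsilon>, L). \<upsilon> = \<sigma> \<and> L \<in> orbit \<sigma> H \<and> (\<sigma>, L) \<in> total_space}"
    if "(\<sigma>, H) \<in> total_space" for \<sigma> H
    using that by (auto simp: sim_class_def sim_def orbit_def)
  have self: "(\<tau>, K) \<in> sim_class (\<tau>, K)"
    using assms(2) G_one[of \<tau>] act_one[of K] by (force simp: cls xy orbit_def)
  show ?thesis
  proof
    assume "sim_class x = sim_class y"
    then have "(\<tau>, K) \<in> sim_class (\<sigma>, H)" using self by (simp add: xy)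
    then show "\<exists>U\<in>G (fst x). y = pair_act U x"
      using assms(1) by (auto simp: cls xy orbit_def pair_act_def)
  next
    assume "\<exists>U\<in>G (fst x). y = pair_act U x"
    then have "\<tau> = \<sigma>" "orbit \<sigma> H = orbit \<sigma> K" by (auto simp: xy pair_act_def orbit_eq_iff)
    then show "sim_class x = sim_class y" using assms by (simp add: xy cls)
  qed
qed

lemma full_rank_subset: "full_rank \<subseteq> total_space"
  using full_rank_eq by blast

lemma pair_act_full_rank: "x \<in> full_rank \<Longrightarrow> U \<in> G (fst x) \<Longrightarrow> pair_act U x \<in> full_rank"
  using act_S_fr[of U "fst x" "snd x"] by (simp add: full_rank_def pair_act_def)

lemma full_rank_saturated: "{x \<in> total_space. sim_class x \<in> sim_class ` full_rank} = full_rank"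
proof -
  have "x \<in> full_rank" if "x \<in> total_space" "y \<in> full_rank" "sim_class x = sim_class y" for x y
    using sim_class_eq_iff[of y x] that pair_act_full_rank[OF that(2)] full_rank_subset by auto
  then show ?thesis using full_rank_subset by blast
qed

lemma continuous_D_mat: "continuous_on UNIV D_mat"
proof -
  have "\<forall>i j. continuous_on UNIV (\<lambda>\<sigma>. D_mat \<sigma> $ i $ j)"
    unfolding forall_2 D_mat_def vector_2 by (intro conjI continuous_intros)
  then have "continuous_on UNIV (\<lambda>\<sigma>. \<chi> i j. D_mat \<sigma> $ i $ j)"
    by (intro continuous_on_vec_lambda) blast
  then show ?thesis by simp
qed

text \<open>
  The union of the graphs of the actions of all $G_\sigma$ is closed in $U(2)$ times the full-rank
  points, and projections along compact factors are closed. So the saturation of a closed set is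
  closed, even though $G_\sigma$ jumps with $\sigma$.
\<close>

lemma closed_map_sim_class:
  "closed_map (top_of_set full_rank) (subtopology M_total (sim_class ` full_rank)) sim_class"
  and quotient_map_sim_class:
  "quotient_map (top_of_set full_rank) (subtopology M_total (sim_class ` full_rank)) sim_class"
  and openin_full_rank: "openin M_total (sim_class ` full_rank)"
proof -
  have quo: "quotient_map (top_of_set total_space) M_total sim_class"
    unfolding M_total_def by (rule quotient_map_quotient_topology)
  have "openin (top_of_set total_space) full_rank"
    unfolding full_rank_eq by (intro openin_open_Int open_Times open_UNIV open_sphere_positive)
  then show op: "openin M_total (sim_class ` full_rank)"
    unfolding M_total_def openin_quotient_topology using full_rank_subset full_rank_saturated by auto
  have "quotient_map (subtopology (top_of_set total_space) full_rank) (subtopology M_total (sim_class ` full_rank)) sim_class"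
    by (rule quotient_map_restriction[OF quo]) (use op full_rank_saturated in auto)
  then show quoF: "quotient_map (top_of_set full_rank) (subtopology M_total (sim_class ` full_rank)) sim_class"
    using full_rank_subset by (simp add: subtopology_subtopology Int_absorb1)
  let ?U = "{U :: complex ^ 2 ^ 2. unitary U}"
  \<comment> \<open>The union of the groups over the full-rank points, as a closed subset of a product with a compact factor.\<close>
  define W where "W = {p \<in> ?U \<times> full_rank. fst p \<in> G (fst (snd p))}"
  have "closed {p :: (complex ^ 2 ^ 2) \<times> param_gram. transpose (fst p) ** D_mat (fst (snd p)) ** fst p = D_mat (fst (snd p))}"
    by (intro closed_Collect_eq matrix_mult_continuous_on bounded_linear.continuous_on[OF bounded_linear_transpose]
        continuous_on_compose2[OF continuous_D_mat] continuous_on_fst continuous_on_snd continuous_on_id) auto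
  moreover have "W = (?U \<times> full_rank) \<inter> {p. transpose (fst p) ** D_mat (fst (snd p)) ** fst p = D_mat (fst (snd p))}"
    by (auto simp: W_def G_def)
  ultimately have W: "closedin (top_of_set (?U \<times> full_rank)) W" by (simp add: closedin_closed_Int)
  have WF: "pair_act (fst p) (snd p) \<in> full_rank" if "p \<in> W" for p
    using that pair_act_full_rank by (auto simp: W_def)
  have cont: "continuous_on UNIV (\<lambda>p. pair_act (fst p) (snd p))"
    using isometric_matrix_action.act_continuous[OF pair_act_isometric_matrix_action] by (simp add: case_prod_unfold)
  show "closed_map (top_of_set full_rank) (subtopology M_total (sim_class ` full_rank)) sim_class"
    unfolding closed_map_def
  proof (intro allI impI)
    fix C assume C: "closedin (top_of_set full_rank) C"
    then have CF: "C \<subseteq> full_rank" using closedin_imp_subset by blast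
    have "closedin (top_of_set W) (W \<inter> (\<lambda>p. pair_act (fst p) (snd p)) -` C)"
      by (rule continuous_closedin_preimage_gen[OF continuous_on_subset[OF cont] _ C]) (use WF in auto)
    then have "closedin (top_of_set (?U \<times> full_rank)) (W \<inter> (\<lambda>p. pair_act (fst p) (snd p)) -` C)"
      using W closedin_trans by blast
    then have cl: "closedin (top_of_set full_rank) {x. \<exists>U. U \<in> ?U \<and> (U, x) \<in> W \<inter> (\<lambda>p. pair_act (fst p) (snd p)) -` C}"
      by (rule closedin_compact_projection[OF compact_unitary])
    have eq: "{x \<in> topspace (top_of_set full_rank). sim_class x \<in> sim_class ` C} =
        {x. \<exists>U. U \<in> ?U \<and> (U, x) \<in> W \<inter> (\<lambda>p. pair_act (fst p) (snd p)) -` C}"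
    proof (rule set_eqI)
      fix x :: param_gram
      have unit: "U \<in> G (fst x) \<Longrightarrow> unitary U" for U by (simp add: G_def)
      have orb: "(\<exists>y\<in>C. sim_class x = sim_class y) \<longleftrightarrow> (\<exists>U\<in>G (fst x). pair_act U x \<in> C)" if "x \<in> full_rank"
      proof -
        have "sim_class x = sim_class y \<longleftrightarrow> (\<exists>U\<in>G (fst x). y = pair_act U x)" if "y \<in> C" for y
          by (rule sim_class_eq_iff) (use that CF full_rank_subset \<open>x \<in> full_rank\<close> in blast)+
        then have "(\<exists>y\<in>C. sim_class x = sim_class y) \<longleftrightarrow> (\<exists>y\<in>C. \<exists>U\<in>G (fst x). y = pair_act U x)"
          by (intro bex_cong refl) simp
        then show ?thesis by auto
      qed
      show "x \<in> {x \<in> topspace (top_of_set full_rank). sim_class x \<in> sim_class ` C} \<longleftrightarrow>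
          x \<in> {x. \<exists>U. U \<in> ?U \<and> (U, x) \<in> W \<inter> (\<lambda>p. pair_act (fst p) (snd p)) -` C}"
      proof (cases "x \<in> full_rank")
        case True
        have "sim_class x \<in> sim_class ` C \<longleftrightarrow> (\<exists>y\<in>C. sim_class x = sim_class y)" by blast
        also have "\<dots> \<longleftrightarrow> (\<exists>U\<in>G (fst x). pair_act U x \<in> C)" by (rule orb[OF True])
        also have "\<dots> \<longleftrightarrow> (\<exists>U. U \<in> ?U \<and> (U, x) \<in> W \<inter> (\<lambda>p. pair_act (fst p) (snd p)) -` C)"
          using True unit by (auto simp: W_def)
        finally show ?thesis using True by simp
      qed (simp add: W_def)
    qed
    have "closedin (top_of_set full_rank) {x \<in> topspace (top_of_set full_rank). sim_class x \<in> sim_class ` C}"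
      by (subst eq) (rule cl)
    moreover have "sim_class ` C \<subseteq> topspace (subtopology M_total (sim_class ` full_rank))"
      unfolding quotient_imp_surjective_map[OF quoF, symmetric] using image_mono[OF CF] by simp
    ultimately show "closedin (subtopology M_total (sim_class ` full_rank)) (sim_class ` C)"
      using quoF unfolding quotient_map_closedin by blast
  qed
qed

text \<open>
  Unlike quotient maps, closed maps restrict to arbitrary saturated subsets; the strata of $\Sigma$
  are in general neither open nor closed.
\<close>

lemma quotient_map_saturated_part:
  assumes "S \<subseteq> full_rank" "\<And>x U. x \<in> S \<Longrightarrow> U \<in> G (fst x) \<Longrightarrow> pair_act U x \<in> S"
  shows "quotient_map (top_of_set S) (subtopology M_total (sim_class ` S)) sim_class"
    and "{x \<in> total_space. sim_class x \<in> sim_class ` S} = S"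
proof -
  have "x \<in> S" if "x \<in> total_space" "y \<in> S" "sim_class x = sim_class y" for x y
  proof -
    have "y \<in> total_space" using that(2) assms(1) full_rank_subset by blast
    then have "\<exists>U\<in>G (fst y). x = pair_act U y" using sim_class_eq_iff[of y x] that by simp
    then obtain U where "U \<in> G (fst y)" "x = pair_act U y" by blast
    then show ?thesis using assms(2) that(2) by blast
  qed
  then show sat: "{x \<in> total_space. sim_class x \<in> sim_class ` S} = S"
    using assms(1) full_rank_subset by blast
  then have sat': "{x \<in> topspace (top_of_set full_rank). sim_class x \<in> sim_class ` S} = S"
    using assms(1) full_rank_subset by auto
  have eq: "subtopology (top_of_set full_rank) S = top_of_set S"
    "subtopology (subtopology M_total (sim_class ` full_rank)) (sim_class ` S) = subtopology M_total (sim_class ` S)"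
    using assms(1) by (simp_all add: subtopology_subtopology Int_absorb1 image_mono)
  have clo: "closed_map (top_of_set S) (subtopology M_total (sim_class ` S)) sim_class"
    using closed_map_restriction[OF closed_map_sim_class sat'] unfolding eq .
  have cont: "continuous_map (top_of_set full_rank) (subtopology M_total (sim_class ` full_rank)) sim_class"
    by (rule quotient_imp_continuous_map[OF quotient_map_sim_class])
  have "sim_class ` S \<subseteq> topspace M_total"
    using assms(1) full_rank_subset by (auto simp: M_total_def topspace_quotient_topology)
  then show "quotient_map (top_of_set S) (subtopology M_total (sim_class ` S)) sim_class"
    using continuous_map_from_subtopology_mono[OF cont assms(1)]
    by (intro continuous_closed_imp_quotient_map clo)
       (auto simp: continuous_map_in_subtopology)
qed

text \<open>
  Openness in the stratum is checked in two steps, through the full-rank part \<open>F\<close> of the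
  stratum: the image of \<open>F\<close> is open in the stratum, and on \<open>F\<close> the stratum
  carries the quotient topology.
\<close>

proposition stratum_dim:
  assumes A: "A \<subseteq> Sigma_set" "\<rho> \<in> A" "\<And>\<sigma>. \<sigma> \<in> A \<Longrightarrow> G \<sigma> = G \<rho>"
    and B: "subspace B" "A \<subseteq> B" "openin (top_of_set B) A"
  shows "stratum_has_dim A (dim B + 25 - dim (lie \<rho>))"
proof -
  define P where "P = full_rank_free A"
  define T where "T = {x \<in> total_space. fst x \<in> A}"
  define F where "F = full_rank \<inter> T"
  have PF: "P \<subseteq> F"
    using A(1) full_rank_subset
    by (auto simp: P_def F_def T_def full_rank_free_def full_rank_def subset_iff)
  have P_act: "pair_act U x \<in> P" if "x \<in> P" "U \<in> G (fst x)" for U x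
    using that act_S_fr[of U "fst x" "snd x"] free_act[of U "fst x" "snd x"]
    by (simp add: P_def full_rank_free_def pair_act_def case_prod_unfold)
  have F_act: "pair_act U x \<in> F" if "x \<in> F" "U \<in> G (fst x)" for U x
    using that pair_act_full_rank[of x U] subsetD[OF full_rank_subset, of "pair_act U x"]
    by (simp add: F_def T_def) (simp add: pair_act_def)
  have PR: "P \<subseteq> full_rank" and FR: "F \<subseteq> full_rank" using PF by (auto simp: F_def)
  note quoP = quotient_map_saturated_part[OF PR P_act]
  note quoF = quotient_map_saturated_part[OF FR F_act]
  have ST: "stratum A = subtopology M_total (sim_class ` T)"
    unfolding stratum_def T_def by (simp add: case_prod_unfold)
  have prin: "principal_points A = P" unfolding P_def by (rule principal_points_eq[OF A(1)])
  have sub: "subtopology (stratum A) (sim_class ` S) = subtopology M_total (sim_class ` S)" if "S \<subseteq> T" for S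
    using that unfolding ST by (simp add: subtopology_subtopology Int_absorb1 image_mono)
  have FT: "F \<subseteq> T" by (simp add: F_def)
  have PT: "P \<subseteq> T" using PF FT by blast
  have "openin (top_of_set F) P"
  proof -
    have eq: "P = F \<inter> (UNIV \<times> {H. trivial_stabilizer (G \<rho>) H})"
    proof (rule set_eqI)
      fix x :: param_gram
      obtain \<sigma> H where x: "x = (\<sigma>, H)" by (cases x)
      show "x \<in> P \<longleftrightarrow> x \<in> F \<inter> (UNIV \<times> {H. trivial_stabilizer (G \<rho>) H})"
        using A(3)[of \<sigma>] subsetD[OF A(1), of \<sigma>] subsetD[OF S_fr_subset_S_red, of H \<sigma>]
        by (auto simp: x P_def F_def T_def full_rank_free_def full_rank_def total_space_def)
    qed
    show ?thesis by (subst eq, intro openin_open_Int open_Times open_UNIV open_trivial_stabilizer)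
  qed
  moreover have "{x \<in> F. sim_class x \<in> sim_class ` P} = P"
    using quoP(2) PF FR full_rank_subset by blast
  ultimately have "openin (subtopology M_total (sim_class ` F)) (sim_class ` P)"
    using quotient_map_eq_quotient_topology[OF quoF(1)] PF by (auto simp: openin_quotient_topology)
  then have "openin (subtopology (stratum A) (sim_class ` F)) (sim_class ` P)"
    by (simp only: sub[OF FT])
  moreover have "openin (stratum A) (sim_class ` F)"
  proof -
    have eq: "sim_class ` F = sim_class ` T \<inter> sim_class ` full_rank"
    proof
      show "sim_class ` T \<inter> sim_class ` full_rank \<subseteq> sim_class ` F"
        using full_rank_saturated by (auto simp: F_def T_def)
    qed (auto simp: F_def)
    show ?thesis unfolding ST eq by (rule openin_subtopology_Int2[OF openin_full_rank])
  qed
  ultimately have opn: "openin (stratum A) (sim_class ` P)" by (rule openin_trans_full)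
  have "top_of_set T closure_of P = topspace (top_of_set T)"
  proof (rule dense_top_of_set[OF _ PT])
    fix x :: param_gram and e :: real assume x: "x \<in> T" "e > 0"
    obtain \<sigma> H where \<sigma>: "x = (\<sigma>, H)" "\<sigma> \<in> A" "H \<in> S_red \<sigma>"
      using x(1) by (auto simp: T_def total_space_def)
    then obtain K where K: "K \<in> S_fr \<sigma>" "covector_det K \<noteq> 0" "dist K H < e"
      using S_fr_covector_det_dense[of \<sigma> H e] A(1) x(2) by blast
    have "(\<sigma>, K) \<in> P" using K \<sigma> covector_det_imp_free[of K \<sigma>] by (simp add: P_def full_rank_free_def)
    moreover have "dist (\<sigma>, K) x < e" using K(3) by (simp add: \<sigma>(1) dist_Pair_Pair)
    ultimately show "\<exists>y\<in>P. dist y x < e" by blast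
  qed
  moreover have "continuous_map (top_of_set T) (stratum A) sim_class"
  proof -
    have "continuous_map (top_of_set total_space) M_total sim_class"
      unfolding M_total_def by (rule quotient_imp_continuous_map[OF quotient_map_quotient_topology])
    moreover have "T \<subseteq> total_space" by (auto simp: T_def)
    ultimately have "continuous_map (top_of_set T) M_total sim_class"
      by (rule continuous_map_from_subtopology_mono)
    then show ?thesis by (simp add: ST continuous_map_in_subtopology)
  qed
  moreover have "sim_class ` topspace (top_of_set T) = topspace (stratum A)"
    unfolding ST topspace_subtopology M_total_def topspace_quotient_topology by (auto simp: T_def)
  ultimately have dense: "stratum A closure_of (sim_class ` P) = topspace (stratum A)"
    by (intro dense_image)
  have "manifold_of_dim (quotient_topology (top_of_set (full_rank_free A)) sim_class) (dim B + 25 - dim (lie \<rho>))"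
  proof (rule manifold_full_rank_free[OF A B(1), where \<upsilon> = 0])
    have "{\<tau> \<in> B. 0 + \<tau> \<in> A} = A" using B(2) by auto
    then show "openin (top_of_set B) {\<tau> \<in> B. 0 + \<tau> \<in> A}" using B(3) by simp
    show "sim_class x = sim_class y \<longleftrightarrow> (\<exists>U\<in>G (fst x). y = pair_act U x)"
      if "x \<in> full_rank_free A" "y \<in> full_rank_free A" for x y
      using that PR full_rank_subset by (intro sim_class_eq_iff) (auto simp: P_def)
  qed (use B(2) in auto)
  moreover have "subtopology (stratum A) (sim_class ` P) = quotient_topology (top_of_set P) sim_class"
    using sub[OF PT] quotient_map_eq_quotient_topology[OF quoP(1)] by (rule trans)
  ultimately have "manifold_of_dim (subtopology (stratum A) (sim_class ` P)) (dim B + 25 - dim (lie \<rho>))"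
    by (metis P_def)
  then show ?thesis
    unfolding stratum_has_dim_def dim_via_open_dense_def prin using opn dense by blast
qed

text \<open>
  For unitary $U$ the condition $U^tD_\sigma U=D_\sigma$ means $D_\sigma U=\bar UD_\sigma$, which is
  linear in the entries over the reals.
\<close>

lemma G_iff:
  "U \<in> G \<sigma> \<longleftrightarrow> unitary U \<and>
     fst \<sigma> *\<^sub>R U $ 1 $ 1 = fst \<sigma> *\<^sub>R cnj (U $ 1 $ 1) \<and> snd \<sigma> *\<^sub>R U $ 2 $ 2 = snd \<sigma> *\<^sub>R cnj (U $ 2 $ 2) \<and>
     fst \<sigma> *\<^sub>R U $ 1 $ 2 = snd \<sigma> *\<^sub>R cnj (U $ 1 $ 2) \<and> snd \<sigma> *\<^sub>R U $ 2 $ 1 = fst \<sigma> *\<^sub>R cnj (U $ 2 $ 1)"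
proof (cases "unitary U")
  case True
  let ?C = "transpose (adjoint_mat U)" and ?D = "D_mat \<sigma>"
  have C1: "?C ** transpose U = mat 1"
    by (simp only: matrix_transpose_mul[symmetric] unitary_right[OF True] transpose_mat)
  then have C2: "transpose U ** ?C = mat 1" using matrix_left_right_inverse by blast
  have "transpose U ** ?D ** U = ?D \<longleftrightarrow> ?D ** U = ?C ** ?D"
  proof
    assume "transpose U ** ?D ** U = ?D"
    then have "?C ** (transpose U ** ?D ** U) = ?C ** ?D" by simp
    then have "(?C ** transpose U) ** ?D ** U = ?C ** ?D" by (simp add: matrix_mul_assoc)
    then show "?D ** U = ?C ** ?D" by (simp add: C1)
  next
    assume "?D ** U = ?C ** ?D"
    then have "transpose U ** ?D ** U = (transpose U ** ?C) ** ?D"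
      by (simp add: matrix_mul_assoc[symmetric])
    then show "transpose U ** ?D ** U = ?D" by (simp add: C2)
  qed
  also have "\<dots> \<longleftrightarrow> fst \<sigma> *\<^sub>R U $ 1 $ 1 = fst \<sigma> *\<^sub>R cnj (U $ 1 $ 1) \<and> snd \<sigma> *\<^sub>R U $ 2 $ 2 = snd \<sigma> *\<^sub>R cnj (U $ 2 $ 2) \<and>
     fst \<sigma> *\<^sub>R U $ 1 $ 2 = snd \<sigma> *\<^sub>R cnj (U $ 1 $ 2) \<and> snd \<sigma> *\<^sub>R U $ 2 $ 1 = fst \<sigma> *\<^sub>R cnj (U $ 2 $ 1)"
    unfolding vec_eq_iff forall_2 matrix_matrix_mult_def transpose_def adjoint_mat_def vec_lambda_beta sum_2
      D_mat_def vector_2 scaleR_conv_of_real[where 'a = complex]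
    by (auto simp: mult.commute)
  finally show ?thesis using True by (simp add: G_def)
qed (simp add: G_def)

lemma scaled_cnj_eq_zero:
  assumes "0 \<le> t" "t < s" "s *\<^sub>R x = t *\<^sub>R cnj x \<or> t *\<^sub>R x = s *\<^sub>R cnj x"
  shows "x = (0 :: complex)"
proof -
  have "norm (s *\<^sub>R x) = norm (t *\<^sub>R x)" using assms(3) by (metis complex_mod_cnj norm_scaleR)
  then have "s * norm x = t * norm x" using assms by simp
  then show ?thesis using assms by simp
qed

lemma G_generic:
  assumes "\<sigma>1 > \<sigma>2" "\<sigma>2 > 0"
  shows "G (\<sigma>1, \<sigma>2) = {U. unitary U \<and> U $ 1 $ 1 = cnj (U $ 1 $ 1) \<and> U $ 2 $ 2 = cnj (U $ 2 $ 2) \<and> U $ 1 $ 2 = 0 \<and> U $ 2 $ 1 = 0}"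
  using assms scaled_cnj_eq_zero[of \<sigma>2 \<sigma>1] by (auto simp: G_iff)

lemma G_diagonal:
  assumes "\<sigma> > 0"
  shows "G (\<sigma>, \<sigma>) = {U. unitary U \<and> U $ 1 $ 1 = cnj (U $ 1 $ 1) \<and> U $ 2 $ 2 = cnj (U $ 2 $ 2) \<and>
     U $ 1 $ 2 = cnj (U $ 1 $ 2) \<and> U $ 2 $ 1 = cnj (U $ 2 $ 1)}"
  using assms by (auto simp: G_iff)

lemma G_axis:
  assumes "\<sigma> > 0"
  shows "G (\<sigma>, 0) = {U. unitary U \<and> U $ 1 $ 1 = cnj (U $ 1 $ 1) \<and> U $ 1 $ 2 = 0 \<and> U $ 2 $ 1 = 0}"
  using assms scaled_cnj_eq_zero[of 0 \<sigma>] by (auto simp: G_iff)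

lemma sigma_bound_open:
  "open {x :: real \<times> real. fst x < 1 \<and> sqrt (1 - (fst x)\<^sup>2) + sqrt (1 - (snd x)\<^sup>2) > 1}"
  by (intro open_Collect_conj open_Collect_less continuous_intros)

theorem theorem1p4:
  shows "(\<forall>\<sigma>1 \<sigma>2 :: real. (\<sigma>1, \<sigma>2) \<in> Sigma_set \<longrightarrow>
            (\<sigma>1 > \<sigma>2 \<and> \<sigma>2 > 0 \<longrightarrow> M_sigma_has_dim (\<sigma>1, \<sigma>2) 25) \<and>
            (\<sigma>1 = \<sigma>2 \<and> \<sigma>2 > 0 \<longrightarrow> M_sigma_has_dim (\<sigma>1, \<sigma>2) 24) \<and>
            (\<sigma>1 > 0 \<and> \<sigma>2 = 0 \<longrightarrow> M_sigma_has_dim (\<sigma>1, \<sigma>2) 24) \<and>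
            (\<sigma>1 = 0 \<and> \<sigma>2 = 0 \<longrightarrow> M_sigma_has_dim (\<sigma>1, \<sigma>2) 21)) \<and>
         M_total_has_dim 27 \<and>
         stratum_has_dim diagonal_params 25 \<and>
         stratum_has_dim axis_params 25 \<and>
         stratum_has_dim polynomial_params 21"
proof (intro conjI allI impI)
  fix \<sigma>1 \<sigma>2 :: real assume \<sigma>: "(\<sigma>1, \<sigma>2) \<in> Sigma_set"
  note M = M_sigma_dim[OF \<sigma>]
  show "\<sigma>1 > \<sigma>2 \<and> \<sigma>2 > 0 \<Longrightarrow> M_sigma_has_dim (\<sigma>1, \<sigma>2) 25"
    using M by (simp add: dim_lie_generic)
  show "\<sigma>1 = \<sigma>2 \<and> \<sigma>2 > 0 \<Longrightarrow> M_sigma_has_dim (\<sigma>1, \<sigma>2) 24"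
    using M by (simp add: dim_lie_diagonal)
  show "\<sigma>1 > 0 \<and> \<sigma>2 = 0 \<Longrightarrow> M_sigma_has_dim (\<sigma>1, \<sigma>2) 24"
    using M by (simp add: dim_lie_axis)
  show "\<sigma>1 = 0 \<and> \<sigma>2 = 0 \<Longrightarrow> M_sigma_has_dim (\<sigma>1, \<sigma>2) 21"
    using M by (simp add: dim_lie_zero)
next
  let ?bound = "{x :: real \<times> real. fst x < 1 \<and> sqrt (1 - (fst x)\<^sup>2) + sqrt (1 - (snd x)\<^sup>2) > 1}"
  have half: "sqrt (1 - (1 / 2 :: real)\<^sup>2) > 1 / 2" by (rule real_less_rsqrt) (simp add: power2_eq_square)
  have quarter: "sqrt (1 - (1 / 4 :: real)\<^sup>2) > 1 / 2" by (rule real_less_rsqrt) (simp add: power2_eq_square)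
  have "stratum_has_dim generic_params (dim (UNIV :: (real \<times> real) set) + 25 - dim (lie (1 / 2, 1 / 4)))"
  proof (rule stratum_dim)
    show "(1 / 2, 1 / 4) \<in> generic_params"
      using half quarter by (simp add: generic_params_def Sigma_set_def)
    show "G \<sigma> = G (1 / 2, 1 / 4)" if "\<sigma> \<in> generic_params" for \<sigma>
      using that by (cases \<sigma>) (simp add: generic_params_def G_generic)
    have "generic_params = {x. snd x > 0 \<and> snd x < fst x} \<inter> ?bound"
      by (auto simp: generic_params_def Sigma_set_def)
    moreover have "open ({x :: real \<times> real. snd x > 0 \<and> snd x < fst x} \<inter> ?bound)"
      by (intro open_Int sigma_bound_open open_Collect_conj open_Collect_less continuous_intros)
    ultimately show "openin (top_of_set UNIV) generic_params" by simp
  qed (auto simp: generic_params_def)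
  then show "M_total_has_dim 27" by (simp add: M_total_has_dim_def dim_lie_generic)
  have "stratum_has_dim diagonal_params (dim (span {(1 :: real, 1 :: real)}) + 25 - dim (lie (1 / 2, 1 / 2)))"
  proof (rule stratum_dim)
    show "(1 / 2, 1 / 2) \<in> diagonal_params"
      using half by (simp add: diagonal_params_def Sigma_set_def)
    show "G \<sigma> = G (1 / 2, 1 / 2)" if "\<sigma> \<in> diagonal_params" for \<sigma>
      using that by (cases \<sigma>) (auto simp: diagonal_params_def G_diagonal)
    have eq: "diagonal_params = span {(1 :: real, 1 :: real)} \<inter> ({x. snd x > 0} \<inter> ?bound)"
      by (auto simp: diagonal_params_def Sigma_set_def span_singleton)
    have "open ({x :: real \<times> real. snd x > 0} \<inter> ?bound)"
      by (intro open_Int sigma_bound_open open_Collect_less continuous_intros)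
    then show "openin (top_of_set (span {(1 :: real, 1 :: real)})) diagonal_params"
      by (subst eq) (rule openin_open_Int)
    show "diagonal_params \<subseteq> span {(1 :: real, 1 :: real)}" using eq by blast
  qed (auto simp: diagonal_params_def)
  then show "stratum_has_dim diagonal_params 25" by (simp add: dim_lie_diagonal zero_prod_def)
  have "stratum_has_dim axis_params (dim (span {(1 :: real, 0 :: real)}) + 25 - dim (lie (1 / 2, 0)))"
  proof (rule stratum_dim)
    show "(1 / 2, 0) \<in> axis_params"
      using half by (simp add: axis_params_def Sigma_set_def power2_eq_square)
    show "G \<sigma> = G (1 / 2, 0)" if "\<sigma> \<in> axis_params" for \<sigma>
      using that by (cases \<sigma>) (auto simp: axis_params_def G_axis)
    have eq: "axis_params = span {(1 :: real, 0 :: real)} \<inter> ({x. fst x > 0} \<inter> ?bound)"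
      by (auto simp: axis_params_def Sigma_set_def span_singleton)
    have "open ({x :: real \<times> real. fst x > 0} \<inter> ?bound)"
      by (intro open_Int sigma_bound_open open_Collect_less continuous_intros)
    then show "openin (top_of_set (span {(1 :: real, 0 :: real)})) axis_params"
      by (subst eq) (rule openin_open_Int)
    show "axis_params \<subseteq> span {(1 :: real, 0 :: real)}" using eq by blast
  qed (auto simp: axis_params_def)
  then show "stratum_has_dim axis_params 25" by (simp add: dim_lie_axis zero_prod_def)
  have "stratum_has_dim polynomial_params (dim {0 :: real \<times> real} + 25 - dim (lie (0, 0)))"
  proof (rule stratum_dim)
    show "polynomial_params \<subseteq> Sigma_set" by (simp add: polynomial_params_def Sigma_set_def)
    show "subspace {0 :: real \<times> real}" by simp
  qed (simp_all add: polynomial_params_def flip: zero_prod_def)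
  then show "stratum_has_dim polynomial_params 21" by (simp add: dim_lie_zero)
qed

end
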